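(* Let $\{V_j\}_{j\in\mathbb{Z}}$ be a multiresolution analysis in $L^2(\mathbb{Q}_p)$ and, for $j\in\mathbb{Z}$, let $W_j$ be the orthogonal complement of $V_j$ in $V_{j+1}$. Let $\psi^{(1)},\dots,\psi^{(r)}\in L^2(\mathbb{Q}_p)$ be compactly supported functions such that $$W_0=\overline{\operatorname{span}\{\psi^{(\nu)}(x-a):\ \nu=1,\dots,r,\ a\in I_p\}} .$$ Then the system $\{p^{j/2}\psi^{(\nu)}(p^{-j}x-a):\ \nu=1,\dots,r,\ a\in I_p,\ j\in\mathbb{Z}\}$ is a frame in $L^2(\mathbb{Q}_p)$.
   Context: $p$ is a prime, $\mathbb{Q}_p$ the field of $p$-adic numbers with norm $|\cdot|_p$ and Haar measure $dx$. The fractional part of $x=p^{\gamma}\sum_{j\ge0}x_jp^j$ ($x_j\in\{0,\dots,p-1\}$, $x_0\ne0$) is $\{x\}_p=p^{\gamma}\sum_{j=0}^{-\gamma-1}x_jp^j$, $\{0\}_p=0$; $I_p=\{a\in\mathbb{Q}_p:\{a\}_p=a\}$. Closures are in $L^2(\mathbb{Q}_p)$. A collection of closed subspaces $V_j\subset L^2(\mathbb{Q}_p)$, $j\in\mathbb{Z}$, is a multiresolution analysis (MRA) if: (a) $V_j\subset V_{j+1}$; (b) $\bigcup_jV_j$ is dense in $L^2(\mathbb{Q}_p)$; (c) $\bigcap_jV_j=\{0\}$; (d) $f(\cdot)\in V_j\iff f(p^{-1}\cdot)\in V_{j+1}$; (e) there is $\phi\in V_0$ with $V_0=\overline{\operatorname{span}\{\phi(x-a):a\in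 I_p\}}$. A countable system $\{f_n\}$ in a Hilbert space $H$ is a frame if there are constants $0<A\le B$ with $A\|f\|^2\le\sum_n|\langle f,f_n\rangle|^2\le B\|f\|^2$ for all $f\in H$. *)

theory Defs
  imports "HOL-Analysis.Analysis"
begin

text \<open>An element x = p^g (x_0 + x_1 p + ...) of Q_p is represented by its (unique) digit
  function d :: int => nat with x = sum_k d k * p^k, where 0 <= d k < p and d k = 0 for all
  sufficiently negative k.\<close>

definition qp :: "nat \<Rightarrow> (int \<Rightarrow> nat) set" where
  "qp p = {x. (\<forall>k. x k < p) \<and> (\<exists>N. \<forall>k<N. x k = 0)}"

text \<open>Carries for digit-wise addition, starting at a position M below both supports.\<close>
fun qp_carry :: "nat \<Rightarrow> (int \<Rightarrow> nat) \<Rightarrow> (int \<Rightarrow> nat) \<Rightarrow> int \<Rightarrow> nat \<Rightarrow> nat" where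
  "qp_carry p x y M 0 = 0"
| "qp_carry p x y M (Suc n) = (x (M + int n) + y (M + int n) + qp_carry p x y M n) div p"

definition qp_add :: "nat \<Rightarrow> (int \<Rightarrow> nat) \<Rightarrow> (int \<Rightarrow> nat) \<Rightarrow> (int \<Rightarrow> nat)" where
  "qp_add p x y =
     (let M = (SOME N. \<forall>k<N. x k = 0 \<and> y k = 0)
      in (\<lambda>k. if k < M then 0 else (x k + y k + qp_carry p x y M (nat (k - M))) mod p))"

definition qp_diff :: "nat \<Rightarrow> (int \<Rightarrow> nat) \<Rightarrow> (int \<Rightarrow> nat) \<Rightarrow> (int \<Rightarrow> nat)" where
  "qp_diff p x a = (THE z. z \<in> qp p \<and> qp_add p z a = x)"

text \<open>Multiplication by p^(-j): shift of digits.  (qp_scale p j x) represents p^(-j) x.\<close>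
definition qp_scale :: "nat \<Rightarrow> int \<Rightarrow> (int \<Rightarrow> nat) \<Rightarrow> (int \<Rightarrow> nat)" where
  "qp_scale p j x = (\<lambda>k. x (k + j))"

definition qp_norm :: "nat \<Rightarrow> (int \<Rightarrow> nat) \<Rightarrow> real" where
  "qp_norm p x = (if (\<forall>k. x k = 0) then 0
     else real p powr (- real_of_int (THE g. x g \<noteq> 0 \<and> (\<forall>k<g. x k = 0))))"

definition qp_frac :: "(int \<Rightarrow> nat) \<Rightarrow> (int \<Rightarrow> nat)" where
  "qp_frac x = (\<lambda>k. if k < 0 then x k else 0)"

definition Ip :: "nat \<Rightarrow> (int \<Rightarrow> nat) set" where
  "Ip p = {a \<in> qp p. qp_frac a = a}"

definition Zp :: "nat \<Rightarrow> (int \<Rightarrow> nat) set" where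
  "Zp p = {x \<in> qp p. qp_norm p x \<le> 1}"

text \<open>Closed balls; they generate the Borel sigma-algebra of Q_p (the topology is second
  countable and has the balls as a base).\<close>
definition qp_ball :: "nat \<Rightarrow> (int \<Rightarrow> nat) \<Rightarrow> real \<Rightarrow> (int \<Rightarrow> nat) set" where
  "qp_ball p c r = {x \<in> qp p. qp_norm p (qp_diff p x c) \<le> r}"

definition qp_borel :: "nat \<Rightarrow> (int \<Rightarrow> nat) set set" where
  "qp_borel p = sigma_sets (qp p) {qp_ball p c r | c r. c \<in> qp p \<and> r > 0}"

definition haar :: "nat \<Rightarrow> (int \<Rightarrow> nat) measure" where
  "haar p = (THE \<mu>. space \<mu> = qp p \<and> sets \<mu> = qp_borel p \<and>
      (\<forall>A\<in>qp_borel p. \<forall>a\<in>qp p. emeasure \<mu> ((\<lambda>x. qp_add p x a) ` A) = emeasure \<mu> A) \<and>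
      emeasure \<mu> (Zp p) = 1)"

definition L2 :: "nat \<Rightarrow> ((int \<Rightarrow> nat) \<Rightarrow> complex) set" where
  "L2 p = {f. f \<in> borel_measurable (haar p) \<and> integrable (haar p) (\<lambda>x. (cmod (f x))\<^sup>2)}"

definition l2_inner :: "nat \<Rightarrow> ((int \<Rightarrow> nat) \<Rightarrow> complex) \<Rightarrow> ((int \<Rightarrow> nat) \<Rightarrow> complex) \<Rightarrow> complex" where
  "l2_inner p f g = (\<integral>x. f x * cnj (g x) \<partial>haar p)"

definition l2_norm :: "nat \<Rightarrow> ((int \<Rightarrow> nat) \<Rightarrow> complex) \<Rightarrow> real" where
  "l2_norm p f = sqrt (\<integral>x. (cmod (f x))\<^sup>2 \<partial>haar p)"

definition l2_closure :: "nat \<Rightarrow> ((int \<Rightarrow> nat) \<Rightarrow> complex) set \<Rightarrow> ((int \<Rightarrow> nat) \<Rightarrow> complex) set" where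
  "l2_closure p S = {f \<in> L2 p. \<forall>e>0. \<exists>g\<in>S. l2_norm p (\<lambda>x. f x - g x) < e}"

definition lin_span :: "('a \<Rightarrow> complex) set \<Rightarrow> ('a \<Rightarrow> complex) set" where
  "lin_span S = {h. \<exists>(n::nat) c g. (\<forall>i<n. g i \<in> S) \<and> h = (\<lambda>x. \<Sum>i<n. c i * g i x)}"

text \<open>Closed (complex linear) subspace of L^2.  Closedness in the L^2 norm also makes such
  a set saturated under equality almost everywhere, so it represents a subspace of the
  Hilbert space of equivalence classes.\<close>
definition closed_subspace :: "nat \<Rightarrow> ((int \<Rightarrow> nat) \<Rightarrow> complex) set \<Rightarrow> bool" where
  "closed_subspace p S \<longleftrightarrow> S \<subseteq> L2 p \<and> (\<lambda>x. 0) \<in> S \<and>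
     (\<forall>f\<in>S. \<forall>g\<in>S. (\<lambda>x. f x + g x) \<in> S) \<and> (\<forall>c. \<forall>f\<in>S. (\<lambda>x. c * f x) \<in> S) \<and>
     l2_closure p S \<subseteq> S"

definition MRA :: "nat \<Rightarrow> (int \<Rightarrow> ((int \<Rightarrow> nat) \<Rightarrow> complex) set) \<Rightarrow> bool" where
  "MRA p V \<longleftrightarrow>
     (\<forall>j. closed_subspace p (V j)) \<and>
     (\<forall>j. V j \<subseteq> V (j + 1)) \<and>
     l2_closure p (\<Union>j. V j) = L2 p \<and>
     (\<Inter>j. V j) = {f \<in> L2 p. AE x in haar p. f x = 0} \<and>
     (\<forall>j f. f \<in> V j \<longleftrightarrow> (\<lambda>x. f (qp_scale p 1 x)) \<in> V (j + 1)) \<and>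
     (\<exists>\<phi>\<in>V 0. V 0 = l2_closure p (lin_span {(\<lambda>x. \<phi> (qp_diff p x a)) | a. a \<in> Ip p}))"

definition Wspace :: "nat \<Rightarrow> (int \<Rightarrow> ((int \<Rightarrow> nat) \<Rightarrow> complex) set) \<Rightarrow> int \<Rightarrow> ((int \<Rightarrow> nat) \<Rightarrow> complex) set" where
  "Wspace p V j = {f \<in> V (j + 1). \<forall>g\<in>V j. l2_inner p f g = 0}"

text \<open>Compact support: vanishing (a.e.) outside some closed ball, i.e. outside a compact set
  (every compact subset of Q_p is contained in a ball and balls are compact).\<close>
definition compact_support :: "nat \<Rightarrow> ((int \<Rightarrow> nat) \<Rightarrow> complex) \<Rightarrow> bool" where
  "compact_support p f \<longleftrightarrow> (\<exists>N::int. AE x in haar p. qp_norm p x > real p powr N \<longrightarrow> f x = 0)"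

definition frame :: "nat \<Rightarrow> 'i set \<Rightarrow> ('i \<Rightarrow> (int \<Rightarrow> nat) \<Rightarrow> complex) \<Rightarrow> bool" where
  "frame p I e \<longleftrightarrow> countable I \<and> (\<forall>i\<in>I. e i \<in> L2 p) \<and>
     (\<exists>A B. 0 < A \<and> A \<le> B \<and>
       (\<forall>f\<in>L2 p. (\<lambda>i. (cmod (l2_inner p f (e i)))\<^sup>2) summable_on I \<and>
          A * (l2_norm p f)\<^sup>2 \<le> (\<Sum>\<^sub>\<infinity>i\<in>I. (cmod (l2_inner p f (e i)))\<^sup>2) \<and>
          (\<Sum>\<^sub>\<infinity>i\<in>I. (cmod (l2_inner p f (e i)))\<^sup>2) \<le> B * (l2_norm p f)\<^sup>2))"

end

theory Submission
  imports Defs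
begin

text \<open>
  If the generators live in the ball of radius \<open>p\<^sup>N\<close>, their translates by \<open>a \<in> I\<^sub>p\<close> split into
  blocks according to the digits of \<open>a\<close> below position \<open>-N\<close>.  Different blocks have disjoint
  supports, and all blocks are translates of one finite family.  A finite family is a frame of its
  span, so the blocks are frames with common bounds and the translates form a frame of \<open>W\<^sub>0\<close>.
  Dilations are unitary and map \<open>W\<^sub>0\<close> to \<open>W\<^sub>j\<close>, and the projections of \<open>f\<close> to the \<open>W\<^sub>j\<close> have square
  norms adding up to that of \<open>f\<close>, by telescoping along the \<open>V\<^sub>j\<close>.

  Haar measure is the image of Lebesgue measure on \<open>[0, \<infinity>)\<close> under base-\<open>p\<close> expansion read backwards:
  the preimage of a ball of radius \<open>p\<^sup>-\<^sup>m\<close> is an interval of length \<open>p\<^sup>-\<^sup>m\<close>.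
\<close>

section \<open>Arithmetic of digit functions\<close>

text \<open>Both \<open>qp_diff\<close> and \<open>haar\<close> are definite descriptions, so
  nothing is known about translates or integrals before existence and uniqueness are proved. For
  subtraction this is done through residues: the digits below position m form the real number
  \<open>qp_trunc p m x\<close>, addition of digit functions becomes addition of these numbers
  modulo p^m, and the residues for all m determine the digits. The carry recursion is thus opened
  only once. Inside one block the generators may be linearly dependent or even vanish almost
  everywhere, so no dual family is at hand. The lower bound asks for less: the norm of a projection
  to the span must be controlled by the inner products with the generators. The upper bound does not
  use this at all; it comes from Cauchy-Schwarz on the supports and from counting how many supports
  share a point. Vectors are functions and not classes, hence projections are unique only up to null
  functions, and only their existence is used. Infinite sums over scales and translates are avoided
  until the end: every estimate is made on a finite index set, the lower one with an arbitrarily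
  small error.\<close>

definition qp_trunc :: "nat \<Rightarrow> int \<Rightarrow> (int \<Rightarrow> nat) \<Rightarrow> real" where
  "qp_trunc p m x = (\<Sum>k | k < m \<and> x k \<noteq> 0. real (x k) * real p powi k)"

text \<open>On truncations this is congruence in Z[1/p] modulo p^m, the real model of Q_p / p^m Z_p.
  Real numbers are used because m may be negative.\<close>

definition qp_cong :: "nat \<Rightarrow> int \<Rightarrow> real \<Rightarrow> real \<Rightarrow> bool" where
  "qp_cong p m u v \<longleftrightarrow> (\<exists>i::int. u - v = of_int i * real p powi m)"

text \<open>The closed ball of radius p^(-m) around \<open>c\<close>, described by digits so that
  membership is a comparison and not an arithmetic condition; \<open>qp_ball_eq\<close> gives the
  link.\<close>

definition cylinder :: "nat \<Rightarrow> int \<Rightarrow> (int \<Rightarrow> nat) \<Rightarrow> (int \<Rightarrow> nat) set" where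
  "cylinder p m c = {x \<in> qp p. \<forall>k<m. x k = c k}"

lemma qp_cong_refl [simp]: "qp_cong p m u u"
  unfolding qp_cong_def by (rule exI[of _ 0]) simp

lemma qp_cong_sym: "qp_cong p m u v \<Longrightarrow> qp_cong p m v u"
  unfolding qp_cong_def by (metis minus_diff_eq mult_minus_left of_int_minus)

lemma qp_cong_add: "qp_cong p m u v \<Longrightarrow> qp_cong p m u' v' \<Longrightarrow> qp_cong p m (u + u') (v + v')"
  unfolding qp_cong_def
proof (elim exE)
  fix i j :: int
  assume "u - v = of_int i * real p powi m" "u' - v' = of_int j * real p powi m"
  then show "\<exists>i::int. u + u' - (v + v') = of_int i * real p powi m"
    by (intro exI[of _ "i + j"]) (simp add: algebra_simps)
qed

lemma qp_cong_minus: "qp_cong p m u v \<Longrightarrow> qp_cong p m (- u) (- v)"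
  unfolding qp_cong_def
proof (elim exE)
  fix i :: int
  assume "u - v = of_int i * real p powi m"
  then show "\<exists>i::int. - u - - v = of_int i * real p powi m"
    by (intro exI[of _ "- i"]) (simp add: algebra_simps)
qed

lemma qp_cong_diff: "qp_cong p m u v \<Longrightarrow> qp_cong p m u' v' \<Longrightarrow> qp_cong p m (u - u') (v - v')"
  using qp_cong_add[OF _ qp_cong_minus] by fastforce

lemma qp_cong_trans [trans]: "qp_cong p m u v \<Longrightarrow> qp_cong p m v w \<Longrightarrow> qp_cong p m u w"
  using qp_cong_add[of p m u v v w] unfolding qp_cong_def by (simp add: algebra_simps)

section \<open>Truncations as residues, and arithmetic through them\<close>

locale digit_base =
  fixes p :: nat
  assumes p_ge_2: "2 \<le> p"
begin

lemma p_pos [simp]: "0 < p" and p_gt_1 [simp]: "1 < p" and p_gt_Suc_0 [simp]: "Suc 0 < p"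
  and p_ge_Suc_0 [simp]: "Suc 0 \<le> p"
  and p_neq_0 [simp]: "p \<noteq> 0"
  using p_ge_2 by auto

lemma powi_Suc: "real p powi (m + 1) = real p * real p powi m"
  by (simp add: power_int_add)

lemma qp_trunc_eq_sum:
  assumes "\<forall>k<N. x k = 0"
  shows "qp_trunc p m x = (\<Sum>k\<in>{N..<m}. real (x k) * real p powi k)"
  unfolding qp_trunc_def using assms
  by (intro sum.mono_neutral_left) (auto simp: not_less[symmetric])

lemma qpE:
  assumes "x \<in> qp p"
  obtains N where "\<forall>k<N. x k = 0"
  using assms unfolding qp_def by auto

lemma qp_digit: "x \<in> qp p \<Longrightarrow> x k < p"
  unfolding qp_def by auto

lemma zero_qp [simp]: "(\<lambda>k. 0) \<in> qp p"
  by (simp add: qp_def)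

lemma qp_trunc_Suc:
  assumes "x \<in> qp p"
  shows "qp_trunc p (m + 1) x = qp_trunc p m x + real (x m) * real p powi m"
proof -
  obtain N0 where N0: "\<forall>k<N0. x k = 0" using assms by (rule qpE)
  define N where "N = min N0 m"
  have N: "\<forall>k<N. x k = 0" and "N \<le> m" using N0 by (auto simp: N_def)
  have "{N..<m + 1} = insert m {N..<m}" using \<open>N \<le> m\<close> by auto
  then show ?thesis by (simp add: qp_trunc_eq_sum[OF N])
qed

lemma qp_trunc_zero: "(\<forall>k<m. x k = 0) \<Longrightarrow> qp_trunc p m x = 0"
  by (simp add: qp_trunc_eq_sum)

lemma qp_trunc_bounds:
  assumes "x \<in> qp p"
  shows "0 \<le> qp_trunc p m x" "qp_trunc p m x < real p powi m"
proof -
  show "0 \<le> qp_trunc p m x" unfolding qp_trunc_def by (intro sum_nonneg) auto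
  obtain N where N: "\<forall>k<N. x k = 0" using assms by (rule qpE)
  show "qp_trunc p m x < real p powi m"
  proof (cases "m \<le> N")
    case True
    then show ?thesis using N by (simp add: qp_trunc_zero)
  next
    case False
    then have "N \<le> m" by simp
    then show ?thesis
    proof (induction m rule: int_ge_induct)
      case base
      then show ?case using N by (simp add: qp_trunc_zero)
    next
      case (step m)
      have "real (x m) + 1 \<le> real p" using qp_digit[OF assms, of m] by linarith
      then have "(real (x m) + 1) * real p powi m \<le> real p * real p powi m"
        by (intro mult_right_mono) auto
      then show ?case using step.IH unfolding qp_trunc_Suc[OF assms] powi_Suc by (simp add: algebra_simps)
    qed
  qed
qed

text \<open>Both truncations lie in the interval from 0 to p^m, right end excluded, so a multiple of
  p^m can be their difference only if it is 0.\<close>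

lemma qp_cong_trunc_imp_eq:
  assumes "x \<in> qp p" "y \<in> qp p" "qp_cong p m (qp_trunc p m x) (qp_trunc p m y)"
  shows "qp_trunc p m x = qp_trunc p m y"
proof -
  obtain i :: int where i: "qp_trunc p m x - qp_trunc p m y = of_int i * real p powi m"
    using assms(3) unfolding qp_cong_def by auto
  have "\<bar>of_int i * real p powi m\<bar> < real p powi m"
    unfolding i[symmetric] using qp_trunc_bounds[OF assms(1), of m] qp_trunc_bounds[OF assms(2), of m] by linarith
  then have "\<bar>of_int i\<bar> < (1::real)" by (simp add: abs_mult)
  then have "i = 0" by linarith
  then show ?thesis using i by simp
qed

lemma qp_cong_mono:
  assumes "k \<le> m" "qp_cong p m u v"
  shows "qp_cong p k u v"
proof -
  obtain i :: int where i: "u - v = of_int i * real p powi m"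
    using assms(2) unfolding qp_cong_def by auto
  have "real p powi m = real p powi k * real p powi (int (nat (m - k)))"
    using assms(1) by (subst power_int_add[symmetric]) auto
  also have "real p powi (int (nat (m - k))) = real p ^ nat (m - k)"
    by (rule power_int_of_nat)
  finally have "u - v = of_int (i * int p ^ nat (m - k)) * real p powi k"
    using i by simp
  then show ?thesis unfolding qp_cong_def by blast
qed

lemma qp_cong_trunc_le:
  assumes "k \<le> m" "x \<in> qp p"
  shows "qp_cong p k (qp_trunc p m x) (qp_trunc p k x)"
  using assms(1)
proof (induction m rule: int_ge_induct)
  case (step m)
  have "qp_cong p m (qp_trunc p (m + 1) x) (qp_trunc p m x)"
    unfolding qp_cong_def qp_trunc_Suc[OF assms(2)] by (rule exI[of _ "int (x m)"]) simp
  then show ?case using qp_cong_mono[OF step.hyps] qp_cong_trans step.IH by blast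
qed simp

text \<open>A congruence at m descends to every smaller position, where it is an equality of
  truncations; the digit at k is then recovered from the truncations at k and k + 1. This turns
  arithmetic statements into digit comparisons.\<close>

lemma qp_cong_trunc_iff:
  assumes x: "x \<in> qp p" and y: "y \<in> qp p"
  shows "qp_cong p m (qp_trunc p m x) (qp_trunc p m y) \<longleftrightarrow> (\<forall>k<m. x k = y k)"
proof
  assume cg: "qp_cong p m (qp_trunc p m x) (qp_trunc p m y)"
  have eq: "qp_trunc p k x = qp_trunc p k y" if "k \<le> m" for k
  proof (rule qp_cong_trunc_imp_eq[OF x y])
    show "qp_cong p k (qp_trunc p k x) (qp_trunc p k y)"
      using qp_cong_trans[OF qp_cong_sym[OF qp_cong_trunc_le[OF that x]]
          qp_cong_trans[OF qp_cong_mono[OF that cg] qp_cong_trunc_le[OF that y]]] .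
  qed
  show "\<forall>k<m. x k = y k"
  proof (intro allI impI)
    fix k assume "k < m"
    then have "qp_trunc p (k + 1) x = qp_trunc p (k + 1) y" "qp_trunc p k x = qp_trunc p k y" by (auto intro: eq)
    then show "x k = y k" by (simp add: qp_trunc_Suc x y)
  qed
next
  assume "\<forall>k<m. x k = y k"
  then have "qp_trunc p m x = qp_trunc p m y" unfolding qp_trunc_def by (intro sum.cong) auto
  then show "qp_cong p m (qp_trunc p m x) (qp_trunc p m y)" by simp
qed

lemma qp_eqI:
  assumes "x \<in> qp p" "y \<in> qp p" "\<And>m. qp_cong p m (qp_trunc p m x) (qp_trunc p m y)"
  shows "x = y"
proof
  fix k
  show "x k = y k" using assms(3)[of "k + 1"] qp_cong_trunc_iff[OF assms(1,2)] by auto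
qed

text \<open>Characterizes addition by its residues; later facts about \<open>qp_add\<close> rest on
  this and not on carries.\<close>

lemma qp_add_spec:
  assumes x: "x \<in> qp p" and y: "y \<in> qp p"
  shows "qp_add p x y \<in> qp p" "qp_cong p m (qp_trunc p m (qp_add p x y)) (qp_trunc p m x + qp_trunc p m y)"
proof -
  define M where "M = (SOME N. \<forall>k<N. x k = 0 \<and> y k = 0)"
  obtain N1 N2 where "\<forall>k<N1. x k = 0" "\<forall>k<N2. y k = 0" using x y by (metis qpE)
  then have "\<forall>k<min N1 N2. x k = 0 \<and> y k = 0" by auto
  then have M: "\<forall>k<M. x k = 0 \<and> y k = 0" unfolding M_def by (rule someI)
  define z where "z = (\<lambda>k. if k < M then 0 else (x k + y k + qp_carry p x y M (nat (k - M))) mod p)"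
  have z: "qp_add p x y = z" unfolding qp_add_def z_def M_def Let_def by simp
  have zqp: "z \<in> qp p" unfolding qp_def z_def by (auto intro: exI[of _ M])
  then show "qp_add p x y \<in> qp p" by (simp add: z)
  \<comment> \<open>Invariant of the carry recursion: what has not yet been written into
    \<open>z\<close> is exactly the carry, with weight p^(M + n). Modulo that power it
    disappears.\<close>
  have *: "qp_trunc p (M + int n) x + qp_trunc p (M + int n) y
      = qp_trunc p (M + int n) z + real (qp_carry p x y M n) * real p powi (M + int n)" for n
  proof (induction n)
    case 0
    then show ?case using M by (simp add: qp_trunc_zero z_def)
  next
    case (Suc n)
    define k where "k = M + int n"
    define c where "c = qp_carry p x y M n"
    have k1: "M + int (Suc n) = k + 1" by (simp add: k_def)
    have zk: "z k = (x k + y k + c) mod p" by (simp add: z_def k_def c_def)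
    have ck: "qp_carry p x y M (Suc n) = (x k + y k + c) div p" by (simp add: k_def c_def)
    have "real (x k + y k + c) = real (z k + p * qp_carry p x y M (Suc n))"
      unfolding zk ck by simp
    then have e: "real (x k) + real (y k) + real c = real (z k) + real p * real (qp_carry p x y M (Suc n))"
      by simp
    have "qp_trunc p (k + 1) x + qp_trunc p (k + 1) y
        = (qp_trunc p k x + qp_trunc p k y) + (real (x k) + real (y k)) * real p powi k"
      unfolding qp_trunc_Suc[OF x] qp_trunc_Suc[OF y] by (simp add: algebra_simps)
    also have "\<dots> = qp_trunc p k z + (real (x k) + real (y k) + real c) * real p powi k"
      using Suc.IH by (simp add: k_def c_def algebra_simps)
    also have "\<dots> = qp_trunc p (k + 1) z + real (qp_carry p x y M (Suc n)) * real p powi (k + 1)"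
      unfolding e qp_trunc_Suc[OF zqp] powi_Suc by (simp add: algebra_simps)
    finally show ?case by (simp only: k1)
  qed
  show "qp_cong p m (qp_trunc p m (qp_add p x y)) (qp_trunc p m x + qp_trunc p m y)"
  proof (cases "m < M")
    case True
    then show ?thesis using M by (simp add: z qp_trunc_zero z_def)
  next
    case False
    then have "m = M + int (nat (m - M))" by simp
    with *[of "nat (m - M)"] have
      "qp_trunc p m z - (qp_trunc p m x + qp_trunc p m y) = of_int (- int (qp_carry p x y M (nat (m - M)))) * real p powi m"
      by simp
    then show ?thesis unfolding z qp_cong_def by blast
  qed
qed

lemma qp_add_eqI:
  assumes "x \<in> qp p" "y \<in> qp p" "z \<in> qp p" "\<And>m. qp_cong p m (qp_trunc p m z) (qp_trunc p m x + qp_trunc p m y)"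
  shows "qp_add p x y = z"
proof (rule qp_eqI)
  fix m
  show "qp_cong p m (qp_trunc p m (qp_add p x y)) (qp_trunc p m z)"
    using qp_cong_trans[OF qp_add_spec(2)[OF assms(1,2)] qp_cong_sym[OF assms(4)]] .
qed (use assms qp_add_spec in auto)

lemma qp_lowest_digit:
  assumes x: "x \<in> qp p" and nz: "\<not> (\<forall>k. x k = 0)"
  obtains g where "x g \<noteq> 0" "\<And>k. k < g \<Longrightarrow> x k = 0"
proof -
  from nz obtain k0 where k0: "x k0 \<noteq> 0" by auto
  obtain N where N: "\<forall>k<N. x k = 0" using x by (rule qpE)
  define n where "n = (LEAST n. x (N + int n) \<noteq> 0)"
  define g where "g = N + int n"
  have "N \<le> k0" using N k0 by (metis not_le)
  then have "x (N + int (nat (k0 - N))) \<noteq> 0" using k0 by simp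
  then have xg: "x g \<noteq> 0" unfolding g_def n_def by (rule LeastI)
  have lt: "x k = 0" if "k < g" for k
  proof (cases "k < N")
    case False
    then have k: "k = N + int (nat (k - N))" and "nat (k - N) < n" using that by (auto simp: g_def)
    from not_less_Least[OF this(2)[unfolded n_def]] have "x (N + int (nat (k - N))) = 0" by simp
    then show ?thesis using k by simp
  qed (use N in auto)
  show ?thesis using that xg lt by blast
qed

text \<open>The p-complement of the digits: from the lowest nonzero digit on, the truncations of x
  and of its complement add up to p^m, which is 0 as a residue.\<close>

lemma neg_exists:
  assumes x: "x \<in> qp p"
  shows "\<exists>z\<in>qp p. \<forall>m. qp_cong p m (qp_trunc p m z) (- qp_trunc p m x)"
proof (cases "\<forall>k. x k = 0")
  case True
  then show ?thesis by (intro bexI[of _ x]) (auto simp: x qp_trunc_zero)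
next
  case False
  then obtain g where xg: "x g \<noteq> 0" and lt: "\<And>k. k < g \<Longrightarrow> x k = 0"
    using qp_lowest_digit[OF x] by blast
  \<comment> \<open>Only the digit at g is completed to p; the carry it produces is why the later
    ones are completed to p - 1.\<close>
  define z where "z = (\<lambda>k. if k < g then 0 else if k = g then p - x g else p - 1 - x k)"
  have zqp: "z \<in> qp p" unfolding qp_def z_def using xg by (auto intro!: exI[of _ g])
  have 1: "qp_trunc p m z + qp_trunc p m x = real p powi m" if "g + 1 \<le> m" for m
    using that
  proof (induction m rule: int_ge_induct)
    case base
    have "qp_trunc p g z = 0" "qp_trunc p g x = 0" using lt by (auto simp: qp_trunc_zero z_def)
    moreover have "real (z g) = real p - real (x g)"
      using qp_digit[OF x, of g] by (simp add: z_def of_nat_diff)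
    ultimately show ?case unfolding qp_trunc_Suc[OF zqp] qp_trunc_Suc[OF x] powi_Suc
      by (simp add: left_diff_distrib)
  next
    case (step m)
    have "real (z m) = real p - 1 - real (x m)"
      using step.hyps qp_digit[OF x, of m] by (simp add: z_def of_nat_diff)
    then show ?case using step.IH unfolding qp_trunc_Suc[OF zqp] qp_trunc_Suc[OF x] powi_Suc
      by (simp add: left_diff_distrib)
  qed
  have "qp_cong p m (qp_trunc p m z) (- qp_trunc p m x)" for m
  proof (cases "m \<le> g")
    case True
    then show ?thesis using lt by (simp add: qp_trunc_zero z_def)
  next
    case False
    then show ?thesis using 1[of m] unfolding qp_cong_def by (intro exI[of _ 1]) simp
  qed
  then show ?thesis using zqp by blast
qed

text \<open>Adding a negative of \<open>a\<close> to \<open>x\<close> gives a candidate; any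
  solution of the defining equation has the same residues, hence the same digits, so the description
  is proper.\<close>

lemma qp_diff_spec:
  assumes x: "x \<in> qp p" and a: "a \<in> qp p"
  shows "qp_diff p x a \<in> qp p" "qp_cong p m (qp_trunc p m (qp_diff p x a)) (qp_trunc p m x - qp_trunc p m a)"
proof -
  obtain b where b: "b \<in> qp p" "\<And>m. qp_cong p m (qp_trunc p m b) (- qp_trunc p m a)"
    using neg_exists[OF a] by auto
  define z where "z = qp_add p x b"
  have z: "z \<in> qp p" "qp_cong p m (qp_trunc p m z) (qp_trunc p m x - qp_trunc p m a)" for m
    using qp_add_spec[OF x b(1)] qp_cong_trans[OF _ qp_cong_add[OF qp_cong_refl b(2)]] by (auto simp: z_def)
  have "qp_diff p x a = z"
    unfolding qp_diff_def
  proof (rule the_equality)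
    show "z \<in> qp p \<and> qp_add p z a = x"
    proof
      show "qp_add p z a = x"
      proof (rule qp_add_eqI)
        fix m
        show "qp_cong p m (qp_trunc p m x) (qp_trunc p m z + qp_trunc p m a)"
          using qp_cong_add[OF z(2)[of m] qp_cong_refl[of p m "qp_trunc p m a"]] by (simp add: qp_cong_sym)
      qed (use z x a in auto)
    qed (rule z)
  next
    fix w assume w: "w \<in> qp p \<and> qp_add p w a = x"
    show "w = z"
    proof (rule qp_eqI)
      fix m
      have "qp_cong p m (qp_trunc p m x) (qp_trunc p m w + qp_trunc p m a)" using qp_add_spec(2)[of w a] w a by auto
      from qp_cong_diff[OF this qp_cong_refl[of p m "qp_trunc p m a"]]
      have "qp_cong p m (qp_trunc p m x - qp_trunc p m a) (qp_trunc p m w)" by simp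
      then show "qp_cong p m (qp_trunc p m w) (qp_trunc p m z)" using z(2) qp_cong_trans qp_cong_sym by blast
    qed (use w z in auto)
  qed
  then show "qp_diff p x a \<in> qp p" "qp_cong p m (qp_trunc p m (qp_diff p x a)) (qp_trunc p m x - qp_trunc p m a)"
    using z by auto
qed

lemma qp_diff_add:
  assumes "x \<in> qp p" "a \<in> qp p"
  shows "qp_diff p (qp_add p x a) a = x"
proof (rule qp_eqI)
  fix m
  from qp_cong_trans[OF qp_diff_spec(2)[OF qp_add_spec(1)[OF assms] assms(2), of m]
      qp_cong_diff[OF qp_add_spec(2)[OF assms, of m] qp_cong_refl[of p m "qp_trunc p m a"]]]
  show "qp_cong p m (qp_trunc p m (qp_diff p (qp_add p x a) a)) (qp_trunc p m x)" by simp
qed (use assms qp_add_spec qp_diff_spec in auto)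

lemma qp_add_diff:
  assumes "x \<in> qp p" "a \<in> qp p"
  shows "qp_add p (qp_diff p x a) a = x"
proof (rule qp_add_eqI)
  fix m
  from qp_cong_sym[OF qp_cong_add[OF qp_diff_spec(2)[OF assms, of m] qp_cong_refl[of p m "qp_trunc p m a"]]]
  show "qp_cong p m (qp_trunc p m x) (qp_trunc p m (qp_diff p x a) + qp_trunc p m a)" by simp
qed (use assms qp_diff_spec in auto)

lemma qp_diff_qp_add:
  assumes x: "x \<in> qp p" and a: "a \<in> qp p" and b: "b \<in> qp p"
  shows "qp_diff p x (qp_add p a b) = qp_diff p (qp_diff p x a) b"
proof (rule qp_eqI)
  fix m
  have "qp_cong p m (qp_trunc p m (qp_diff p x (qp_add p a b))) (qp_trunc p m x - qp_trunc p m (qp_add p a b))"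
    using qp_diff_spec(2) x qp_add_spec(1) a b by auto
  also have "qp_cong p m (qp_trunc p m x - qp_trunc p m (qp_add p a b)) (qp_trunc p m x - (qp_trunc p m a + qp_trunc p m b))"
    by (intro qp_cong_diff qp_cong_refl qp_add_spec a b)
  finally have 1: "qp_cong p m (qp_trunc p m (qp_diff p x (qp_add p a b))) (qp_trunc p m x - qp_trunc p m a - qp_trunc p m b)"
    by (simp add: algebra_simps)
  have "qp_cong p m (qp_trunc p m (qp_diff p (qp_diff p x a) b)) (qp_trunc p m (qp_diff p x a) - qp_trunc p m b)"
    by (intro qp_diff_spec x a b)
  also have "qp_cong p m (qp_trunc p m (qp_diff p x a) - qp_trunc p m b) (qp_trunc p m x - qp_trunc p m a - qp_trunc p m b)"
    by (intro qp_cong_diff qp_cong_refl qp_diff_spec x a)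
  finally show "qp_cong p m (qp_trunc p m (qp_diff p x (qp_add p a b))) (qp_trunc p m (qp_diff p (qp_diff p x a) b))"
    using 1 qp_cong_trans qp_cong_sym by blast
qed (use assms qp_add_spec qp_diff_spec in auto)

text \<open>The ball moves by \<open>a\<close> and keeps its radius. Translation invariance of the
  measure and the location of the supports both reduce to this.\<close>

lemma qp_diff_mem_cyl:
  assumes x: "x \<in> qp p" and a: "a \<in> qp p" and c: "c \<in> qp p"
  shows "qp_diff p x a \<in> cylinder p m c \<longleftrightarrow> x \<in> cylinder p m (qp_add p c a)"
proof -
  let ?u = "qp_trunc p m x" and ?v = "qp_trunc p m a" and ?w = "qp_trunc p m c"
  have "qp_diff p x a \<in> cylinder p m c \<longleftrightarrow> qp_cong p m (qp_trunc p m (qp_diff p x a)) ?w"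
    using qp_cong_trunc_iff qp_diff_spec(1) x a c unfolding cylinder_def by auto
  also have "\<dots> \<longleftrightarrow> qp_cong p m (?u - ?v) ?w"
    using qp_cong_trans qp_cong_sym qp_diff_spec(2)[OF x a, of m] by metis
  also have "\<dots> \<longleftrightarrow> qp_cong p m ?u (?w + ?v)"
    by (simp add: qp_cong_def algebra_simps)
  also have "\<dots> \<longleftrightarrow> qp_cong p m ?u (qp_trunc p m (qp_add p c a))"
    using qp_cong_trans qp_cong_sym qp_add_spec(2)[OF c a, of m] by metis
  also have "\<dots> \<longleftrightarrow> x \<in> cylinder p m (qp_add p c a)"
    using qp_cong_trunc_iff qp_add_spec(1) x a c unfolding cylinder_def by auto
  finally show ?thesis .
qed

text \<open>With lowest nonzero digit at g the norm is p^(-g), so the condition reads g \<ge> -log_p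
  r; as g is an integer, rounding the bound up loses nothing.\<close>

lemma qp_norm_le_iff:
  assumes x: "x \<in> qp p" and r: "0 < r"
  shows "qp_norm p x \<le> r \<longleftrightarrow> (\<forall>k < \<lceil>- log p r\<rceil>. x k = 0)"
proof (cases "\<forall>k. x k = 0")
  case True
  then show ?thesis using r by (simp add: qp_norm_def)
next
  case False
  then obtain g where xg: "x g \<noteq> 0" and lt: "\<And>k. k < g \<Longrightarrow> x k = 0"
    using qp_lowest_digit[OF x] by blast
  have "(THE g. x g \<noteq> 0 \<and> (\<forall>k<g. x k = 0)) = g"
  proof (rule the_equality)
    fix h assume h: "x h \<noteq> 0 \<and> (\<forall>k<h. x k = 0)"
    then have "\<not> h < g" "\<not> g < h" using xg lt by auto
    then show "h = g" by simp
  qed (use xg lt in blast)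
  then have "qp_norm p x \<le> r \<longleftrightarrow> real p powr (- real_of_int g) \<le> r"
    using False by (auto simp: qp_norm_def)
  also have "\<dots> \<longleftrightarrow> - real_of_int g \<le> log p r"
    by (rule le_log_iff[symmetric]) (use r in auto)
  also have "\<dots> \<longleftrightarrow> \<lceil>- log p r\<rceil> \<le> g"
    by (simp add: ceiling_le_iff) linarith
  also have "\<dots> \<longleftrightarrow> (\<forall>k < \<lceil>- log p r\<rceil>. x k = 0)"
    using xg lt by (metis linorder_not_le order_less_le_trans)
  finally show ?thesis .
qed

lemma cyl_zero_add: "c \<in> qp p \<Longrightarrow> qp_add p (\<lambda>k. 0) c = c"
  by (rule qp_add_eqI) (auto simp: qp_trunc_zero)

lemma qp_ball_eq:
  assumes c: "c \<in> qp p" and r: "0 < r"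
  shows "qp_ball p c r = cylinder p \<lceil>- log p r\<rceil> c"
proof -
  have "qp_norm p (qp_diff p x c) \<le> r \<longleftrightarrow> x \<in> cylinder p \<lceil>- log p r\<rceil> c" if x: "x \<in> qp p" for x
  proof -
    have "qp_norm p (qp_diff p x c) \<le> r \<longleftrightarrow> qp_diff p x c \<in> cylinder p \<lceil>- log p r\<rceil> (\<lambda>k. 0)"
      using qp_norm_le_iff[OF qp_diff_spec(1)[OF x c] r] qp_diff_spec(1)[OF x c]
      unfolding cylinder_def by blast
    then show ?thesis by (simp only: qp_diff_mem_cyl[OF x c zero_qp] cyl_zero_add[OF c])
  qed
  then show ?thesis unfolding qp_ball_def by (auto simp: cylinder_def)
qed

text \<open>A real radius matters only through an integer: r gives the position \<lceil>-log_p
  r\<rceil>, and position m is attained by the radius p^(-m).\<close>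

lemma qp_balls_eq_cyls:
  "{qp_ball p c r | c r. c \<in> qp p \<and> r > 0} = {cylinder p m c | m c. c \<in> qp p}"
proof (intro equalityI subsetI)
  fix A assume "A \<in> {cylinder p m c | m c. c \<in> qp p}"
  then obtain m c where A: "A = cylinder p m c" "c \<in> qp p" by auto
  have "- log p (real p powr (- real_of_int m)) = real_of_int m"
    using p_ge_2 by (subst log_powr_cancel) auto
  then have "A = qp_ball p c (real p powr (- real_of_int m))" using A by (simp add: qp_ball_eq)
  then show "A \<in> {qp_ball p c r | c r. c \<in> qp p \<and> r > 0}"
    using A by (intro CollectI exI[of _ c] exI[of _ "real p powr (- real_of_int m)"]) auto
qed (use qp_ball_eq in blast)

lemma qp_borel_eq: "qp_borel p = sigma_sets (qp p) {cylinder p m c | m c. c \<in> qp p}"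
  unfolding qp_borel_def qp_balls_eq_cyls ..

lemma Zp_eq: "Zp p = cylinder p 0 (\<lambda>k. 0)"
  unfolding Zp_def cylinder_def using qp_norm_le_iff[of _ 1] by auto

end

section \<open>Haar measure\<close>

context digit_base
begin

section \<open>Cylinders as a generating family, and the digit map on the half-line\<close>

lemma cyl_subset: "cylinder p m c \<subseteq> qp p"
  by (auto simp: cylinder_def)

lemma cyl_subset_iff: "m \<le> n \<Longrightarrow> e \<in> cylinder p m c \<Longrightarrow> cylinder p n e \<subseteq> cylinder p m c"
  by (auto simp: cylinder_def)

lemma qp_cover: "(\<Union>i::nat. cylinder p (- int i) (\<lambda>k. 0)) = qp p"
proof (intro equalityI subsetI)
  fix x assume x: "x \<in> qp p"
  then obtain N where N: "\<forall>k<N. x k = 0" by (rule qpE)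
  then have "x \<in> cylinder p (- int (nat (- N))) (\<lambda>k. 0)" using x by (auto simp: cylinder_def)
  then show "x \<in> (\<Union>i::nat. cylinder p (- int i) (\<lambda>k. 0))" by blast
qed (auto simp: cylinder_def)

text \<open>Two cylinders are nested or disjoint, so together with the empty set they form an
  intersection-stable generator. The balls of radius p^i exhaust the space with finite
  measure.\<close>

lemma measure_eq_on_cyl:
  assumes M: "sets M = qp_borel p" and N: "sets N = qp_borel p"
    and eq: "\<And>m c. c \<in> qp p \<Longrightarrow> emeasure M (cylinder p m c) = emeasure N (cylinder p m c)"
    and fin: "\<And>m c. c \<in> qp p \<Longrightarrow> emeasure M (cylinder p m c) \<noteq> \<infinity>"
  shows "M = N"
proof (rule measure_eqI_generator_eq)
  let ?E = "insert {} {cylinder p m c | m c. c \<in> qp p}"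
  have s: "sigma_sets (qp p) ?E = qp_borel p"
    unfolding qp_borel_eq
    by (rule sigma_sets_eqI) (auto intro: sigma_sets.Empty)
  show "Int_stable ?E"
  proof (rule Int_stableI)
    have 1: "cylinder p m c \<inter> cylinder p n d \<in> ?E" if "m \<le> n" "d \<in> qp p" for m n c d
    proof (cases "d \<in> cylinder p m c")
      case True
      then have "cylinder p n d \<subseteq> cylinder p m c" using that by (intro cyl_subset_iff)
      then have "cylinder p m c \<inter> cylinder p n d = cylinder p n d" by auto
      then show ?thesis using that(2) by auto
    next
      case False
      then have "cylinder p m c \<inter> cylinder p n d = {}" using that by (auto simp: cylinder_def)
      then show ?thesis by simp
    qed
    fix a b assume "a \<in> ?E" "b \<in> ?E"
    then consider "a = {} \<or> b = {}"
      | m c n d where "a = cylinder p m c" "b = cylinder p n d" "c \<in> qp p" "d \<in> qp p" by auto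
    then show "a \<inter> b \<in> ?E"
    proof cases
      case (2 m c n d)
      then show ?thesis using 1[of m n d c] 1[of n m c d] by (cases "m \<le> n") (auto simp: Int_commute)
    qed auto
  qed
  show "?E \<subseteq> Pow (qp p)" using cyl_subset by auto
  show "sets M = sigma_sets (qp p) ?E" "sets N = sigma_sets (qp p) ?E" using M N s by auto
  show "emeasure M X = emeasure N X" if "X \<in> ?E" for X using that eq by auto
  show "range (\<lambda>i. cylinder p (- int i) (\<lambda>k. 0)) \<subseteq> ?E" using zero_qp by blast
  show "(\<Union>i. cylinder p (- int i) (\<lambda>k. 0)) = qp p" by (rule qp_cover)
  show "emeasure M (cylinder p (- int i) (\<lambda>k. 0)) \<noteq> \<infinity>" for i by (rule fin) simp
qed

text \<open>The base-p digit of \<open>t\<close> with weight p^(-k-1) is placed at the p-adic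
  position k. The shift by one makes the unit interval, right end excluded, correspond to
  Z_p.\<close>

definition digit :: "real \<Rightarrow> int \<Rightarrow> nat" where
  "digit t k = nat (\<lfloor>t * real p powi (k + 1)\<rfloor> mod int p)"

lemma floor_powi_div: "\<lfloor>t * real p powi m\<rfloor> = \<lfloor>t * real p powi (m + 1)\<rfloor> div int p"
proof -
  have "\<lfloor>t * real p powi (m + 1)\<rfloor> div int p = \<lfloor>(t * real p powi (m + 1)) / real p\<rfloor>"
    using floor_divide_real_eq_div[of "int p" "t * real p powi (m + 1)"] by simp
  also have "(t * real p powi (m + 1)) / real p = t * real p powi m"
    by (simp add: powi_Suc)
  finally show ?thesis by simp
qed

lemma floor_powi_Suc: "\<lfloor>t * real p powi (m + 1)\<rfloor> = int p * \<lfloor>t * real p powi m\<rfloor> + int (digit t m)"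
  unfolding floor_powi_div[of t m] digit_def by simp

lemma floor_powi_mono:
  assumes "0 \<le> t" "k \<le> m"
  shows "\<lfloor>t * real p powi k\<rfloor> \<le> \<lfloor>t * real p powi m\<rfloor>"
proof (intro floor_mono mult_left_mono)
  show "real p powi k \<le> real p powi m" by (intro power_int_increasing) (use assms in auto)
qed (use assms in auto)

text \<open>Supplies a starting point for upward induction on positions, since integer positions
  have no lowest element.\<close>

lemma powi_small:
  assumes "0 \<le> (t::real)"
  shows "\<exists>K::int. K \<le> m \<and> t * real p powi K < 1"
proof -
  have "1 < real p" using p_gt_1 by simp
  then obtain n where n: "t < real p ^ n" using real_arch_pow by blast
  define K where "K = min m (- int n)"
  have "t * real p powi K \<le> t * real p powi (- int n)"
    using assms by (intro mult_left_mono power_int_increasing) (auto simp: K_def)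
  also have "\<dots> < 1"
    using n by (simp add: power_int_minus field_simps)
  finally show ?thesis by (intro exI[of _ K]) (auto simp: K_def)
qed

lemma digit_qp:
  assumes "0 \<le> t"
  shows "digit t \<in> qp p"
proof -
  obtain K where K: "t * real p powi K < 1" using powi_small[OF assms, of 0] by auto
  have "digit t k = 0" if "k < K" for k
  proof -
    have "\<lfloor>t * real p powi (k + 1)\<rfloor> \<le> \<lfloor>t * real p powi K\<rfloor>"
      using that by (intro floor_powi_mono assms) auto
    also have "\<dots> = 0" using K assms by (intro floor_unique) auto
    finally have "\<lfloor>t * real p powi (k + 1)\<rfloor> = 0" using assms by (intro antisym) auto
    then show ?thesis unfolding digit_def by (simp only:) simp
  qed
  moreover have "digit t k < p" for k
    unfolding digit_def by (simp add: nat_less_iff)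
  ultimately show ?thesis by (auto simp: qp_def)
qed

lemma digits_zero_iff:
  assumes "0 \<le> t"
  shows "(\<forall>k<m. digit t k = 0) \<longleftrightarrow> \<lfloor>t * real p powi m\<rfloor> = 0"
proof
  assume *: "\<forall>k<m. digit t k = 0"
  obtain K where K: "K \<le> m" "t * real p powi K < 1" using powi_small[OF assms, of m] by auto
  from K(1) * show "\<lfloor>t * real p powi m\<rfloor> = 0"
  proof (induction m rule: int_ge_induct)
    case base
    show ?case using K assms by (intro floor_unique) auto
  next
    case (step m)
    then show ?case unfolding floor_powi_Suc by simp
  qed
next
  assume *: "\<lfloor>t * real p powi m\<rfloor> = 0"
  show "\<forall>k<m. digit t k = 0"
  proof (intro allI impI)
    fix k assume "k < m"
    then have "\<lfloor>t * real p powi (k + 1)\<rfloor> \<le> 0"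
      unfolding *[symmetric] by (intro floor_powi_mono assms) auto
    then have "\<lfloor>t * real p powi (k + 1)\<rfloor> = 0" using assms by (intro antisym) auto
    then show "digit t k = 0" unfolding digit_def by (simp only:) simp
  qed
qed

text \<open>The number n is the integer whose base-p expansion lists the digits of \<open>c\<close>
  below m, in reversed order of significance: each further digit is appended on the right. Fixing
  the digits thus fixes one integer part.\<close>

lemma digits_eq_iff:
  assumes c: "c \<in> qp p"
  shows "\<exists>n::int\<ge>0. \<forall>t\<ge>0. (\<forall>k<m. digit t k = c k) \<longleftrightarrow> \<lfloor>t * real p powi m\<rfloor> = n"
proof -
  obtain N where N: "\<forall>k<N. c k = 0" using c by (rule qpE)
  have lo_fracs: "\<exists>n::int\<ge>0. \<forall>t\<ge>0. (\<forall>k<m. digit t k = c k) \<longleftrightarrow> \<lfloor>t * real p powi m\<rfloor> = n"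
    if "m \<le> N" for m
  proof -
    have "(\<forall>k<m. d k = c k) \<longleftrightarrow> (\<forall>k<m. d k = 0)" for d :: "int \<Rightarrow> nat"
      using N that by simp
    then show ?thesis using digits_zero_iff[of _ m] by (intro exI[of _ 0]) simp
  qed
  show ?thesis
  proof (cases "m \<le> N")
    case False
    then have "N \<le> m" by simp
    then show ?thesis
    proof (induction m rule: int_ge_induct)
      case base
      show ?case by (rule lo_fracs) simp
    next
      case (step m)
      then obtain n where n: "0 \<le> n" "\<And>t. 0 \<le> t \<Longrightarrow> (\<forall>k<m. digit t k = c k) \<longleftrightarrow> \<lfloor>t * real p powi m\<rfloor> = n"
        by blast
      \<comment> \<open>Appending a digit: quotient and remainder by p of the new integer part are
        the old integer part and the digit at m.\<close>
      have "(\<forall>k<m + 1. digit t k = c k) \<longleftrightarrow> \<lfloor>t * real p powi (m + 1)\<rfloor> = int p * n + int (c m)"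
        if t: "0 \<le> t" for t
      proof -
        let ?e = "\<lfloor>t * real p powi (m + 1)\<rfloor>"
        have dm: "int (digit t m) = ?e mod int p" unfolding digit_def by simp
        have "(\<forall>k<m + 1. digit t k = c k) \<longleftrightarrow> (\<forall>k<m. digit t k = c k) \<and> digit t m = c m"
          by (auto simp: order_le_less)
        also have "\<dots> \<longleftrightarrow> ?e div int p = n \<and> ?e mod int p = int (c m)"
          unfolding n(2)[OF t] floor_powi_div[of t m] dm[symmetric] by simp
        also have "\<dots> \<longleftrightarrow> ?e = int p * n + int (c m)"
        proof
          assume "?e div int p = n \<and> ?e mod int p = int (c m)"
          then show "?e = int p * n + int (c m)" using mult_div_mod_eq[of "int p" ?e] by metis
        qed (use qp_digit[OF c, of m] in auto)
        finally show ?thesis .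
      qed
      then show ?case using n(1) by (intro exI[of _ "int p * n + int (c m)"]) auto
    qed
  qed (rule lo_fracs)
qed

definition haar0 :: "(int \<Rightarrow> nat) measure" where
  "haar0 = distr (restrict_space lborel {0..}) (sigma (qp p) {cylinder p m c | m c. c \<in> qp p}) digit"

lemma cyls_subset_Pow: "{cylinder p m c | m c. c \<in> qp p} \<subseteq> Pow (qp p)"
  using cyl_subset by auto

lemma digit_vimage_cyl:
  assumes "c \<in> qp p"
  obtains n :: int where "0 \<le> n"
    "digit -` cylinder p m c \<inter> {0..} = {of_int n / real p powi m ..< (of_int n + 1) / real p powi m}"
proof -
  obtain n :: int where n: "0 \<le> n"
    "\<And>t. 0 \<le> t \<Longrightarrow> (\<forall>k<m. digit t k = c k) \<longleftrightarrow> \<lfloor>t * real p powi m\<rfloor> = n"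
    using digits_eq_iff[OF assms, of m] by blast
  have "t \<in> digit -` cylinder p m c \<inter> {0..} \<longleftrightarrow> 0 \<le> t \<and> \<lfloor>t * real p powi m\<rfloor> = n" for t
    using n(2)[of t] digit_qp[of t] by (auto simp: cylinder_def)
  also have "\<dots>t \<longleftrightarrow> t \<in> {of_int n / real p powi m ..< (of_int n + 1) / real p powi m}" for t
  proof -
    have "0 \<le> of_int n / real p powi m" using n(1) by simp
    then have "t \<in> {of_int n / real p powi m ..< (of_int n + 1) / real p powi m} \<Longrightarrow> 0 \<le> t"
      by simp
    then show ?thesis unfolding floor_eq_iff by (auto simp: field_simps)
  qed
  finally show ?thesis using that n(1) by blast
qed

lemma digit_measurable: "digit \<in> restrict_space lborel {0..} \<rightarrow>\<^sub>M sigma (qp p) {cylinder p m c | m c. c \<in> qp p}"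
proof (rule measurable_measure_of)
  fix y assume "y \<in> {cylinder p m c | m c. c \<in> qp p}"
  then obtain m c where y: "y = cylinder p m c" "c \<in> qp p" by auto
  obtain n :: int where n: "digit -` cylinder p m c \<inter> {0..} = {of_int n / real p powi m ..< (of_int n + 1) / real p powi m}"
    "0 \<le> n"
    using digit_vimage_cyl[OF y(2), of m] by metis
  then show "digit -` y \<inter> space (restrict_space lborel {0..}) \<in> sets (restrict_space lborel {0..})"
    unfolding y by (subst sets_restrict_space_iff) (auto simp: space_restrict_space)
qed (use cyl_subset digit_qp in \<open>auto simp: space_restrict_space\<close>)

lemma sets_haar0: "sets haar0 = qp_borel p"
  unfolding haar0_def qp_borel_eq by (simp add: cyls_subset_Pow)

lemma space_haar0: "space haar0 = qp p"
  unfolding haar0_def by (simp add: cyls_subset_Pow)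

lemma cyl_in_borel: "c \<in> qp p \<Longrightarrow> cylinder p m c \<in> qp_borel p"
  unfolding qp_borel_eq by (rule sigma_sets.Basic) auto

lemma emeasure_haar0_cyl:
  assumes c: "c \<in> qp p"
  shows "emeasure haar0 (cylinder p m c) = ennreal (real p powi (- m))"
proof -
  obtain n :: int where n: "0 \<le> n"
    "digit -` cylinder p m c \<inter> {0..} = {of_int n / real p powi m ..< (of_int n + 1) / real p powi m}"
    using digit_vimage_cyl[OF c, of m] by metis
  have "emeasure haar0 (cylinder p m c) = emeasure (restrict_space lborel {0..}) (digit -` cylinder p m c \<inter> {0..})"
    unfolding haar0_def
    by (subst emeasure_distr[OF digit_measurable]) (use c in \<open>auto simp: cyls_subset_Pow space_restrict_space\<close>)
  also have "\<dots> = emeasure lborel {of_int n / real p powi m ..< (of_int n + 1) / real p powi m}"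
    unfolding n(2) using n by (subst emeasure_restrict_space) (auto simp: order_trans[of 0 "of_int n / real p powi m"])
  also have "\<dots> = ennreal ((of_int n + 1) / real p powi m - of_int n / real p powi m)"
    by (rule emeasure_lborel_Ico) (simp add: divide_right_mono)
  also have "(of_int n + 1) / real p powi m - of_int n / real p powi m = real p powi (- m)"
    by (simp add: power_int_minus field_simps)
  finally show ?thesis .
qed

text \<open>Common criterion for translations and dilations. It takes any measure with these sets,
  since it is needed for \<open>haar0\<close> before \<open>haar\<close> is identified with
  it.\<close>

lemma measurable_qp_borel:
  assumes M: "sets M = qp_borel p" and "\<And>x. x \<in> qp p \<Longrightarrow> f x \<in> qp p"
    and "\<And>m c. c \<in> qp p \<Longrightarrow> \<exists>n d. d \<in> qp p \<and> f -` cylinder p m c \<inter> qp p = cylinder p n d"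
  shows "f \<in> M \<rightarrow>\<^sub>M M"
proof -
  have sp: "space M = qp p"
    using sets_eq_imp_space_eq[of M haar0] M by (simp add: sets_haar0 space_haar0)
  show ?thesis
  proof (rule measurable_sigma_sets[OF M[unfolded qp_borel_eq] cyls_subset_Pow])
    fix y assume "y \<in> {cylinder p m c | m c. c \<in> qp p}"
    then show "f -` y \<inter> space M \<in> sets M" unfolding sp M using assms(3) cyl_in_borel by clarify metis
  qed (use assms(2) sp in auto)
qed

lemma vimage_qp_diff_cyl:
  assumes "a \<in> qp p" "c \<in> qp p"
  shows "(\<lambda>x. qp_diff p x a) -` cylinder p m c \<inter> qp p = cylinder p m (qp_add p c a)"
  using qp_diff_mem_cyl[OF _ assms] by (auto simp: cylinder_def)

lemma measurable_qp_diff0: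
  assumes "sets M = qp_borel p" "a \<in> qp p"
  shows "(\<lambda>x. qp_diff p x a) \<in> M \<rightarrow>\<^sub>M M"
proof (rule measurable_qp_borel[OF assms(1)])
  fix m c assume c: "c \<in> qp p"
  show "\<exists>n d. d \<in> qp p \<and> (\<lambda>x. qp_diff p x a) -` cylinder p m c \<inter> qp p = cylinder p n d"
    using vimage_qp_diff_cyl[OF assms(2) c] qp_add_spec(1)[OF c assms(2)] by blast
qed (rule qp_diff_spec(1)[OF _ assms(2)])

text \<open>The preimage of a cylinder is a cylinder at the same position m, and its measure depends
  on m alone.\<close>

lemma distr_qp_diff0:
  assumes a: "a \<in> qp p"
  shows "distr haar0 haar0 (\<lambda>x. qp_diff p x a) = haar0"
proof (rule sym, rule measure_eq_on_cyl)
  fix m c assume c: "c \<in> qp p"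
  show "emeasure haar0 (cylinder p m c) = emeasure (distr haar0 haar0 (\<lambda>x. qp_diff p x a)) (cylinder p m c)"
    using cyl_in_borel[OF c] qp_add_spec(1)[OF c a]
    by (subst emeasure_distr[OF measurable_qp_diff0[OF sets_haar0 a]])
      (simp_all add: sets_haar0 space_haar0 vimage_qp_diff_cyl[OF a c] emeasure_haar0_cyl c)
qed (auto simp: sets_haar0 emeasure_haar0_cyl)

text \<open>Invariance in the definition of \<open>haar\<close> speaks of images under addition,
  while pushforward measures use preimages under subtraction.\<close>

lemma image_qp_add:
  assumes "a \<in> qp p" "A \<subseteq> qp p"
  shows "(\<lambda>x. qp_add p x a) ` A = (\<lambda>x. qp_diff p x a) -` A \<inter> qp p"
proof (intro equalityI subsetI)
  fix y assume "y \<in> (\<lambda>x. qp_add p x a) ` A"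
  then show "y \<in> (\<lambda>x. qp_diff p x a) -` A \<inter> qp p"
    using assms qp_diff_add qp_add_spec(1) by auto
next
  fix y assume "y \<in> (\<lambda>x. qp_diff p x a) -` A \<inter> qp p"
  then show "y \<in> (\<lambda>x. qp_add p x a) ` A"
    using qp_add_diff[of y a] assms by (intro image_eqI[of _ _ "qp_diff p y a"]) auto
qed

section \<open>Uniqueness of the invariant measure\<close>

lemma qp_borel_subset: "A \<in> qp_borel p \<Longrightarrow> A \<subseteq> qp p"
  using sets.sets_into_space[of A haar0] by (simp add: sets_haar0 space_haar0)

lemma cyl_image_add:
  assumes "a \<in> qp p"
  shows "(\<lambda>x. qp_add p x a) ` cylinder p m (\<lambda>k. 0) = cylinder p m a"
  using image_qp_add[OF assms cyl_subset] vimage_qp_diff_cyl[OF assms zero_qp] cyl_zero_add[OF assms]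
  by simp

lemma cyl_split:
  assumes c: "c \<in> qp p"
  shows "cylinder p m c = (\<Union>i<p. cylinder p (m + 1) (c(m := i)))"
    and "i < p \<Longrightarrow> c(m := i) \<in> qp p"
    and "disjoint_family_on (\<lambda>i. cylinder p (m + 1) (c(m := i))) {..<p}"
proof -
  show "cylinder p m c = (\<Union>i<p. cylinder p (m + 1) (c(m := i)))"
  proof (intro equalityI subsetI)
    fix x assume "x \<in> cylinder p m c"
    then have "x m < p" "x \<in> cylinder p (m + 1) (c(m := x m))"
      using qp_digit by (auto simp: cylinder_def)
    then show "x \<in> (\<Union>i<p. cylinder p (m + 1) (c(m := i)))" by blast
  next
    fix x assume "x \<in> (\<Union>i<p. cylinder p (m + 1) (c(m := i)))"
    then obtain i where x: "x \<in> qp p" "\<forall>k<m + 1. x k = (c(m := i)) k" by (auto simp: cylinder_def)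
    have "x k = c k" if "k < m" for k using x(2)[rule_format, of k] that by simp
    then show "x \<in> cylinder p m c" using x(1) by (simp add: cylinder_def)
  qed
  show "c(m := i) \<in> qp p" if "i < p"
  proof -
    obtain N where "\<forall>k<N. c k = 0" using c by (rule qpE)
    then have "\<forall>k<min N m. (c(m := i)) k = 0" by auto
    then show ?thesis using c that unfolding qp_def by (intro CollectI conjI exI[of _ "min N m"]) auto
  qed
  show "disjoint_family_on (\<lambda>i. cylinder p (m + 1) (c(m := i))) {..<p}"
    unfolding disjoint_family_on_def
  proof (intro ballI impI)
    fix i j :: nat assume "i \<noteq> j"
    moreover have "x m = i \<and> x m = j" if "x \<in> cylinder p (m + 1) (c(m := i)) \<inter> cylinder p (m + 1) (c(m := j))" for x
      using that unfolding cylinder_def by (auto dest!: spec[of _ m])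
    ultimately show "cylinder p (m + 1) (c(m := i)) \<inter> cylinder p (m + 1) (c(m := j)) = {}" by blast
  qed
qed

text \<open>By invariance the measure of a cylinder depends on its position only. Splitting it by
  the next digit into p translates gives u m = p * u (m + 1), and the normalization on Z_p gives u 0
  = 1.\<close>

lemma invariant_emeasure_cyl:
  assumes M: "sets M = qp_borel p"
    and inv: "\<forall>A\<in>qp_borel p. \<forall>a\<in>qp p. emeasure M ((\<lambda>x. qp_add p x a) ` A) = emeasure M A"
    and one: "emeasure M (Zp p) = 1" and c: "c \<in> qp p"
  shows "emeasure M (cylinder p m c) = ennreal (real p powi (- m))"
proof -
  define u :: "int \<Rightarrow> ennreal" where "u m = emeasure M (cylinder p m (\<lambda>k. 0))" for m
  have trans: "emeasure M (cylinder p m c) = u m" if "c \<in> qp p" for c m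
    using inv[rule_format, OF cyl_in_borel[OF zero_qp] that] cyl_image_add[OF that] by (simp add: u_def)
  have rec: "u m = of_nat p * u (m + 1)" for m
  proof -
    have "u m = (\<Sum>i<p. emeasure M (cylinder p (m + 1) ((\<lambda>k::int. 0::nat)(m := i))))"
      unfolding u_def
      by (subst cyl_split(1)[OF zero_qp], rule sum_emeasure[symmetric])
        (use cyl_split(2,3)[OF zero_qp] cyl_in_borel M in auto)
    also have "\<dots> = (\<Sum>i<p. u (m + 1))"
      by (intro sum.cong trans cyl_split(2)) auto
    finally show ?thesis by simp
  qed
  have "u m = ennreal (real p powi (- m))"
  proof (induction m rule: int_induct[of _ 0])
    case base
    then show ?case using one by (simp add: u_def Zp_eq)
  next
    case (step1 i)
    \<comment> \<open>Upwards the recursion yields \<open>u (i + 1)\<close> only after cancelling p,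
      which is allowed because p is neither 0 nor infinite; downwards it can be read off
      directly.\<close>
    have "of_nat p * u (i + 1) = of_nat p * ennreal (real p powi (- (i + 1)))"
    proof -
      have "real p powi (- i) = real p * real p powi (- (i + 1))"
        using powi_Suc[of "- (i + 1)"] by simp
      then show ?thesis
        using step1 rec[of i] by (simp add: ennreal_mult' ennreal_of_nat_eq_real_of_nat)
    qed
    then show ?case by (simp add: ennreal_mult_cancel_left ennreal_of_nat_eq_real_of_nat)
  next
    case (step2 i)
    have "real p powi (- (i - 1)) = real p * real p powi (- i)"
      using powi_Suc[of "- i"] by (simp add: algebra_simps)
    then show ?case
      using step2 rec[of "i - 1"] by (simp add: ennreal_mult' ennreal_of_nat_eq_real_of_nat)
  qed
  then show ?thesis by (simp add: trans c)
qed

text \<open>The description in \<open>haar\<close> is met by \<open>haar0\<close> and by nothing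
  else, so all later facts about Haar measure are facts about \<open>haar0\<close>.\<close>

lemma haar_eq: "haar p = haar0"
  unfolding haar_def
proof (rule the_equality)
  show "space haar0 = qp p \<and> sets haar0 = qp_borel p \<and>
      (\<forall>A\<in>qp_borel p. \<forall>a\<in>qp p. emeasure haar0 ((\<lambda>x. qp_add p x a) ` A) = emeasure haar0 A) \<and>
      emeasure haar0 (Zp p) = 1"
  proof (intro conjI ballI)
    fix A a assume A: "A \<in> qp_borel p" and a: "a \<in> qp p"
    have "emeasure haar0 A = emeasure (distr haar0 haar0 (\<lambda>x. qp_diff p x a)) A"
      by (simp add: distr_qp_diff0[OF a])
    also have "\<dots> = emeasure haar0 ((\<lambda>x. qp_diff p x a) -` A \<inter> qp p)"
      by (subst emeasure_distr[OF measurable_qp_diff0[OF sets_haar0 a]]) (simp_all add: sets_haar0 A space_haar0)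
    finally show "emeasure haar0 ((\<lambda>x. qp_add p x a) ` A) = emeasure haar0 A"
      by (simp add: image_qp_add[OF a qp_borel_subset[OF A]])
  qed (simp_all add: space_haar0 sets_haar0 Zp_eq emeasure_haar0_cyl)
next
  fix M :: "(int \<Rightarrow> nat) measure"
  assume M: "space M = qp p \<and> sets M = qp_borel p \<and>
      (\<forall>A\<in>qp_borel p. \<forall>a\<in>qp p. emeasure M ((\<lambda>x. qp_add p x a) ` A) = emeasure M A) \<and>
      emeasure M (Zp p) = 1"
  show "M = haar0"
    using M by (intro measure_eq_on_cyl) (auto simp: sets_haar0 emeasure_haar0_cyl invariant_emeasure_cyl)
qed

lemma sets_haar [simp]: "sets (haar p) = qp_borel p"
  and space_haar [simp]: "space (haar p) = qp p"
  and emeasure_haar_cyl: "c \<in> qp p \<Longrightarrow> emeasure (haar p) (cylinder p m c) = ennreal (real p powi (- m))"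
  and measurable_qp_diff: "a \<in> qp p \<Longrightarrow> (\<lambda>x. qp_diff p x a) \<in> haar p \<rightarrow>\<^sub>M haar p"
  and distr_qp_diff: "a \<in> qp p \<Longrightarrow> distr (haar p) (haar p) (\<lambda>x. qp_diff p x a) = haar p"
  by (simp_all add: haar_eq sets_haar0 space_haar0 emeasure_haar0_cyl measurable_qp_diff0 distr_qp_diff0)

section \<open>Dilations and Haar measure\<close>

lemma qp_scale_qp:
  assumes "x \<in> qp p"
  shows "qp_scale p j x \<in> qp p"
proof -
  obtain N where "\<forall>k<N. x k = 0" using assms by (rule qpE)
  then have "\<forall>k<N - j. x (k + j) = 0" by auto
  then show ?thesis using assms unfolding qp_def qp_scale_def by auto
qed

lemma qp_scale_scale [simp]: "qp_scale p i (qp_scale p j x) = qp_scale p (i + j) x"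
  by (simp add: qp_scale_def algebra_simps)

lemma qp_scale_0 [simp]: "qp_scale p 0 x = x"
  by (simp add: qp_scale_def)

lemma vimage_qp_scale_cyl:
  assumes "c \<in> qp p"
  shows "qp_scale p j -` cylinder p m c \<inter> qp p = cylinder p (m + j) (qp_scale p (- j) c)"
proof -
  have "(\<forall>k<m. x (k + j) = c k) \<longleftrightarrow> (\<forall>k<m + j. x k = c (k - j))" for x :: "int \<Rightarrow> nat"
  proof safe
    fix k assume "\<forall>k<m. x (k + j) = c k" "k < m + j"
    then show "x k = c (k - j)" by (auto dest: spec[of _ "k - j"])
  next
    fix k assume "\<forall>k<m + j. x k = c (k - j)" "k < m"
    then show "x (k + j) = c k" by (auto dest: spec[of _ "k + j"])
  qed
  then show ?thesis using qp_scale_qp[of _ j] by (auto simp: cylinder_def qp_scale_def)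
qed

lemma measurable_qp_scale: "qp_scale p j \<in> haar p \<rightarrow>\<^sub>M haar p"
proof (rule measurable_qp_borel[OF sets_haar])
  fix m c assume c: "c \<in> qp p"
  show "\<exists>n d. d \<in> qp p \<and> qp_scale p j -` cylinder p m c \<inter> qp p = cylinder p n d"
    using vimage_qp_scale_cyl[OF c] qp_scale_qp[OF c] by blast
qed (rule qp_scale_qp)

text \<open>The map multiplies by p^(-j), so the preimage of a ball is a ball whose position is
  larger by j, and its measure changes by the factor p^(-j).\<close>

lemma distr_qp_scale:
  "distr (haar p) (haar p) (qp_scale p j) = density (haar p) (\<lambda>_. ennreal (real p powi (- j)))"
proof (rule measure_eq_on_cyl)
  have e: "emeasure (distr (haar p) (haar p) (qp_scale p j)) (cylinder p m c) = ennreal (real p powi (- (m + j)))"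
    if c: "c \<in> qp p" for m c
    using cyl_in_borel[OF c] qp_scale_qp[OF c]
    by (subst emeasure_distr[OF measurable_qp_scale])
      (simp_all add: vimage_qp_scale_cyl[OF c] emeasure_haar_cyl)
  fix m c assume c: "c \<in> qp p"
  have "real p powi (- (m + j)) = real p powi (- j) * real p powi (- m)"
    by (subst power_int_add[symmetric]) (auto simp: algebra_simps)
  then show "emeasure (distr (haar p) (haar p) (qp_scale p j)) (cylinder p m c)
      = emeasure (density (haar p) (\<lambda>_. ennreal (real p powi (- j)))) (cylinder p m c)"
    unfolding e[OF c]
    by (subst emeasure_density_const) (use c in \<open>simp_all add: cyl_in_borel emeasure_haar_cyl ennreal_mult'\<close>)
  show "emeasure (distr (haar p) (haar p) (qp_scale p j)) (cylinder p m c) \<noteq> \<infinity>"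
    unfolding e[OF c] by simp
qed simp_all

end

section \<open>The Hilbert space of square integrable functions\<close>

lemma L2_D: "f \<in> L2 p \<Longrightarrow> f \<in> borel_measurable (haar p)"
  "f \<in> L2 p \<Longrightarrow> integrable (haar p) (\<lambda>x. (cmod (f x))\<^sup>2)"
  by (auto simp: L2_def)

lemma sum_square_le: "((a::real) + b)\<^sup>2 \<le> 2 * a\<^sup>2 + 2 * b\<^sup>2"
proof -
  have "0 \<le> (a - b)\<^sup>2" by simp
  then show ?thesis unfolding power2_eq_square by (simp add: algebra_simps)
qed

lemma L2_zero [simp]: "(\<lambda>x. 0) \<in> L2 p"
  by (simp add: L2_def)

lemma L2_add [simp]:
  assumes "f \<in> L2 p" "g \<in> L2 p"
  shows "(\<lambda>x. f x + g x) \<in> L2 p"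
proof -
  note [measurable] = L2_D(1)[OF assms(1)] L2_D(1)[OF assms(2)]
  have "integrable (haar p) (\<lambda>x. (cmod (f x + g x))\<^sup>2)"
  proof (rule Bochner_Integration.integrable_bound)
    show "integrable (haar p) (\<lambda>x. 2 * (cmod (f x))\<^sup>2 + 2 * (cmod (g x))\<^sup>2)"
      using assms by (intro Bochner_Integration.integrable_add integrable_mult_right L2_D)
    have "(cmod (f x + g x))\<^sup>2 \<le> 2 * (cmod (f x))\<^sup>2 + 2 * (cmod (g x))\<^sup>2" for x
      using order_trans[OF power_mono[OF norm_triangle_ineq norm_ge_zero] sum_square_le] .
    then show "AE x in haar p. norm ((cmod (f x + g x))\<^sup>2) \<le> norm (2 * (cmod (f x))\<^sup>2 + 2 * (cmod (g x))\<^sup>2)"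
      by simp
  qed simp
  then show ?thesis by (simp add: L2_def)
qed

lemma L2_scale [simp]:
  assumes "f \<in> L2 p"
  shows "(\<lambda>x. c * f x) \<in> L2 p"
  using assms by (auto simp: L2_def norm_mult power_mult_distrib)

lemma L2_diff [simp]:
  assumes "f \<in> L2 p" "g \<in> L2 p"
  shows "(\<lambda>x. f x - g x) \<in> L2 p"
  using L2_add[OF assms(1) L2_scale[OF assms(2), of "-1"]] by simp

lemma L2_sum [simp]:
  assumes "\<And>i. i \<in> A \<Longrightarrow> g i \<in> L2 p"
  shows "(\<lambda>x. \<Sum>i\<in>A. g i x) \<in> L2 p"
  using assms
proof (induction A rule: infinite_finite_induct)
  case (insert a A)
  then show ?case using L2_add[of "g a" p "\<lambda>x. \<Sum>i\<in>A. g i x"] by simp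
qed simp_all

section \<open>Inner product and norm\<close>

lemma integrable_inner [simp]:
  assumes "f \<in> L2 p" "g \<in> L2 p"
  shows "integrable (haar p) (\<lambda>x. f x * cnj (g x))"
proof -
  note [measurable] = L2_D(1)[OF assms(1)] L2_D(1)[OF assms(2)]
  show ?thesis
  proof (rule Bochner_Integration.integrable_bound)
    show "integrable (haar p) (\<lambda>x. (cmod (f x))\<^sup>2 + (cmod (g x))\<^sup>2)"
      using assms by (intro Bochner_Integration.integrable_add L2_D)
    have "cmod (f x * cnj (g x)) \<le> (cmod (f x))\<^sup>2 + (cmod (g x))\<^sup>2" for x
    proof -
      have "2 * (cmod (f x) * cmod (g x)) \<le> (cmod (f x))\<^sup>2 + (cmod (g x))\<^sup>2"
        using sum_squares_bound[of "cmod (f x)" "cmod (g x)"] by simp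
      moreover have "0 \<le> cmod (f x) * cmod (g x)" by simp
      ultimately show ?thesis unfolding norm_mult complex_mod_cnj by linarith
    qed
    then show "AE x in haar p. norm (f x * cnj (g x)) \<le> norm ((cmod (f x))\<^sup>2 + (cmod (g x))\<^sup>2)"
      by simp
    have [measurable]: "cnj \<in> borel_measurable borel"
      by (intro borel_measurable_continuous_onI continuous_intros)
    show "(\<lambda>x. f x * cnj (g x)) \<in> borel_measurable (haar p)" by measurable
  qed
qed

lemma inner_add_left:
  assumes "f \<in> L2 p" "g \<in> L2 p" "h \<in> L2 p"
  shows "l2_inner p (\<lambda>x. f x + g x) h = l2_inner p f h + l2_inner p g h"
  using assms unfolding l2_inner_def by (simp add: distrib_right)

lemma inner_scale_left: "l2_inner p (\<lambda>x. c * f x) h = c * l2_inner p f h"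
  unfolding l2_inner_def by (simp add: mult.assoc)

lemma inner_diff_left:
  assumes "f \<in> L2 p" "g \<in> L2 p" "h \<in> L2 p"
  shows "l2_inner p (\<lambda>x. f x - g x) h = l2_inner p f h - l2_inner p g h"
  using assms unfolding l2_inner_def by (simp add: left_diff_distrib)

lemma inner_commute: "l2_inner p g f = cnj (l2_inner p f g)"
proof -
  have "l2_inner p g f = (\<integral>x. cnj (f x * cnj (g x)) \<partial>haar p)"
    unfolding l2_inner_def by (simp add: mult.commute)
  then show ?thesis unfolding Bochner_Integration.integral_cnj l2_inner_def .
qed

lemma inner_scale_right: "l2_inner p h (\<lambda>x. c * f x) = cnj c * l2_inner p h f"
  by (subst (1 2) inner_commute) (simp add: inner_scale_left)

lemma inner_add_right:
  assumes "f \<in> L2 p" "g \<in> L2 p" "h \<in> L2 p"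
  shows "l2_inner p h (\<lambda>x. f x + g x) = l2_inner p h f + l2_inner p h g"
  by (subst (1 2 3) inner_commute) (simp add: inner_add_left assms)

lemma inner_diff_right:
  assumes "f \<in> L2 p" "g \<in> L2 p" "h \<in> L2 p"
  shows "l2_inner p h (\<lambda>x. f x - g x) = l2_inner p h f - l2_inner p h g"
  by (subst (1 2 3) inner_commute) (simp add: inner_diff_left assms)

lemma inner_zero_left [simp]: "l2_inner p (\<lambda>x. 0) h = 0"
  and inner_zero_right [simp]: "l2_inner p h (\<lambda>x. 0) = 0"
  by (simp_all add: l2_inner_def)

lemma inner_sum_left:
  assumes "\<And>i. i \<in> A \<Longrightarrow> g i \<in> L2 p" "h \<in> L2 p"
  shows "l2_inner p (\<lambda>x. \<Sum>i\<in>A. g i x) h = (\<Sum>i\<in>A. l2_inner p (g i) h)"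
  using assms
proof (induction A rule: infinite_finite_induct)
  case (insert a A)
  then show ?case using inner_add_left[of "g a" p "\<lambda>x. \<Sum>i\<in>A. g i x" h] by simp
qed simp_all

lemma inner_sum_right:
  assumes "\<And>i. i \<in> A \<Longrightarrow> g i \<in> L2 p" "h \<in> L2 p"
  shows "l2_inner p h (\<lambda>x. \<Sum>i\<in>A. g i x) = (\<Sum>i\<in>A. l2_inner p h (g i))"
  by (subst (1 2) inner_commute) (simp add: inner_sum_left assms)

lemma l2_norm_nonneg [simp]: "0 \<le> l2_norm p f"
  by (simp add: l2_norm_def)

lemma l2_norm_sq: "(l2_norm p f)\<^sup>2 = (\<integral>x. (cmod (f x))\<^sup>2 \<partial>haar p)"
  by (simp add: l2_norm_def)

lemma inner_self: "l2_inner p f f = complex_of_real ((l2_norm p f)\<^sup>2)"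
proof -
  have "l2_inner p f f = (\<integral>x. complex_of_real ((cmod (f x))\<^sup>2) \<partial>haar p)"
    unfolding l2_inner_def by (intro Bochner_Integration.integral_cong) (simp_all only: complex_norm_square)
  then show ?thesis by (simp add: l2_norm_sq del: of_real_power)
qed

lemma l2_norm_zero [simp]: "l2_norm p (\<lambda>x. 0) = 0"
  by (simp add: l2_norm_def)

lemma l2_norm_scale: "l2_norm p (\<lambda>x. c * f x) = cmod c * l2_norm p f"
  by (simp add: l2_norm_def norm_mult power_mult_distrib real_sqrt_mult)

lemma l2_norm_minus_commute: "l2_norm p (\<lambda>x. f x - g x) = l2_norm p (\<lambda>x. g x - f x)"
  by (simp add: l2_norm_def norm_minus_commute)

lemma l2_norm_AE_cong:
  assumes "f \<in> L2 p" "g \<in> L2 p" "AE x in haar p. f x = g x"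
  shows "l2_norm p f = l2_norm p g"
proof -
  have "(\<integral>x. (cmod (f x))\<^sup>2 \<partial>haar p) = (\<integral>x. (cmod (g x))\<^sup>2 \<partial>haar p)"
    using assms by (intro integral_cong_AE) (auto simp: L2_def)
  then show ?thesis by (simp add: l2_norm_def)
qed

lemma l2_norm_add_sq:
  assumes "f \<in> L2 p" "g \<in> L2 p"
  shows "(l2_norm p (\<lambda>x. f x + g x))\<^sup>2 = (l2_norm p f)\<^sup>2 + (l2_norm p g)\<^sup>2 + 2 * Re (l2_inner p f g)"
proof -
  have "complex_of_real ((l2_norm p (\<lambda>x. f x + g x))\<^sup>2)
      = l2_inner p f f + l2_inner p g g + (l2_inner p f g + cnj (l2_inner p f g))"
    unfolding inner_self[symmetric]
    using assms by (simp add: inner_add_left inner_add_right inner_commute[of p g f])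
  also have "\<dots> = complex_of_real ((l2_norm p f)\<^sup>2 + (l2_norm p g)\<^sup>2 + 2 * Re (l2_inner p f g))"
    unfolding inner_self complex_add_cnj by simp
  finally show ?thesis using of_real_eq_iff by blast
qed

lemma l2_norm_diff_sq:
  assumes "f \<in> L2 p" "g \<in> L2 p"
  shows "(l2_norm p (\<lambda>x. f x - g x))\<^sup>2 = (l2_norm p f)\<^sup>2 + (l2_norm p g)\<^sup>2 - 2 * Re (l2_inner p f g)"
  using l2_norm_add_sq[OF assms(1) L2_scale[OF assms(2), of "-1"]]
  by (simp only: inner_scale_right l2_norm_scale) simp

text \<open>The squared norm of f - s \<langle>f,g\<rangle> g is a nonnegative quadratic polynomial
  in the real number s; it is evaluated at s = 1 / v, its minimum.\<close>

lemma Cauchy_Schwarz_sq: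
  assumes f: "f \<in> L2 p" and g: "g \<in> L2 p"
  shows "(cmod (l2_inner p f g))\<^sup>2 \<le> (l2_norm p f)\<^sup>2 * (l2_norm p g)\<^sup>2"
proof (cases "l2_inner p f g = 0")
  case False
  define q where "q = (cmod (l2_inner p f g))\<^sup>2"
  define u where "u = (l2_norm p f)\<^sup>2"
  define v where "v = (l2_norm p g)\<^sup>2"
  have q: "0 < q" and u: "0 \<le> u" and v: "0 \<le> v" using False by (auto simp: q_def u_def v_def)
  have *: "0 \<le> u + s\<^sup>2 * q * v - 2 * s * q" for s :: real
  proof -
    let ?t = "complex_of_real s * l2_inner p f g"
    have "cnj (l2_inner p f g) * l2_inner p f g = complex_of_real q"
      unfolding q_def by (subst complex_norm_square) (simp add: mult.commute)
    then have "Re (l2_inner p f (\<lambda>x. ?t * g x)) = s * q"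
      unfolding inner_scale_right by (simp add: mult.assoc)
    moreover have "(l2_norm p (\<lambda>x. ?t * g x))\<^sup>2 = s\<^sup>2 * q * v"
      unfolding l2_norm_scale by (simp add: norm_mult power_mult_distrib q_def v_def)
    ultimately have "(l2_norm p (\<lambda>x. f x - ?t * g x))\<^sup>2 = u + s\<^sup>2 * q * v - 2 * s * q"
      using l2_norm_diff_sq[OF f L2_scale[OF g, of ?t]] by (simp add: u_def)
    then show ?thesis by (metis zero_le_power2)
  qed
  \<comment> \<open>A function of norm 0 need not be the zero function, so this case needs an
    argument: the polynomial would be linear with negative slope, and s = (u + 1) / q makes it
    negative.\<close>
  have "v \<noteq> 0"
  proof
    assume "v = 0"
    then have "0 \<le> u - 2 * ((u + 1) / q) * q" using *[of "(u + 1) / q"] by simp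
    then show False using q u by simp
  qed
  then have "0 < v" using v by simp
  then have "0 \<le> u - q / v" using *[of "1 / v"] by (simp add: power2_eq_square)
  then show ?thesis using \<open>0 < v\<close> unfolding q_def[symmetric] u_def[symmetric] v_def[symmetric]
    by (simp add: field_simps)
qed simp

lemma Cauchy_Schwarz:
  assumes "f \<in> L2 p" "g \<in> L2 p"
  shows "cmod (l2_inner p f g) \<le> l2_norm p f * l2_norm p g"
proof (rule power2_le_imp_le)
  show "(cmod (l2_inner p f g))\<^sup>2 \<le> (l2_norm p f * l2_norm p g)\<^sup>2"
    unfolding power_mult_distrib by (rule Cauchy_Schwarz_sq[OF assms])
qed simp

lemma l2_norm_triangle:
  assumes "f \<in> L2 p" "g \<in> L2 p"
  shows "l2_norm p (\<lambda>x. f x + g x) \<le> l2_norm p f + l2_norm p g"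
proof (rule power2_le_imp_le)
  have "Re (l2_inner p f g) \<le> l2_norm p f * l2_norm p g"
    using complex_Re_le_cmod Cauchy_Schwarz[OF assms] by (rule order_trans)
  then show "(l2_norm p (\<lambda>x. f x + g x))\<^sup>2 \<le> (l2_norm p f + l2_norm p g)\<^sup>2"
    unfolding l2_norm_add_sq[OF assms] by (simp add: power2_sum)
qed simp

lemma l2_norm_triangle_diff:
  assumes "f \<in> L2 p" "g \<in> L2 p" "h \<in> L2 p"
  shows "l2_norm p (\<lambda>x. f x - h x) \<le> l2_norm p (\<lambda>x. f x - g x) + l2_norm p (\<lambda>x. g x - h x)"
proof -
  have "(\<lambda>x. (f x - g x) + (g x - h x)) = (\<lambda>x. f x - h x)" by simp
  then show ?thesis
    using l2_norm_triangle[OF L2_diff[OF assms(1,2)] L2_diff[OF assms(2,3)]] by (simp only:)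
qed

lemma l2_pythagoras:
  assumes "f \<in> L2 p" "g \<in> L2 p" "l2_inner p f g = 0"
  shows "(l2_norm p (\<lambda>x. f x + g x))\<^sup>2 = (l2_norm p f)\<^sup>2 + (l2_norm p g)\<^sup>2"
  using l2_norm_add_sq[OF assms(1,2)] assms(3) by simp

lemma l2_pythagoras_sum:
  assumes "finite A" "\<And>i. i \<in> A \<Longrightarrow> g i \<in> L2 p"
    "\<And>i j. i \<in> A \<Longrightarrow> j \<in> A \<Longrightarrow> i \<noteq> j \<Longrightarrow> l2_inner p (g i) (g j) = 0"
  shows "(l2_norm p (\<lambda>x. \<Sum>i\<in>A. g i x))\<^sup>2 = (\<Sum>i\<in>A. (l2_norm p (g i))\<^sup>2)"
  using assms
proof (induction A)
  case (insert a A)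
  have "l2_inner p (g a) (\<lambda>x. \<Sum>i\<in>A. g i x) = (\<Sum>i\<in>A. l2_inner p (g a) (g i))"
    using insert.prems by (intro inner_sum_right) auto
  also have "\<dots> = 0" using insert by (intro sum.neutral) auto
  finally show ?case using insert l2_pythagoras[of "g a" p "\<lambda>x. \<Sum>i\<in>A. g i x"] by simp
qed simp

section \<open>Completeness\<close>

lemma ennreal_norm_sq:
  assumes "f \<in> L2 p"
  shows "(\<integral>\<^sup>+x. ennreal ((cmod (f x))\<^sup>2) \<partial>haar p) = ennreal ((l2_norm p f)\<^sup>2)"
  unfolding l2_norm_sq using assms by (intro nn_integral_eq_integral) (auto intro: L2_D)

lemma L2_I_nn:
  assumes "f \<in> borel_measurable (haar p)" "(\<integral>\<^sup>+x. ennreal ((cmod (f x))\<^sup>2) \<partial>haar p) < \<infinity>"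
  shows "f \<in> L2 p"
  unfolding L2_def using assms by (auto intro!: integrableI_bounded)

text \<open>Along a subsequence with geometrically decaying increments
  the series of increments converges absolutely almost everywhere, since
  \<open>d \<le> 2\<^sup>-\<^sup>i + 2\<^sup>i d\<^sup>2\<close> and the sum of the \<open>2\<^sup>i d\<^sub>i\<^sup>2\<close> is integrable.\<close>
lemma L2_complete:
  assumes F: "\<And>n::nat. F n \<in> L2 p"
    and cauchy: "\<And>e. 0 < e \<Longrightarrow> \<exists>N. \<forall>m\<ge>N. \<forall>n\<ge>N. l2_norm p (\<lambda>x. F m x - F n x) < e"
  obtains f where "f \<in> L2 p" "(\<lambda>n. l2_norm p (\<lambda>x. F n x - f x)) \<longlonglongrightarrow> 0"
proof -
  note [measurable] = L2_D(1)[OF F]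
  have "\<exists>N. \<forall>i. (\<forall>m\<ge>N i. \<forall>n\<ge>N i. l2_norm p (\<lambda>x. F m x - F n x) < (1/2)^i)"
    by (rule choice) (use cauchy in auto)
  then obtain N where N: "\<And>i m n. m \<ge> N i \<Longrightarrow> n \<ge> N i \<Longrightarrow> l2_norm p (\<lambda>x. F m x - F n x) < (1/2)^i"
    by blast
  \<comment> \<open>The sum makes \<open>k\<close> nondecreasing and at least \<open>N i\<close>;
    the summand i makes it at least i, so the subsequence is unbounded.\<close>
  define k where "k i = i + (\<Sum>j\<le>i. N j)" for i
  have kN: "N i \<le> k i" for i
    unfolding k_def by (rule trans_le_add2, rule member_le_sum) auto
  have kS: "k i \<le> k (Suc i)" for i by (simp add: k_def)
  have ki: "i \<le> k i" for i by (simp add: k_def)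
  define d where "d i x = cmod (F (k (Suc i)) x - F (k i) x)" for i x
  have [measurable]: "d i \<in> borel_measurable (haar p)" for i unfolding d_def by measurable
  have dn: "(\<integral>\<^sup>+x. ennreal ((d i x)\<^sup>2) \<partial>haar p) \<le> ennreal ((1/4)^i)" for i
  proof -
    have "l2_norm p (\<lambda>x. F (k (Suc i)) x - F (k i) x) \<le> (1/2)^i"
      using N[of i "k (Suc i)" "k i"] kN[of i] kS[of i] by force
    then have "(l2_norm p (\<lambda>x. F (k (Suc i)) x - F (k i) x))\<^sup>2 \<le> ((1/2)^i)\<^sup>2"
      by (intro power_mono) auto
    also have "((1/2)^i)\<^sup>2 = (1/4::real)^i"
      by (simp add: power_mult_distrib[symmetric] power2_eq_square)
    finally show ?thesis
      unfolding d_def using ennreal_norm_sq[OF L2_diff[OF F F]] by (simp add: ennreal_leI)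
  qed
  have "(\<integral>\<^sup>+x. (\<Sum>i. ennreal (2^i * (d i x)\<^sup>2)) \<partial>haar p) = (\<Sum>i. \<integral>\<^sup>+x. ennreal (2^i * (d i x)\<^sup>2) \<partial>haar p)"
    by (intro nn_integral_suminf) measurable
  also have "\<dots> \<le> (\<Sum>i. ennreal ((1/2)^i))"
  proof (intro suminf_le summableI)
    fix i
    have "(\<integral>\<^sup>+x. ennreal (2^i * (d i x)\<^sup>2) \<partial>haar p) = ennreal (2^i) * (\<integral>\<^sup>+x. ennreal ((d i x)\<^sup>2) \<partial>haar p)"
      by (subst nn_integral_cmult[symmetric]) (auto simp: ennreal_mult)
    also have "\<dots> \<le> ennreal (2^i) * ennreal ((1/4)^i)"
      by (intro mult_left_mono dn) auto
    also have "\<dots> = ennreal ((1/2)^i)"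
      by (simp add: ennreal_mult[symmetric] power_mult_distrib[symmetric])
    finally show "(\<integral>\<^sup>+x. ennreal (2^i * (d i x)\<^sup>2) \<partial>haar p) \<le> ennreal ((1/2)^i)" .
  qed
  also have "\<dots> < \<infinity>"
    unfolding infinity_ennreal_def less_top[symmetric]
    by (intro ennreal_suminf_neq_top summable_geometric) auto
  finally have "AE x in haar p. (\<Sum>i. ennreal (2^i * (d i x)\<^sup>2)) \<noteq> \<infinity>"
    by (intro nn_integral_PInf_AE) auto
  then have conv: "AE x in haar p. convergent (\<lambda>i. F (k i) x)"
  proof eventually_elim
    case (elim x)
    have 1: "summable (\<lambda>i. 2^i * (d i x)\<^sup>2)"
      using elim by (intro summable_suminf_not_top) (auto simp: infinity_ennreal_def)
    have "d i x \<le> (1/2)^i + 2^i * (d i x)\<^sup>2" for i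
    proof -
      have "0 \<le> (2^i * d i x - 1)\<^sup>2" "0 \<le> d i x * 2^i" by (auto simp: d_def)
      then have "d i x * 2^i \<le> 1 + (2^i)\<^sup>2 * (d i x)\<^sup>2"
        by (simp add: power2_eq_square algebra_simps)
      then have "(d i x * 2^i) / 2^i \<le> (1 + (2^i)\<^sup>2 * (d i x)\<^sup>2) / 2^i"
        by (intro divide_right_mono) auto
      then show ?thesis by (simp add: add_divide_distrib power2_eq_square power_one_over)
    qed
    moreover have "summable (\<lambda>i. (1/2)^i + 2^i * (d i x)\<^sup>2)"
      by (intro summable_add 1 summable_geometric) auto
    ultimately have "summable (\<lambda>i. d i x)"
      by (intro summable_comparison_test[of "\<lambda>i. d i x"]) (auto simp: d_def)
    then have "summable (\<lambda>i. F (k (Suc i)) x - F (k i) x)"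
      unfolding d_def by (rule summable_norm_cancel)
    then have "convergent (\<lambda>n. \<Sum>i<n. F (k (Suc i)) x - F (k i) x)"
      by (simp add: summable_iff_convergent)
    then have "convergent (\<lambda>n. F (k n) x - F (k 0) x)"
      unfolding sum_lessThan_telescope[of "\<lambda>i. F (k i) x"] .
    then have "convergent (\<lambda>n. (F (k n) x - F (k 0) x) + F (k 0) x)"
      by (intro convergent_add) (auto simp: convergent_const)
    then show ?case by simp
  qed
  define f where "f x = lim (\<lambda>i. F (k i) x)" for x
  have [measurable]: "f \<in> borel_measurable (haar p)" unfolding f_def by measurable
  \<comment> \<open>Fatou's lemma along the subsequence carries the Cauchy estimate over to the
    pointwise limit, for every late index n and not only for the subsequence.\<close>
  have bnd: "(\<integral>\<^sup>+x. ennreal ((cmod (F n x - f x))\<^sup>2) \<partial>haar p) \<le> ennreal (((1/2)^j)\<^sup>2)" if n: "n \<ge> N j" for n j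
  proof -
    have "(\<integral>\<^sup>+x. ennreal ((cmod (F n x - f x))\<^sup>2) \<partial>haar p)
        = (\<integral>\<^sup>+x. liminf (\<lambda>i. ennreal ((cmod (F n x - F (k i) x))\<^sup>2)) \<partial>haar p)"
    proof (rule nn_integral_cong_AE)
      show "AE x in haar p. ennreal ((cmod (F n x - f x))\<^sup>2) = liminf (\<lambda>i. ennreal ((cmod (F n x - F (k i) x))\<^sup>2))"
        using conv
      proof eventually_elim
        case (elim x)
        then have "(\<lambda>i. F (k i) x) \<longlonglongrightarrow> f x" unfolding f_def by (simp add: convergent_LIMSEQ_iff)
        then have "(\<lambda>i. ennreal ((cmod (F n x - F (k i) x))\<^sup>2)) \<longlonglongrightarrow> ennreal ((cmod (F n x - f x))\<^sup>2)"
          by (intro tendsto_intros)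
        then show ?case by (intro lim_imp_Liminf[symmetric]) auto
      qed
    qed
    also have "\<dots> \<le> liminf (\<lambda>i. \<integral>\<^sup>+x. ennreal ((cmod (F n x - F (k i) x))\<^sup>2) \<partial>haar p)"
      by (intro nn_integral_liminf) measurable
    also have "\<dots> \<le> liminf (\<lambda>i. ennreal (((1/2)^j)\<^sup>2))"
    proof (rule Liminf_mono, rule eventually_sequentiallyI[of "N j"])
      fix i assume i: "N j \<le> i"
      have "l2_norm p (\<lambda>x. F n x - F (k i) x) \<le> (1/2)^j"
        using N[of j n "k i"] n i ki[of i] by force
      then show "(\<integral>\<^sup>+x. ennreal ((cmod (F n x - F (k i) x))\<^sup>2) \<partial>haar p) \<le> ennreal (((1/2)^j)\<^sup>2)"
        unfolding ennreal_norm_sq[OF L2_diff[OF F F]] by (intro ennreal_leI power_mono) auto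
    qed
    also have "\<dots> = ennreal (((1/2)^j)\<^sup>2)" by (simp add: Liminf_const)
    finally show ?thesis .
  qed
  have FfL2: "(\<lambda>x. F (N 0) x - f x) \<in> L2 p"
    using bnd[of 0 "N 0"] by (intro L2_I_nn) (auto simp: le_less_trans)
  have fL2: "f \<in> L2 p" using L2_diff[OF F[of "N 0"] FfL2] by simp
  have le: "l2_norm p (\<lambda>x. F n x - f x) \<le> (1/2)^j" if "n \<ge> N j" for n j
  proof (rule power2_le_imp_le)
    show "(l2_norm p (\<lambda>x. F n x - f x))\<^sup>2 \<le> ((1/2)^j)\<^sup>2"
      using bnd[OF that] unfolding ennreal_norm_sq[OF L2_diff[OF F fL2]]
      by (subst (asm) ennreal_le_iff) auto
  qed simp
  have "(\<lambda>n. l2_norm p (\<lambda>x. F n x - f x)) \<longlonglongrightarrow> 0"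
  proof (rule LIMSEQ_I)
    fix e :: real assume "0 < e"
    then obtain j where "(1/2)^j < e" using real_arch_pow_inv[of e "1/2"] by auto
    then have "\<forall>n\<ge>N j. norm (l2_norm p (\<lambda>x. F n x - f x) - 0) < e" using le by force
    then show "\<exists>no. \<forall>n\<ge>no. norm (l2_norm p (\<lambda>x. F n x - f x) - 0) < e" by blast
  qed
  then show ?thesis using that fL2 by blast
qed

section \<open>Closed subspaces and orthogonal projections\<close>

lemma closed_subspaceD:
  assumes "closed_subspace p S"
  shows "S \<subseteq> L2 p" "(\<lambda>x. 0) \<in> S" "f \<in> S \<Longrightarrow> g \<in> S \<Longrightarrow> (\<lambda>x. f x + g x) \<in> S"
    "f \<in> S \<Longrightarrow> (\<lambda>x. c * f x) \<in> S" "f \<in> l2_closure p S \<Longrightarrow> f \<in> S"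
  using assms unfolding closed_subspace_def by auto

lemma closed_subspace_diff:
  assumes "closed_subspace p S" "f \<in> S" "g \<in> S"
  shows "(\<lambda>x. f x - g x) \<in> S"
  using closed_subspaceD(3)[OF assms(1,2) closed_subspaceD(4)[OF assms(1,3), of "-1"]] by simp

lemma closed_subspace_limit:
  assumes S: "closed_subspace p S" and F: "\<And>n. F n \<in> S" and f: "f \<in> L2 p"
    and lim: "(\<lambda>n. l2_norm p (\<lambda>x. F n x - f x)) \<longlonglongrightarrow> 0"
  shows "f \<in> S"
proof (rule closed_subspaceD(5)[OF S])
  have "\<exists>g\<in>S. l2_norm p (\<lambda>x. f x - g x) < e" if "0 < e" for e
  proof -
    have "\<exists>n. l2_norm p (\<lambda>x. F n x - f x) < e"
      using LIMSEQ_D[OF lim that] by auto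
    then show ?thesis using F l2_norm_minus_commute by metis
  qed
  then show "f \<in> l2_closure p S" using f by (simp add: l2_closure_def)
qed

text \<open>A minimizing sequence for the distance from \<open>f\<close> to \<open>S\<close> is
  Cauchy by the parallelogram law; its limit attains the minimum, and minimality forces the
  difference to be orthogonal to \<open>S\<close>.\<close>

lemma projection_exists:
  assumes S: "closed_subspace p S" and f: "f \<in> L2 p"
  obtains g where "g \<in> S" "\<And>h. h \<in> S \<Longrightarrow> l2_inner p (\<lambda>x. f x - g x) h = 0"
proof -
  note SL = subsetD[OF closed_subspaceD(1)[OF S]]
  define D where "D = (\<lambda>g. (l2_norm p (\<lambda>x. f x - g x))\<^sup>2) ` S"
  define dd where "dd = Inf D"
  have bdd: "bdd_below D" unfolding D_def by (intro bdd_belowI[of _ 0]) auto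
  have ne: "D \<noteq> {}" using closed_subspaceD(2)[OF S] by (auto simp: D_def)
  have lb: "dd \<le> (l2_norm p (\<lambda>x. f x - g x))\<^sup>2" if "g \<in> S" for g
    unfolding dd_def using that by (intro cInf_lower bdd) (auto simp: D_def)
  have "\<exists>g\<in>S. (l2_norm p (\<lambda>x. f x - g x))\<^sup>2 < dd + inverse (real (Suc n))" for n
  proof -
    have "dd < dd + inverse (real (Suc n))" by simp
    then obtain u where "u \<in> D" "u < dd + inverse (real (Suc n))"
      unfolding dd_def using cInf_lessD[OF ne] by blast
    then show ?thesis by (auto simp: D_def)
  qed
  then obtain G where GS: "\<And>n. G n \<in> S"
    and G: "\<And>n. (l2_norm p (\<lambda>x. f x - G n x))\<^sup>2 < dd + inverse (real (Suc n))"
    by metis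
  note GL = SL[OF GS]
  \<comment> \<open>Parallelogram law for f - G m and f - G n: their sum is twice the difference of
    f and the midpoint, which lies in \<open>S\<close> and so is at distance at least sqrt
    dd.\<close>
  have par: "(l2_norm p (\<lambda>x. G m x - G n x))\<^sup>2 \<le> 2 * inverse (real (Suc m)) + 2 * inverse (real (Suc n))" for m n
  proof -
    define u where "u = (\<lambda>x. f x - G m x)"
    define v where "v = (\<lambda>x. f x - G n x)"
    have uv: "u \<in> L2 p" "v \<in> L2 p" using f GL by (auto simp: u_def v_def)
    let ?h = "\<lambda>x. (1/2) * (G m x + G n x)"
    have hS: "?h \<in> S" by (intro closed_subspaceD(4)[OF S] closed_subspaceD(3)[OF S] GS)
    have "(\<lambda>x. u x + v x) = (\<lambda>x. 2 * (f x - ?h x))"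
      by (rule ext) (simp add: u_def v_def field_simps)
    then have 1: "(l2_norm p (\<lambda>x. u x + v x))\<^sup>2 = 4 * (l2_norm p (\<lambda>x. f x - ?h x))\<^sup>2"
      by (simp only: l2_norm_scale) (simp add: power_mult_distrib)
    have 2: "l2_norm p (\<lambda>x. G m x - G n x) = l2_norm p (\<lambda>x. u x - v x)"
      unfolding u_def v_def using l2_norm_minus_commute[of p "G m" "G n"] by simp
    have "(l2_norm p (\<lambda>x. u x - v x))\<^sup>2 + (l2_norm p (\<lambda>x. u x + v x))\<^sup>2
        = 2 * (l2_norm p u)\<^sup>2 + 2 * (l2_norm p v)\<^sup>2"
      unfolding l2_norm_add_sq[OF uv] l2_norm_diff_sq[OF uv] by simp
    then show ?thesis
      using lb[OF hS] G[of m] G[of n] unfolding 1 2 u_def[symmetric] v_def[symmetric] by linarith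
  qed
  have cau: "\<exists>N. \<forall>m\<ge>N. \<forall>n\<ge>N. l2_norm p (\<lambda>x. G m x - G n x) < e" if e: "0 < e" for e
  proof -
    have "0 < e\<^sup>2 / 4" using e by simp
    then obtain N where N: "inverse (real (Suc N)) < e\<^sup>2 / 4" using reals_Archimedean by blast
    have "l2_norm p (\<lambda>x. G m x - G n x) < e" if mn: "m \<ge> N" "n \<ge> N" for m n
    proof (rule power2_less_imp_less)
      have "inverse (real (Suc m)) \<le> inverse (real (Suc N))" "inverse (real (Suc n)) \<le> inverse (real (Suc N))"
        using mn by (auto intro!: le_imp_inverse_le)
      then show "(l2_norm p (\<lambda>x. G m x - G n x))\<^sup>2 < e\<^sup>2" using par[of m n] N by linarith
    qed (use e in simp)
    then show ?thesis by blast
  qed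
  obtain g where g: "g \<in> L2 p" and lim: "(\<lambda>n. l2_norm p (\<lambda>x. G n x - g x)) \<longlonglongrightarrow> 0"
    by (rule L2_complete[OF GL cau])
  have gS: "g \<in> S" by (rule closed_subspace_limit[OF S GS g lim])
  have min: "(l2_norm p (\<lambda>x. f x - g x))\<^sup>2 \<le> dd"
  proof (rule LIMSEQ_le_const)
    have l1: "(\<lambda>n. sqrt (dd + inverse (real (Suc n))) + l2_norm p (\<lambda>x. G n x - g x)) \<longlonglongrightarrow> sqrt (dd + 0) + 0"
      by (intro tendsto_intros lim LIMSEQ_inverse_real_of_nat)
    then show "(\<lambda>n. (sqrt (dd + inverse (real (Suc n))) + l2_norm p (\<lambda>x. G n x - g x))\<^sup>2) \<longlonglongrightarrow> dd"
    proof -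
      have "0 \<le> dd" unfolding dd_def by (intro cInf_greatest ne) (auto simp: D_def)
      then show ?thesis using tendsto_power[OF l1, of 2] by simp
    qed
    have "l2_norm p (\<lambda>x. f x - g x) \<le> sqrt (dd + inverse (real (Suc n))) + l2_norm p (\<lambda>x. G n x - g x)" for n
    proof -
      have "l2_norm p (\<lambda>x. f x - G n x) \<le> sqrt (dd + inverse (real (Suc n)))"
        using G[of n] by (intro real_le_rsqrt) simp
      then show ?thesis using l2_norm_triangle_diff[OF f GL[of n] g] by linarith
    qed
    then show "\<exists>N. \<forall>n\<ge>N. (l2_norm p (\<lambda>x. f x - g x))\<^sup>2
        \<le> (sqrt (dd + inverse (real (Suc n))) + l2_norm p (\<lambda>x. G n x - g x))\<^sup>2"
      by (intro exI[of _ 0] allI impI power_mono l2_norm_nonneg)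
  qed
  have "l2_inner p (\<lambda>x. f x - g x) h = 0" if hS: "h \<in> S" for h
  proof -
    define u where "u = (\<lambda>x. f x - g x)"
    have u: "u \<in> L2 p" and h: "h \<in> L2 p" using f g SL[OF hS] by (auto simp: u_def)
    show ?thesis
    proof (cases "l2_norm p h = 0")
      case True
      then show ?thesis using Cauchy_Schwarz[OF u h] unfolding u_def by simp
    next
      case False
      define n where "n = (l2_norm p h)\<^sup>2"
      have n: "0 < n" using False by (simp add: n_def)
      define I where "I = l2_inner p u h"
      let ?t = "I / complex_of_real n"
      \<comment> \<open>The coefficient \<open>?t\<close> gives the best correction of g along h; it
        would lower the squared distance by |I|^2 / n, so minimality leaves I = 0.\<close>
      have "dd \<le> (l2_norm p (\<lambda>x. u x - ?t * h x))\<^sup>2"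
        using lb[OF closed_subspaceD(3)[OF S gS closed_subspaceD(4)[OF S hS, of ?t]]]
        by (simp add: u_def diff_diff_eq)
      also have "\<dots> = (l2_norm p u)\<^sup>2 + (cmod ?t * l2_norm p h)\<^sup>2 - 2 * Re (cnj ?t * I)"
        unfolding l2_norm_diff_sq[OF u L2_scale[OF h]] l2_norm_scale inner_scale_right I_def ..
      also have "(cmod ?t * l2_norm p h)\<^sup>2 = (cmod I)\<^sup>2 / n"
        using n by (simp add: norm_divide power_mult_distrib power_divide n_def[symmetric]) (simp add: power2_eq_square)
      also have "cnj ?t * I = complex_of_real ((cmod I)\<^sup>2 / n)"
        using complex_norm_square[of I] by (simp add: mult.commute)
      finally have "(cmod I)\<^sup>2 / n \<le> 0" using min unfolding u_def[symmetric] Re_complex_of_real by linarith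
      then show ?thesis using n by (simp add: divide_le_0_iff I_def u_def)
    qed
  qed
  then show ?thesis using that gS by blast
qed

section \<open>Projection to a finite span, bounded by the inner products\<close>

lemma L2_comb [simp]:
  assumes "\<And>i. i \<in> A \<Longrightarrow> e i \<in> L2 p"
  shows "(\<lambda>x. \<Sum>i\<in>A. c i * e i x) \<in> L2 p"
  using assms by simp

lemma inner_comb_right:
  assumes "\<And>i. i \<in> A \<Longrightarrow> e i \<in> L2 p" "g \<in> L2 p" "\<And>i. i \<in> A \<Longrightarrow> l2_inner p g (e i) = 0"
  shows "l2_inner p g (\<lambda>x. \<Sum>i\<in>A. c i * e i x) = 0"
  using assms by (subst inner_sum_right) (auto simp: inner_scale_right)

text \<open>One Gram--Schmidt step: \<open>u\<close> is the part of the new vector orthogonal to the old ones.\<close>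
lemma finite_projection_bound:
  assumes "finite A" "\<And>i. i \<in> A \<Longrightarrow> e i \<in> L2 p"
  shows "\<exists>C\<ge>0. \<forall>g\<in>L2 p. \<exists>c. (\<forall>i\<in>A. l2_inner p (\<lambda>x. g x - (\<Sum>i\<in>A. c i * e i x)) (e i) = 0) \<and>
    (l2_norm p (\<lambda>x. \<Sum>i\<in>A. c i * e i x))\<^sup>2 \<le> C * (\<Sum>i\<in>A. (cmod (l2_inner p g (e i)))\<^sup>2)"
  using assms
proof (induction A)
  case empty
  then show ?case by (intro exI[of _ 0]) simp
next
  case (insert a A)
  let ?h = "\<lambda>c x. \<Sum>i\<in>A. c i * e i x"
  let ?S = "\<lambda>g. \<Sum>i\<in>A. (cmod (l2_inner p g (e i)))\<^sup>2"
  have eL: "e i \<in> L2 p" if "i \<in> A" for i using insert.prems that by simp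
  have ea: "e a \<in> L2 p" using insert.prems by simp
  have hL: "?h c \<in> L2 p" for c by (rule L2_comb) (rule eL)
  from insert.IH eL obtain C where C: "0 \<le> C"
    and P: "\<And>g. g \<in> L2 p \<Longrightarrow> \<exists>c. (\<forall>i\<in>A. l2_inner p (\<lambda>x. g x - ?h c x) (e i) = 0) \<and>
      (l2_norm p (?h c))\<^sup>2 \<le> C * ?S g" by blast
  obtain d where d: "\<And>i. i \<in> A \<Longrightarrow> l2_inner p (\<lambda>x. e a x - ?h d x) (e i) = 0"
    using P[OF ea] by blast
  define u where "u = (\<lambda>x. e a x - ?h d x)"
  have u: "u \<in> L2 p" using ea hL by (simp add: u_def)
  have uh: "l2_inner p u (?h c) = 0" for c
    by (rule inner_comb_right) (use eL u d in \<open>auto simp: u_def\<close>)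
  have hu: "l2_inner p (?h c) u = 0" for c
    using uh[of c] inner_commute[of p "?h c" u] by simp
  have ei_u: "l2_inner p u (e i) = 0" if "i \<in> A" for i
    using d[OF that] by (simp add: u_def)
  define n where "n = (l2_norm p u)\<^sup>2"
  have n0: "0 \<le> n" by (simp add: n_def)
  have ea_eq: "e a = (\<lambda>x. u x + ?h d x)" by (simp add: u_def)
  define q where "q = (l2_norm p (?h d))\<^sup>2"
  have q0: "0 \<le> q" by (simp add: q_def)
  \<comment> \<open>The old part contributes C. The new direction contributes |I|^2 / n, where |I|^2
    is at most twice the new squared inner product plus 2 C q times the sum of the old ones. The
    constant depends on the family alone and not on g.\<close>
  define C' where "C' = C + (2 + 2 * C * q) / n"
  have C'0: "0 \<le> C'" using C n0 q0 by (simp add: C'_def)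
  show ?case
  proof (intro exI[of _ C'] conjI ballI C'0)
    fix g assume g: "g \<in> L2 p"
    obtain c where orth: "\<And>i. i \<in> A \<Longrightarrow> l2_inner p (\<lambda>x. g x - ?h c x) (e i) = 0"
      and bound: "(l2_norm p (?h c))\<^sup>2 \<le> C * ?S g" using P[OF g] by blast
    define I where "I = l2_inner p g u"
    \<comment> \<open>If the new vector depends on the old ones up to a null function, then n = 0
      and division by zero gives s = 0 and C' = C: the projection stays as it is.\<close>
    define s where "s = I / complex_of_real n"
    define c' where "c' i = (if i = a then s else c i - s * d i)" for i
    have "(\<Sum>i\<in>insert a A. c' i * e i x) = ?h c x + s * u x" for x
    proof -
      have "(\<Sum>i\<in>A. c' i * e i x) = (\<Sum>i\<in>A. c i * e i x - s * (d i * e i x))"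
        using insert.hyps by (intro sum.cong) (auto simp: c'_def algebra_simps)
      then show ?thesis using insert.hyps
        by (simp add: c'_def u_def sum_subtractf sum_distrib_left algebra_simps)
    qed
    note h'' = this
    then have h': "(\<lambda>x. \<Sum>i\<in>insert a A. c' i * e i x) = (\<lambda>x. ?h c x + s * u x)" by (rule ext)
    let ?r = "\<lambda>x. g x - (?h c x + s * u x)"
    have rL: "?r \<in> L2 p" by (intro L2_diff L2_add g hL L2_scale u)
    have ru: "l2_inner p ?r u = 0"
    proof (cases "n = 0")
      case True
      then show ?thesis using Cauchy_Schwarz[OF rL u] by (simp add: n_def)
    next
      case False
      have "l2_inner p ?r u = I - s * complex_of_real n"
        using inner_self[of p u] by (simp add: inner_diff_left inner_add_left g hL u hu inner_scale_left I_def n_def)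
      then show ?thesis using False by (simp add: s_def)
    qed
    have ri: "l2_inner p ?r (e i) = 0" if "i \<in> A" for i
    proof -
      have "?r = (\<lambda>x. (g x - ?h c x) - s * u x)" by (simp add: algebra_simps)
      then have "l2_inner p ?r (e i) = l2_inner p (\<lambda>x. g x - ?h c x) (e i) - s * l2_inner p u (e i)"
        by (simp only: inner_diff_left L2_diff L2_scale g hL u eL that inner_scale_left)
      then show ?thesis using orth[OF that] ei_u[OF that] by simp
    qed
    have ra: "l2_inner p ?r (e a) = 0"
      unfolding ea_eq using inner_add_right[OF u hL rL] inner_comb_right[OF eL rL ri] ru by simp
    have norm_h': "(l2_norm p (\<lambda>x. ?h c x + s * u x))\<^sup>2 = (l2_norm p (?h c))\<^sup>2 + (cmod s)\<^sup>2 * n"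
      by (subst l2_pythagoras) (simp_all add: hL u inner_scale_right hu l2_norm_scale power_mult_distrib n_def)
    have sI: "(cmod s)\<^sup>2 * n = (cmod I)\<^sup>2 / n"
      by (cases "n = 0") (simp_all add: s_def norm_divide power_divide n0 power2_eq_square)
    \<comment> \<open>The residual of g is orthogonal to the old span, so g may be replaced by its
      projection \<open>?h c\<close>. Its norm is bounded by the old inner products, while the norm
      of g would be useless here.\<close>
    have ghd: "l2_inner p g (?h d) = l2_inner p (?h c) (?h d)"
    proof -
      have "l2_inner p (\<lambda>x. g x - ?h c x) (?h d) = 0"
        by (rule inner_comb_right[OF eL L2_diff[OF g hL] orth])
      then show ?thesis by (simp add: inner_diff_left g hL)
    qed
    have "I = l2_inner p g (e a) - l2_inner p g (?h d)"
      unfolding I_def u_def by (intro inner_diff_right ea hL g)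
    then have "cmod I \<le> cmod (l2_inner p g (e a)) + cmod (l2_inner p (?h c) (?h d))"
      unfolding ghd by (simp add: norm_triangle_ineq4)
    then have "(cmod I)\<^sup>2 \<le> (cmod (l2_inner p g (e a)) + cmod (l2_inner p (?h c) (?h d)))\<^sup>2"
      by (intro power_mono) auto
    also have "\<dots> \<le> 2 * (cmod (l2_inner p g (e a)))\<^sup>2 + 2 * (cmod (l2_inner p (?h c) (?h d)))\<^sup>2"
      by (rule sum_square_le)
    also have "(cmod (l2_inner p (?h c) (?h d)))\<^sup>2 \<le> (l2_norm p (?h c))\<^sup>2 * q"
      unfolding q_def by (intro Cauchy_Schwarz_sq hL)
    also have "\<dots> \<le> (C * ?S g) * q" by (intro mult_right_mono bound q0)
    finally have I: "(cmod I)\<^sup>2 \<le> 2 * (cmod (l2_inner p g (e a)))\<^sup>2 + 2 * ((C * ?S g) * q)" by simp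
    have S0: "0 \<le> ?S g" by (intro sum_nonneg) auto
    define y where "y = (cmod (l2_inner p g (e a)))\<^sup>2"
    have y0: "0 \<le> y" by (simp add: y_def)
    have "2 * y + 2 * ((C * ?S g) * q) \<le> (2 + 2 * C * q) * (y + ?S g)"
    proof -
      have "0 \<le> 2 * C * q * y + 2 * ?S g" using C q0 y0 S0 by simp
      then show ?thesis by (simp add: algebra_simps)
    qed
    then have "(cmod I)\<^sup>2 / n \<le> ((2 + 2 * C * q) * (y + ?S g)) / n"
      using I n0 unfolding y_def[symmetric] by (intro divide_right_mono) auto
    moreover have "(l2_norm p (?h c))\<^sup>2 \<le> C * (y + ?S g)"
      using bound mult_nonneg_nonneg[OF C y0] by (simp add: distrib_left)
    ultimately have "(l2_norm p (\<lambda>x. ?h c x + s * u x))\<^sup>2 \<le> C' * (y + ?S g)"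
      unfolding norm_h' sI C'_def by (simp add: distrib_right)
    then have "(l2_norm p (\<lambda>x. ?h c x + s * u x))\<^sup>2 \<le> C' * (\<Sum>i\<in>insert a A. (cmod (l2_inner p g (e i)))\<^sup>2)"
      using insert.hyps by (simp add: y_def)
    moreover have "\<forall>i\<in>insert a A. l2_inner p ?r (e i) = 0" using ri ra by blast
    ultimately show "\<exists>c. (\<forall>i\<in>insert a A. l2_inner p (\<lambda>x. g x - (\<Sum>i\<in>insert a A. c i * e i x)) (e i) = 0) \<and>
      (l2_norm p (\<lambda>x. \<Sum>i\<in>insert a A. c i * e i x))\<^sup>2 \<le> C' * (\<Sum>i\<in>insert a A. (cmod (l2_inner p g (e i)))\<^sup>2)"
      by (intro exI[of _ c'] conjI) (simp_all only: h'')
  qed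
qed

section \<open>Projections along the nested subspaces\<close>

locale nested_subspaces =
  fixes p :: nat and V :: "int \<Rightarrow> ((int \<Rightarrow> nat) \<Rightarrow> complex) set"
  assumes closed: "closed_subspace p (V j)"
    and V_step: "V j \<subseteq> V (j + 1)"
    and dense: "l2_closure p (\<Union>j. V j) = L2 p"
    and trivial: "(\<Inter>j. V j) = {f \<in> L2 p. AE x in haar p. f x = 0}"
begin

lemma V_mono: "j \<le> k \<Longrightarrow> V j \<subseteq> V k"
  by (induction k rule: int_ge_induct) (use V_step in auto)

lemma V_L2: "f \<in> V j \<Longrightarrow> f \<in> L2 p"
  using closed_subspaceD(1)[OF closed] by blast

lemma V_diff: "f \<in> V j \<Longrightarrow> g \<in> V j \<Longrightarrow> (\<lambda>x. f x - g x) \<in> V j"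
  by (rule closed_subspace_diff[OF closed])

text \<open>\<open>v j\<close> is the projection of \<open>f\<close> to \<open>V j\<close>, so \<open>v (j + 1) - v j\<close> is its projection to the
  orthogonal complement of \<open>V j\<close> in \<open>V (j + 1)\<close>.\<close>
context
  fixes f v
  assumes f: "f \<in> L2 p" and vV: "\<And>j. v j \<in> V j"
    and proj: "\<And>j h. h \<in> V j \<Longrightarrow> l2_inner p (\<lambda>x. f x - v j x) h = 0"
begin

lemma vL: "v j \<in> L2 p"
  using vV V_L2 by blast

lemma proj_diff_orth:
  assumes "i \<le> j" "h \<in> V i"
  shows "l2_inner p (\<lambda>x. v j x - v i x) h = 0"
proof -
  have h: "h \<in> V j" "h \<in> L2 p" using assms V_mono V_L2 by blast+
  have "(\<lambda>x. v j x - v i x) = (\<lambda>x. (f x - v i x) - (f x - v j x))" by simp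
  then have "l2_inner p (\<lambda>x. v j x - v i x) h
      = l2_inner p (\<lambda>x. f x - v i x) h - l2_inner p (\<lambda>x. f x - v j x) h"
    by (simp only: inner_diff_left L2_diff f vL h(2))
  then show ?thesis using proj[OF assms(2)] proj[OF h(1)] by simp
qed

lemma norm_proj_diff:
  assumes "i \<le> j"
  shows "(l2_norm p (\<lambda>x. v j x - v i x))\<^sup>2 = (l2_norm p (v j))\<^sup>2 - (l2_norm p (v i))\<^sup>2"
  using l2_pythagoras[OF L2_diff[OF vL vL] vL proj_diff_orth[OF assms vV]] by simp

lemma norm_proj_mono: "i \<le> j \<Longrightarrow> (l2_norm p (v i))\<^sup>2 \<le> (l2_norm p (v j))\<^sup>2"
  using norm_proj_diff by (metis diff_ge_0_iff_ge zero_le_power2)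

lemma norm_proj: "(l2_norm p f)\<^sup>2 = (l2_norm p (\<lambda>x. f x - v j x))\<^sup>2 + (l2_norm p (v j))\<^sup>2"
  using l2_pythagoras[OF L2_diff[OF f vL] vL proj[OF vV]] by simp

lemma telescope:
  "(\<Sum>j\<in>{- int n..<int n}. (l2_norm p (\<lambda>x. v (j + 1) x - v j x))\<^sup>2)
    = (l2_norm p (v (int n)))\<^sup>2 - (l2_norm p (v (- int n)))\<^sup>2"
proof (induction n)
  case (Suc n)
  let ?d = "\<lambda>j. (l2_norm p (\<lambda>x. v (j + 1) x - v j x))\<^sup>2"
  have "{- int (Suc n)..<int (Suc n)} = insert (- int (Suc n)) (insert (int n) {- int n..<int n})"
    by auto
  then have "(\<Sum>j\<in>{- int (Suc n)..<int (Suc n)}. ?d j)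
      = ?d (- int (Suc n)) + (?d (int n) + (\<Sum>j\<in>{- int n..<int n}. ?d j))"
    by simp
  also have "\<dots> = (l2_norm p (v (int (Suc n))))\<^sup>2 - (l2_norm p (v (- int (Suc n))))\<^sup>2"
    unfolding Suc.IH using norm_proj_diff[of "- int (Suc n)" "- int (Suc n) + 1"]
      norm_proj_diff[of "int n" "int n + 1"] by (simp add: algebra_simps)
  finally show ?case .
qed simp

lemma sum_le_norm:
  "(\<Sum>j\<in>{- int n..<int n}. (l2_norm p (\<lambda>x. v (j + 1) x - v j x))\<^sup>2) \<le> (l2_norm p f)\<^sup>2"
  unfolding telescope norm_proj[of "int n"] by simp

text \<open>By density some element of some V J is close to \<open>f\<close>, and the projection to
  that V J is at least as close.\<close>

lemma proj_upper:
  assumes "0 < \<delta>"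
  shows "\<exists>J. (l2_norm p f)\<^sup>2 - \<delta> \<le> (l2_norm p (v J))\<^sup>2"
proof -
  have "f \<in> l2_closure p (\<Union>j. V j)" using dense f by simp
  then have "\<exists>g\<in>(\<Union>j. V j). l2_norm p (\<lambda>x. f x - g x) < sqrt \<delta>"
    using assms unfolding l2_closure_def by simp
  then obtain J g where g: "g \<in> V J" "l2_norm p (\<lambda>x. f x - g x) < sqrt \<delta>" by blast
  have o: "l2_inner p (\<lambda>x. f x - v J x) (\<lambda>x. v J x - g x) = 0"
    by (intro proj V_diff vV g)
  have "(l2_norm p (\<lambda>x. f x - v J x))\<^sup>2 \<le> (l2_norm p (\<lambda>x. f x - g x))\<^sup>2"
    using l2_pythagoras[OF L2_diff[OF f vL] L2_diff[OF vL V_L2[OF g(1)]] o] by simp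
  also have "\<dots> \<le> (sqrt \<delta>)\<^sup>2" using g(2) by (intro power_mono) auto
  also have "\<dots> = \<delta>" using assms by simp
  finally show ?thesis using norm_proj[of J] by (intro exI[of _ J]) simp
qed

text \<open>Downwards the squared norms decrease, and their differences are the squared distances of
  the projections, so the projections form a Cauchy sequence. Its limit lies in every V j and
  therefore vanishes almost everywhere.\<close>

lemma proj_lower:
  assumes "0 < \<delta>"
  shows "\<exists>n::nat. (l2_norm p (v (- int n)))\<^sup>2 \<le> \<delta>"
proof -
  define F where "F n = v (- int n)" for n :: nat
  define a where "a n = (l2_norm p (F n))\<^sup>2" for n
  have dec: "decseq a" unfolding decseq_def a_def F_def using norm_proj_mono by simp
  then have "convergent a"
    by (rule decseq_convergent[of a 0]) (auto simp: a_def convergent_def)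
  then have ca: "Cauchy a" by (rule convergent_Cauchy)
  have nd: "(l2_norm p (\<lambda>x. F m x - F n x))\<^sup>2 = \<bar>a m - a n\<bar>" for m n
  proof (cases "m \<le> n")
    case True
    then show ?thesis using norm_proj_diff[of "- int n" "- int m"] dec
      unfolding F_def a_def decseq_def by (simp add: abs_of_nonneg)
  next
    case False
    then show ?thesis using norm_proj_diff[of "- int m" "- int n"] dec l2_norm_minus_commute[of p "F m" "F n"]
      unfolding F_def a_def decseq_def by (simp add: abs_of_nonpos)
  qed
  have FL: "F n \<in> L2 p" for n by (simp add: F_def vL)
  have cau: "\<exists>N. \<forall>m\<ge>N. \<forall>n\<ge>N. l2_norm p (\<lambda>x. F m x - F n x) < e" if "0 < e" for e
  proof -
    have "0 < e\<^sup>2" using that by simp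
    then obtain N where N: "\<And>m n. m \<ge> N \<Longrightarrow> n \<ge> N \<Longrightarrow> norm (a m - a n) < e\<^sup>2"
      using CauchyD[OF ca] by meson
    have "l2_norm p (\<lambda>x. F m x - F n x) < e" if "m \<ge> N" "n \<ge> N" for m n
    proof (rule power2_less_imp_less)
      show "(l2_norm p (\<lambda>x. F m x - F n x))\<^sup>2 < e\<^sup>2" using N[OF that] unfolding nd by simp
    qed (use \<open>0 < e\<close> in simp)
    then show ?thesis by blast
  qed
  obtain w where w: "w \<in> L2 p" and lim: "(\<lambda>n. l2_norm p (\<lambda>x. F n x - w x)) \<longlonglongrightarrow> 0"
    by (rule L2_complete[OF FL cau])
  have "w \<in> V j" for j
  proof (rule closed_subspace_limit[OF closed _ w])
    \<comment> \<open>Skipping nat (-j) terms leaves only indices at most j, so the tail lies in V j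
      whatever the sign of j.\<close>
    show "F (n + nat (- j)) \<in> V j" for n
      using vV[of "- int (n + nat (- j))"] V_mono[of "- int (n + nat (- j))" j] unfolding F_def by auto
    show "(\<lambda>n. l2_norm p (\<lambda>x. F (n + nat (- j)) x - w x)) \<longlonglongrightarrow> 0"
      using LIMSEQ_ignore_initial_segment[OF lim] .
  qed
  then have "AE x in haar p. w x = 0" using trivial by auto
  then have "l2_norm p (\<lambda>x. F n x - w x) = l2_norm p (F n)" for n
    by (intro l2_norm_AE_cong L2_diff FL w) (auto elim: eventually_mono)
  then have "(\<lambda>n. l2_norm p (F n)) \<longlonglongrightarrow> 0" using lim by simp
  moreover have "0 < sqrt \<delta>" using assms by simp
  ultimately obtain n where "l2_norm p (F n) < sqrt \<delta>"
    using LIMSEQ_D[of _ 0 "sqrt \<delta>"] by force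
  then have "(l2_norm p (F n))\<^sup>2 \<le> (sqrt \<delta>)\<^sup>2" by (intro power_mono) auto
  then show ?thesis using assms by (auto simp: F_def)
qed

text \<open>With \<open>sum_le_norm\<close> this is the identity between the squared norm of f and
  the sum over all scales, stated on finite ranges. Half of the error is spent at each end of the
  range.\<close>

lemma norm_le_sum:
  assumes "0 < \<delta>"
  shows "\<exists>n::nat. (l2_norm p f)\<^sup>2 - \<delta> \<le> (\<Sum>j\<in>{- int n..<int n}. (l2_norm p (\<lambda>x. v (j + 1) x - v j x))\<^sup>2)"
proof -
  obtain J where J: "(l2_norm p f)\<^sup>2 - \<delta> / 2 \<le> (l2_norm p (v J))\<^sup>2"
    using proj_upper[of "\<delta> / 2"] assms by auto
  obtain m :: nat where m: "(l2_norm p (v (- int m)))\<^sup>2 \<le> \<delta> / 2"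
    using proj_lower[of "\<delta> / 2"] assms by auto
  define n where "n = max (nat J) m"
  have "(l2_norm p (v J))\<^sup>2 \<le> (l2_norm p (v (int n)))\<^sup>2"
    "(l2_norm p (v (- int n)))\<^sup>2 \<le> (l2_norm p (v (- int m)))\<^sup>2"
    by (intro norm_proj_mono; simp add: n_def)+
  then have "(l2_norm p f)\<^sup>2 - \<delta> \<le> (l2_norm p (v (int n)))\<^sup>2 - (l2_norm p (v (- int n)))\<^sup>2"
    using J m by linarith
  then show ?thesis unfolding telescope[symmetric] by (rule exI)
qed

end

end

section \<open>Translates and dilates of compactly supported generators\<close>

lemma lin_span_superset: "g \<in> S \<Longrightarrow> g \<in> lin_span S"
  unfolding lin_span_def
  by (intro CollectI exI[of _ 1] exI[of _ "\<lambda>_. 1"] exI[of _ "\<lambda>_. g"]) auto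

lemma lin_span_D:
  assumes "k \<in> lin_span {e i | i. i \<in> I}"
  shows "\<exists>(n::nat) c i. (\<forall>l<n. i l \<in> I) \<and> k = (\<lambda>x. \<Sum>l<n. c l * e (i l) x)"
proof -
  obtain n :: nat and c g where g: "\<And>l. l < n \<Longrightarrow> g l \<in> {e i | i. i \<in> I}" "k = (\<lambda>x. \<Sum>l<n. c l * g l x)"
    using assms unfolding lin_span_def by blast
  then have "\<forall>l. \<exists>i. l < n \<longrightarrow> i \<in> I \<and> g l = e i" by blast
  then obtain i where i: "\<And>l. l < n \<Longrightarrow> i l \<in> I \<and> g l = e (i l)" by metis
  then have "k = (\<lambda>x. \<Sum>l<n. c l * e (i l) x)" unfolding g(2) by (intro ext sum.cong) auto
  then show ?thesis using i by blast
qed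

context digit_base
begin

text \<open>Translations are the case c = 1 and dilations the case c = p^(-j): the pushforward is a
  constant multiple of Haar measure in both.\<close>

lemma pullback_inner:
  assumes m: "\<phi> \<in> haar p \<rightarrow>\<^sub>M haar p"
    and d: "distr (haar p) (haar p) \<phi> = density (haar p) (\<lambda>_. ennreal c)" and c: "0 \<le> c"
    and f: "f \<in> L2 p" and g: "g \<in> L2 p"
  shows "(\<lambda>x. f (\<phi> x)) \<in> L2 p"
    and "l2_inner p (\<lambda>x. f (\<phi> x)) (\<lambda>x. g (\<phi> x)) = complex_of_real c * l2_inner p f g"
proof -
  note [measurable] = m L2_D(1)[OF f]
  have "integrable (density (haar p) (\<lambda>_. ennreal c)) (\<lambda>x. (cmod (f x))\<^sup>2)"
    using L2_D(2)[OF f] c by (subst integrable_density) auto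
  then have "integrable (haar p) (\<lambda>x. (cmod (f (\<phi> x)))\<^sup>2)"
    unfolding d[symmetric] by (subst (asm) integrable_distr_eq) auto
  then show "(\<lambda>x. f (\<phi> x)) \<in> L2 p" unfolding L2_def by simp
  have [measurable]: "(\<lambda>x. f x * cnj (g x)) \<in> borel_measurable (haar p)"
    by (rule borel_measurable_integrable[OF integrable_inner[OF f g]])
  have "l2_inner p (\<lambda>x. f (\<phi> x)) (\<lambda>x. g (\<phi> x))
      = (\<integral>x. f x * cnj (g x) \<partial>distr (haar p) (haar p) \<phi>)"
    unfolding l2_inner_def by (subst integral_distr) auto
  also have "\<dots> = complex_of_real c * l2_inner p f g"
    unfolding d l2_inner_def using c by (subst integral_density) (auto simp: scaleR_conv_of_real)
  finally show "l2_inner p (\<lambda>x. f (\<phi> x)) (\<lambda>x. g (\<phi> x)) = complex_of_real c * l2_inner p f g" .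
qed

lemma distr_qp_diff_density:
  "a \<in> qp p \<Longrightarrow> distr (haar p) (haar p) (\<lambda>x. qp_diff p x a) = density (haar p) (\<lambda>_. ennreal 1)"
  by (simp add: distr_qp_diff density_1)

lemma L2_translate:
  assumes "a \<in> qp p" "f \<in> L2 p"
  shows "(\<lambda>x. f (qp_diff p x a)) \<in> L2 p"
  using pullback_inner(1)[OF measurable_qp_diff distr_qp_diff_density] assms by simp

lemma inner_translate:
  assumes "a \<in> qp p" "f \<in> L2 p" "g \<in> L2 p"
  shows "l2_inner p (\<lambda>x. f (qp_diff p x a)) (\<lambda>x. g (qp_diff p x a)) = l2_inner p f g"
  using pullback_inner(2)[OF measurable_qp_diff distr_qp_diff_density] assms by simp

lemma norm_eq_if_inner_eq:
  "l2_inner p f f = l2_inner p g g \<Longrightarrow> l2_norm p f = l2_norm p g"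
  unfolding inner_self of_real_eq_iff by (rule power2_eq_imp_eq) auto

text \<open>The arithmetic identities hold only for digit functions in \<open>qp p\<close>; this is
  enough since it is the whole space of the measure.\<close>

lemma inner_cong:
  assumes "\<And>x. x \<in> qp p \<Longrightarrow> f x = f' x" "\<And>x. x \<in> qp p \<Longrightarrow> g x = g' x"
  shows "l2_inner p f g = l2_inner p f' g'"
  unfolding l2_inner_def using assms by (intro Bochner_Integration.integral_cong) auto

text \<open>Translation facts are available for subtraction, so adding b is expressed as subtracting
  its negative.\<close>

lemma qp_add_eq_diff:
  assumes x: "x \<in> qp p" and b: "b \<in> qp p"
  shows "qp_add p x b = qp_diff p x (qp_diff p (\<lambda>k. 0) b)"
proof (rule qp_add_eqI)
  let ?z = "\<lambda>k::int. 0::nat"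
  fix m
  have z: "qp_trunc p m ?z = 0" by (simp add: qp_trunc_zero)
  have n: "qp_diff p ?z b \<in> qp p" "qp_cong p m (qp_trunc p m (qp_diff p ?z b)) (- qp_trunc p m b)"
    using qp_diff_spec[OF zero_qp b] z by (auto simp: z) (metis diff_0 z)
  from qp_cong_trans[OF qp_diff_spec(2)[OF x n(1), of m] qp_cong_diff[OF qp_cong_refl n(2)]]
  show "qp_cong p m (qp_trunc p m (qp_diff p x (qp_diff p ?z b))) (qp_trunc p m x + qp_trunc p m b)" by simp
qed (use assms qp_diff_spec(1) in auto)

lemma translate_surj:
  assumes b: "b \<in> qp p" and g: "g \<in> L2 p"
  obtains g' where "g' \<in> L2 p" "\<And>x. x \<in> qp p \<Longrightarrow> g' (qp_diff p x b) = g x"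
proof
  let ?nb = "qp_diff p (\<lambda>k. 0) b"
  show "(\<lambda>x. g (qp_diff p x ?nb)) \<in> L2 p"
    by (intro L2_translate g qp_diff_spec(1) zero_qp b)
  show "g (qp_diff p (qp_diff p x b) ?nb) = g x" if x: "x \<in> qp p" for x
    using qp_add_eq_diff[OF qp_diff_spec(1)[OF x b] b] qp_add_diff[OF x b] by simp
qed

definition dilate :: "int \<Rightarrow> ((int \<Rightarrow> nat) \<Rightarrow> complex) \<Rightarrow> (int \<Rightarrow> nat) \<Rightarrow> complex" where
  "dilate j f x = complex_of_real (real p powr (real_of_int j / 2)) * f (qp_scale p j x)"

lemma L2_dil: "f \<in> L2 p \<Longrightarrow> dilate j f \<in> L2 p"
  unfolding dilate_def using pullback_inner(1)[OF measurable_qp_scale distr_qp_scale]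
  by (intro L2_scale) simp

text \<open>The two weights p^(j/2) multiply to p^j and cancel the factor p^(-j) of the change of
  variables.\<close>

lemma inner_dil:
  assumes "f \<in> L2 p" "g \<in> L2 p"
  shows "l2_inner p (dilate j f) (dilate j g) = l2_inner p f g"
proof -
  let ?c = "complex_of_real (real p powr (real_of_int j / 2))"
  have "l2_inner p (\<lambda>x. f (qp_scale p j x)) (\<lambda>x. g (qp_scale p j x))
      = complex_of_real (real p powi (- j)) * l2_inner p f g"
    using assms by (intro pullback_inner(2)[OF measurable_qp_scale distr_qp_scale]) auto
  then have 1: "l2_inner p (dilate j f) (dilate j g)
      = ?c * (?c * (complex_of_real (real p powi (- j)) * l2_inner p f g))"
    unfolding dilate_def inner_scale_left inner_scale_right by (simp only: complex_cnj_complex_of_real)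
  have "real p powr (real_of_int j / 2) * (real p powr (real_of_int j / 2) * real p powi (- j)) = 1"
  proof -
    have "real p powi (- j) = real p powr (- real_of_int j)"
      by (simp add: powr_real_of_int' flip: of_int_minus)
    then show ?thesis by (simp flip: powr_add)
  qed
  then have "?c * (?c * complex_of_real (real p powi (- j))) = 1"
    by (simp only: of_real_mult[symmetric] of_real_1)
  then show ?thesis unfolding 1 by (simp only: mult.assoc[symmetric]) simp
qed

lemma norm_dil: "f \<in> L2 p \<Longrightarrow> l2_norm p (dilate j f) = l2_norm p f"
  by (intro norm_eq_if_inner_eq inner_dil)

lemma dilate_dilate: "dilate j (dilate (- j) f) = f"
proof -
  have "real p powr (real_of_int j / 2) * real p powr (real_of_int (- j) / 2) = 1"
    by (simp flip: powr_add)
  then have "complex_of_real (real p powr (real_of_int j / 2)) * complex_of_real (real p powr (real_of_int (- j) / 2)) = 1"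
    by (simp only: of_real_mult[symmetric] of_real_1)
  then show ?thesis unfolding dilate_def by (simp only: mult.assoc[symmetric] qp_scale_scale) simp
qed

section \<open>Splitting the translation parameters into blocks\<close>

definition hi_part :: "nat \<Rightarrow> (int \<Rightarrow> nat) \<Rightarrow> int \<Rightarrow> nat" where
  "hi_part N a = (\<lambda>k. if k < - int N then a k else 0)"

definition lo_part :: "nat \<Rightarrow> (int \<Rightarrow> nat) \<Rightarrow> int \<Rightarrow> nat" where
  "lo_part N a = (\<lambda>k. if - int N \<le> k then a k else 0)"

text \<open>Representatives of p^(-N) Z_p modulo Z_p, that is p^N elements. \<open>hi_part N\<close>
  in turn names the coset of p^(-N) Z_p.\<close>

definition lo_fracs :: "nat \<Rightarrow> (int \<Rightarrow> nat) set" where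
  "lo_fracs N = {c \<in> Ip p. \<forall>k < - int N. c k = 0}"

lemma Ip_qp: "a \<in> Ip p \<Longrightarrow> a \<in> qp p"
  by (simp add: Ip_def)

lemma Ip_iff: "a \<in> Ip p \<longleftrightarrow> a \<in> qp p \<and> (\<forall>k\<ge>0. a k = 0)"
  unfolding Ip_def qp_frac_def by (auto simp: fun_eq_iff not_less)

lemma qp_mask:
  assumes "a \<in> qp p"
  shows "(\<lambda>k. if P k then a k else 0) \<in> qp p"
  using assms unfolding qp_def by auto

lemma finite_low: "finite (lo_fracs N)"
proof (rule finite_subset)
  show "lo_fracs N \<subseteq> {f. \<forall>x. (x \<in> {- int N..<0} \<longrightarrow> f x \<in> {..<p}) \<and> (x \<notin> {- int N..<0} \<longrightarrow> f x = 0)}"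
    unfolding lo_fracs_def Ip_iff by (auto intro: qp_digit)
  show "finite {f :: int \<Rightarrow> nat. \<forall>x. (x \<in> {- int N..<0} \<longrightarrow> f x \<in> {..<p}) \<and> (x \<notin> {- int N..<0} \<longrightarrow> f x = 0)}"
    by (rule finite_set_of_finite_funs) auto
qed

lemma countable_Ip: "countable (Ip p)"
proof -
  have "Ip p \<subseteq> (\<Union>N. lo_fracs N)"
  proof
    fix a assume a: "a \<in> Ip p"
    then obtain M where "\<forall>k<M. a k = 0" using qpE Ip_qp by metis
    then have "\<forall>k < - int (nat (- M)). a k = 0" by auto
    then have "a \<in> lo_fracs (nat (- M))" using a by (simp add: lo_fracs_def)
    then show "a \<in> (\<Union>N. lo_fracs N)" by blast
  qed
  then show ?thesis
    by (rule countable_subset) (simp add: countable_finite[OF finite_low])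
qed

lemma lo_low: "a \<in> Ip p \<Longrightarrow> lo_part N a \<in> lo_fracs N"
  using qp_mask[of a "\<lambda>k. - int N \<le> k"] unfolding lo_fracs_def Ip_iff lo_part_def by auto

lemma hi_Ip: "a \<in> Ip p \<Longrightarrow> hi_part N a \<in> Ip p"
  using qp_mask[of a "\<lambda>k. k < - int N"] unfolding Ip_iff hi_part_def by auto

text \<open>At each position one of the digits is 0, so no carry arises.\<close>

lemma qp_add_disjoint:
  assumes b: "b \<in> qp p" and c: "c \<in> qp p" and "\<And>k. b k = 0 \<or> c k = 0"
  shows "qp_add p b c = (\<lambda>k. b k + c k)"
proof -
  obtain N1 N2 where N: "\<forall>k<N1. b k = 0" "\<forall>k<N2. c k = 0" using b c by (metis qpE)
  define N where "N = min N1 N2"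
  have Nb: "\<forall>k<N. b k = 0" and Nc: "\<forall>k<N. c k = 0" using N by (auto simp: N_def)
  have z: "(\<lambda>k. b k + c k) \<in> qp p"
  proof -
    have "b k + c k < p" for k
      using assms(3)[of k] qp_digit[OF b, of k] qp_digit[OF c, of k] by auto
    then show ?thesis using Nb Nc unfolding qp_def by auto
  qed
  show ?thesis
  proof (rule qp_add_eqI[OF b c z])
    fix m
    have "qp_trunc p m (\<lambda>k. b k + c k) = qp_trunc p m b + qp_trunc p m c"
      using Nb Nc by (simp add: qp_trunc_eq_sum[of N] sum.distrib[symmetric] distrib_right)
    then show "qp_cong p m (qp_trunc p m (\<lambda>k. b k + c k)) (qp_trunc p m b + qp_trunc p m c)" by simp
  qed
qed

lemma hi_lo: "qp_add p (hi_part N a) (lo_part N a) = a" if "a \<in> Ip p"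
  using that
  by (subst qp_add_disjoint) (auto simp: hi_part_def lo_part_def qp_mask Ip_qp)

text \<open>Without carries both parts can be read off the sum, so adding a fixed high part maps
  \<open>lo_fracs N\<close> bijectively onto one block.\<close>

lemma hi_add:
  assumes a: "a \<in> Ip p" and c: "c \<in> lo_fracs N"
  shows "qp_add p (hi_part N a) c \<in> Ip p" "hi_part N (qp_add p (hi_part N a) c) = hi_part N a" "lo_part N (qp_add p (hi_part N a) c) = c"
proof -
  have cI: "c \<in> Ip p" using c by (simp add: lo_fracs_def)
  have e: "qp_add p (hi_part N a) c = (\<lambda>k. hi_part N a k + c k)"
    using c by (intro qp_add_disjoint Ip_qp hi_Ip a cI) (auto simp: hi_part_def lo_fracs_def)
  have "qp_add p (hi_part N a) c \<in> qp p" by (intro qp_add_spec(1) Ip_qp hi_Ip a cI)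
  moreover have "\<forall>k\<ge>0. qp_add p (hi_part N a) c k = 0"
    unfolding e using cI by (auto simp: Ip_iff hi_part_def)
  ultimately show "qp_add p (hi_part N a) c \<in> Ip p" by (simp add: Ip_iff)
  show "hi_part N (qp_add p (hi_part N a) c) = hi_part N a" "lo_part N (qp_add p (hi_part N a) c) = c"
    unfolding e using c by (auto simp: hi_part_def lo_part_def lo_fracs_def)
qed

text \<open>Within a block the low digits determine \<open>a\<close>. The bound does not depend on
  \<open>b\<close>, and it limits how many supports share a point.\<close>

lemma card_same_hi: "finite {a \<in> Ip p. hi_part N a = b}" "card {a \<in> Ip p. hi_part N a = b} \<le> card (lo_fracs N)"
proof -
  have inj: "inj_on (lo_part N) {a \<in> Ip p. hi_part N a = b}"
    by (rule inj_onI) (metis (mono_tags, lifting) hi_lo mem_Collect_eq)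
  have sub: "lo_part N ` {a \<in> Ip p. hi_part N a = b} \<subseteq> lo_fracs N" using lo_low by blast
  show "finite {a \<in> Ip p. hi_part N a = b}"
    using inj finite_subset[OF sub finite_low] finite_imageD by blast
  show "card {a \<in> Ip p. hi_part N a = b} \<le> card (lo_fracs N)"
    by (rule card_inj_on_le[OF inj sub finite_low])
qed

text \<open>The conclusion covers all larger balls too, so that finitely many generators can be
  given one common ball.\<close>

lemma compact_support_cyl:
  assumes "compact_support p f"
  obtains N :: nat where "\<And>n. N \<le> n \<Longrightarrow> AE x in haar p. x \<notin> cylinder p (- int n) (\<lambda>k. 0) \<longrightarrow> f x = 0"
proof -
  obtain M :: int where M: "AE x in haar p. qp_norm p x > real p powr M \<longrightarrow> f x = 0"
    using assms unfolding compact_support_def by blast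
  have "log p (real p powr M) = M" using p_ge_2 by (subst log_powr_cancel) auto
  then have l: "\<lceil>- log p (real p powr M)\<rceil> = - M" by (simp flip: of_int_minus)
  have "AE x in haar p. x \<notin> cylinder p (- int n) (\<lambda>k. 0) \<longrightarrow> f x = 0" if n: "nat M \<le> n" for n
    using M AE_space
  proof eventually_elim
    case (elim x)
    then have x: "x \<in> qp p" by simp
    show ?case
    proof
      assume "x \<notin> cylinder p (- int n) (\<lambda>k. 0)"
      then obtain k where "k < - int n" "x k \<noteq> 0" using x by (auto simp: cylinder_def)
      then have "k < - M" "x k \<noteq> 0" using n by auto
      then have "\<not> qp_norm p x \<le> real p powr M"
        using qp_norm_le_iff[OF x, of "real p powr M"] unfolding l by auto
      then show "f x = 0" using elim by simp
    qed
  qed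
  then show ?thesis using that by blast
qed

end

section \<open>Frame bounds for the translates of the generators\<close>

locale wavelet_generators = digit_base +
  fixes r N :: nat and \<psi> :: "nat \<Rightarrow> (int \<Rightarrow> nat) \<Rightarrow> complex"
  assumes \<psi>_L2: "\<nu> \<in> {1..r} \<Longrightarrow> \<psi> \<nu> \<in> L2 p"
    and \<psi>_supp: "\<nu> \<in> {1..r} \<Longrightarrow> AE x in haar p. x \<notin> cylinder p (- int N) (\<lambda>k. 0) \<longrightarrow> \<psi> \<nu> x = 0"
begin

definition gen :: "nat \<times> (int \<Rightarrow> nat) \<Rightarrow> (int \<Rightarrow> nat) \<Rightarrow> complex" where
  "gen i = (\<lambda>x. \<psi> (fst i) (qp_diff p x (snd i)))"

lemma gen_L2: "\<nu> \<in> {1..r} \<Longrightarrow> a \<in> Ip p \<Longrightarrow> gen (\<nu>, a) \<in> L2 p"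
  unfolding gen_def by (simp add: L2_translate \<psi>_L2 Ip_qp)

text \<open>Translation preserves Haar measure, so it carries the exceptional null set of the
  generator to a null set.\<close>

lemma gen_supp:
  assumes \<nu>: "\<nu> \<in> {1..r}" and a: "a \<in> qp p"
  shows "AE x in haar p. x \<notin> cylinder p (- int N) a \<longrightarrow> gen (\<nu>, a) x = 0"
proof -
  have "AE x in distr (haar p) (haar p) (\<lambda>x. qp_diff p x a). x \<notin> cylinder p (- int N) (\<lambda>k. 0) \<longrightarrow> \<psi> \<nu> x = 0"
    unfolding distr_qp_diff[OF a] by (rule \<psi>_supp[OF \<nu>])
  from AE_distrD[OF measurable_qp_diff[OF a] this] AE_space[of "haar p"] show ?thesis
  proof eventually_elim
    case (elim x)
    then show ?case
      using qp_diff_mem_cyl[OF _ a zero_qp, of x "- int N"] cyl_zero_add[OF a] by (simp add: gen_def)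
  qed
qed

text \<open>The ball around \<open>a\<close> depends on its digits below -N only. Locating a point
  in a support and finding the block of \<open>a\<close> become the same comparison.\<close>

lemma cyl_hi: "a \<in> Ip p \<Longrightarrow> cylinder p (- int N) a = {x \<in> qp p. hi_part N x = hi_part N a}"
  by (auto simp: cylinder_def hi_part_def fun_eq_iff)

lemma inner_gen_block:
  assumes "\<nu> \<in> {1..r}" "\<mu> \<in> {1..r}" "a \<in> Ip p" "b \<in> Ip p" "hi_part N a \<noteq> hi_part N b"
  shows "l2_inner p (gen (\<nu>, a)) (gen (\<mu>, b)) = 0"
  unfolding l2_inner_def
proof (rule integral_eq_zero_AE)
  show "AE x in haar p. gen (\<nu>, a) x * cnj (gen (\<mu>, b) x) = 0"
    using gen_supp[OF assms(1) Ip_qp[OF assms(3)]] gen_supp[OF assms(2) Ip_qp[OF assms(4)]]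
  proof eventually_elim
    case (elim x)
    then show ?case using assms(5) by (auto simp: cyl_hi assms(3,4))
  qed
qed

definition block :: "(int \<Rightarrow> nat) \<Rightarrow> (nat \<times> (int \<Rightarrow> nat)) set" where
  "block b = {1..r} \<times> {a \<in> Ip p. hi_part N a = b}"

lemma finite_block: "finite (block b)"
  unfolding block_def using card_same_hi(1) by simp

text \<open>Every block of translates is a translate of the finite family indexed by
  \<open>{1..r} \<times> lo_fracs N\<close>, so the constant does not depend on the block.\<close>
lemma block_projection:
  "\<exists>C\<ge>0. \<forall>a0\<in>Ip p. \<forall>g\<in>L2 p. \<exists>c.
    (\<forall>i\<in>block (hi_part N a0). l2_inner p (\<lambda>x. g x - (\<Sum>i\<in>block (hi_part N a0). c i * gen i x)) (gen i) = 0) \<and>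
    (l2_norm p (\<lambda>x. \<Sum>i\<in>block (hi_part N a0). c i * gen i x))\<^sup>2
      \<le> C * (\<Sum>i\<in>block (hi_part N a0). (cmod (l2_inner p g (gen i)))\<^sup>2)"
proof -
  let ?K = "{1..r} \<times> lo_fracs N"
  have KL: "gen i \<in> L2 p" if "i \<in> ?K" for i
    using that gen_L2[of "fst i" "snd i"] by (auto simp: lo_fracs_def)
  have "finite ?K" by (simp add: finite_low)
  from finite_projection_bound[OF this KL] obtain C where CP: "0 \<le> C \<and>
    (\<forall>g\<in>L2 p. \<exists>c. (\<forall>i\<in>?K. l2_inner p (\<lambda>x. g x - (\<Sum>i\<in>?K. c i * gen i x)) (gen i) = 0) \<and>
      (l2_norm p (\<lambda>x. \<Sum>i\<in>?K. c i * gen i x))\<^sup>2 \<le> C * (\<Sum>i\<in>?K. (cmod (l2_inner p g (gen i)))\<^sup>2))"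
    by (rule exE)
  note C = conjunct1[OF CP] and P = bspec[OF conjunct2[OF CP]]
  show ?thesis
  proof (intro exI[of _ C] conjI C ballI)
    fix a0 g assume a0: "a0 \<in> Ip p" and g: "g \<in> L2 p"
    define b where "b = hi_part N a0"
    have b: "b \<in> qp p" unfolding b_def by (intro Ip_qp hi_Ip a0)
    \<comment> \<open>Instead of moving the family, g is moved back by b: its inner products with
      the block equal those of g' with the fixed finite family, so the constant of that family
      applies.\<close>
    obtain g' where g': "g' \<in> L2 p" "\<And>x. x \<in> qp p \<Longrightarrow> g' (qp_diff p x b) = g x"
      using translate_surj[OF b g] by metis
    obtain c where c: "\<And>i. i \<in> ?K \<Longrightarrow> l2_inner p (\<lambda>x. g' x - (\<Sum>i\<in>?K. c i * gen i x)) (gen i) = 0"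
      "(l2_norm p (\<lambda>x. \<Sum>i\<in>?K. c i * gen i x))\<^sup>2 \<le> C * (\<Sum>i\<in>?K. (cmod (l2_inner p g' (gen i)))\<^sup>2)"
      using P[OF g'(1)] by blast
    \<comment> \<open>Reindexes the finite family by the block; by \<open>qp_diff_qp_add\<close>
      translating by b + c is translating by b and then by c.\<close>
    define \<sigma> where "\<sigma> i = (fst i, qp_add p b (snd i))" for i :: "nat \<times> (int \<Rightarrow> nat)"
    have bij: "bij_betw \<sigma> ?K (block b)"
    proof (rule bij_betw_byWitness[where f' = "\<lambda>i. (fst i, lo_part N (snd i))"])
      show "\<forall>i\<in>?K. (fst (\<sigma> i), lo_part N (snd (\<sigma> i))) = i"
        by (auto simp: \<sigma>_def b_def hi_add[OF a0])
      show "\<forall>i\<in>block b. \<sigma> (fst i, lo_part N (snd i)) = i"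
        by (auto simp: \<sigma>_def block_def hi_lo)
      show "\<sigma> ` ?K \<subseteq> block b" by (auto simp: \<sigma>_def block_def b_def hi_add[OF a0])
      show "(\<lambda>i. (fst i, lo_part N (snd i))) ` block b \<subseteq> ?K" by (auto simp: block_def lo_low)
    qed
    have gen\<sigma>: "gen (\<sigma> i) x = gen i (qp_diff p x b)" if "i \<in> ?K" "x \<in> qp p" for i x
      using that b by (auto simp: \<sigma>_def gen_def qp_diff_qp_add lo_fracs_def Ip_qp)
    define c' where "c' i = c (fst i, lo_part N (snd i))" for i
    have c'\<sigma>: "c' (\<sigma> i) = c i" if "i \<in> ?K" for i
      using that by (auto simp: c'_def \<sigma>_def b_def hi_add[OF a0])
    let ?h = "\<lambda>x. \<Sum>i\<in>?K. c i * gen i x"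
    have hL: "?h \<in> L2 p" by (rule L2_comb) (rule KL)
    have h: "(\<Sum>i\<in>block b. c' i * gen i x) = ?h (qp_diff p x b)" if "x \<in> qp p" for x
      using that by (simp add: sum.reindex_bij_betw[OF bij, symmetric] c'\<sigma> gen\<sigma>)
    have in_g: "l2_inner p g (gen (\<sigma> i)) = l2_inner p g' (gen i)" if i: "i \<in> ?K" for i
    proof -
      have "l2_inner p g (gen (\<sigma> i)) = l2_inner p (\<lambda>x. g' (qp_diff p x b)) (\<lambda>x. gen i (qp_diff p x b))"
        using g'(2) gen\<sigma>[OF i] by (intro inner_cong) auto
      also have "\<dots> = l2_inner p g' (gen i)" by (rule inner_translate[OF b g'(1) KL[OF i]])
      finally show ?thesis .
    qed
    have 1: "l2_inner p (\<lambda>x. g x - (\<Sum>i\<in>block b. c' i * gen i x)) (gen j) = 0" if j: "j \<in> block b" for j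
    proof -
      obtain i where i: "i \<in> ?K" "j = \<sigma> i" using j bij unfolding bij_betw_def by blast
      have "l2_inner p (\<lambda>x. g x - (\<Sum>i\<in>block b. c' i * gen i x)) (gen j)
          = l2_inner p (\<lambda>x. (\<lambda>y. g' y - ?h y) (qp_diff p x b)) (\<lambda>x. gen i (qp_diff p x b))"
        using g'(2) gen\<sigma>[OF i(1)] h i(2) by (intro inner_cong) auto
      also have "\<dots> = l2_inner p (\<lambda>y. g' y - ?h y) (gen i)"
        by (rule inner_translate[OF b L2_diff[OF g'(1) hL] KL[OF i(1)]])
      finally show ?thesis using c(1)[OF i(1)] by simp
    qed
    have 2: "l2_norm p (\<lambda>x. \<Sum>i\<in>block b. c' i * gen i x) = l2_norm p ?h"
    proof (rule norm_eq_if_inner_eq)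
      have "l2_inner p (\<lambda>x. \<Sum>i\<in>block b. c' i * gen i x) (\<lambda>x. \<Sum>i\<in>block b. c' i * gen i x)
          = l2_inner p (\<lambda>x. ?h (qp_diff p x b)) (\<lambda>x. ?h (qp_diff p x b))"
        using h by (intro inner_cong) auto
      also have "\<dots> = l2_inner p ?h ?h" by (rule inner_translate[OF b hL hL])
      finally show "l2_inner p (\<lambda>x. \<Sum>i\<in>block b. c' i * gen i x) (\<lambda>x. \<Sum>i\<in>block b. c' i * gen i x)
          = l2_inner p ?h ?h" .
    qed
    have 3: "(\<Sum>i\<in>block b. (cmod (l2_inner p g (gen i)))\<^sup>2) = (\<Sum>i\<in>?K. (cmod (l2_inner p g' (gen i)))\<^sup>2)"
      using in_g by (simp add: sum.reindex_bij_betw[OF bij, symmetric])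
    show "\<exists>c. (\<forall>i\<in>block (hi_part N a0). l2_inner p (\<lambda>x. g x - (\<Sum>i\<in>block (hi_part N a0). c i * gen i x)) (gen i) = 0) \<and>
      (l2_norm p (\<lambda>x. \<Sum>i\<in>block (hi_part N a0). c i * gen i x))\<^sup>2
        \<le> C * (\<Sum>i\<in>block (hi_part N a0). (cmod (l2_inner p g (gen i)))\<^sup>2)"
      unfolding b_def[symmetric] using 1 c(2)[folded 2 3] by blast
  qed
qed

text \<open>An element of the closed span is approximated by a finite combination, which meets
  finitely many blocks. The projection of g to the span of these whole blocks is at least as close,
  and since blocks are orthogonal, the estimates of \<open>block_projection\<close> add up with one
  constant. The slack keeps the index set finite.\<close>

lemma lower_bound:
  "\<exists>C>0. \<forall>g\<in>l2_closure p (lin_span {gen i | i. i \<in> {1..r} \<times> Ip p}). \<forall>\<epsilon>>0.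
    \<exists>G. finite G \<and> G \<subseteq> {1..r} \<times> Ip p \<and> (l2_norm p g)\<^sup>2 \<le> C * (\<Sum>i\<in>G. (cmod (l2_inner p g (gen i)))\<^sup>2) + \<epsilon>"
proof -
  from block_projection obtain C where CP: "0 \<le> C \<and> (\<forall>a0\<in>Ip p. \<forall>g\<in>L2 p. \<exists>c.
    (\<forall>i\<in>block (hi_part N a0). l2_inner p (\<lambda>x. g x - (\<Sum>i\<in>block (hi_part N a0). c i * gen i x)) (gen i) = 0) \<and>
    (l2_norm p (\<lambda>x. \<Sum>i\<in>block (hi_part N a0). c i * gen i x))\<^sup>2
      \<le> C * (\<Sum>i\<in>block (hi_part N a0). (cmod (l2_inner p g (gen i)))\<^sup>2))"
    by (rule exE)
  note C = conjunct1[OF CP] and P = bspec[OF bspec[OF conjunct2[OF CP]]]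
  show ?thesis
  \<comment> \<open>One is added because the block constant is only known to be nonnegative.\<close>
  proof (intro exI[of _ "C + 1"] conjI ballI allI impI)
    fix g and \<epsilon> :: real
    assume gW: "g \<in> l2_closure p (lin_span {gen i | i. i \<in> {1..r} \<times> Ip p})" and \<epsilon>: "0 < \<epsilon>"
    have g: "g \<in> L2 p" using gW by (simp add: l2_closure_def)
    have "0 < sqrt \<epsilon>" using \<epsilon> by simp
    then obtain k where k: "k \<in> lin_span {gen i | i. i \<in> {1..r} \<times> Ip p}"
      and gk: "l2_norm p (\<lambda>x. g x - k x) < sqrt \<epsilon>"
      using gW unfolding l2_closure_def by blast
    obtain n :: nat and d i where i: "\<And>l. l < n \<Longrightarrow> i l \<in> {1..r} \<times> Ip p"
      and k_eq: "k = (\<lambda>x. \<Sum>l<n. d l * gen (i l) x)"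
      using lin_span_D[OF k] by blast
    \<comment> \<open>The blocks met by the approximating combination. Whole blocks are taken, since
      the projection bound is available only for them.\<close>
    define F where "F = (\<lambda>l. hi_part N (snd (i l))) ` {..<n}"
    have finF: "finite F" by (simp add: F_def)
    have "\<forall>b\<in>F. \<exists>c.
      (\<forall>i\<in>block b. l2_inner p (\<lambda>x. g x - (\<Sum>i\<in>block b. c i * gen i x)) (gen i) = 0) \<and>
      (l2_norm p (\<lambda>x. \<Sum>i\<in>block b. c i * gen i x))\<^sup>2
        \<le> C * (\<Sum>i\<in>block b. (cmod (l2_inner p g (gen i)))\<^sup>2)"
    proof
      fix b assume "b \<in> F"
      then obtain l where l: "l < n" "b = hi_part N (snd (i l))" by (auto simp: F_def)
      have "snd (i l) \<in> Ip p" using i[OF l(1)] by auto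
      from P[OF this g] show "\<exists>c.
        (\<forall>i\<in>block b. l2_inner p (\<lambda>x. g x - (\<Sum>i\<in>block b. c i * gen i x)) (gen i) = 0) \<and>
        (l2_norm p (\<lambda>x. \<Sum>i\<in>block b. c i * gen i x))\<^sup>2
          \<le> C * (\<Sum>i\<in>block b. (cmod (l2_inner p g (gen i)))\<^sup>2)" unfolding l(2) .
    qed
    from bchoice[OF this] obtain c where
      c: "\<And>b j. b \<in> F \<Longrightarrow> j \<in> block b \<Longrightarrow> l2_inner p (\<lambda>x. g x - (\<Sum>i\<in>block b. c b i * gen i x)) (gen j) = 0"
      and cn: "\<And>b. b \<in> F \<Longrightarrow> (l2_norm p (\<lambda>x. \<Sum>i\<in>block b. c b i * gen i x))\<^sup>2
        \<le> C * (\<Sum>i\<in>block b. (cmod (l2_inner p g (gen i)))\<^sup>2)"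
      by blast
    define h where "h b = (\<lambda>x. \<Sum>i\<in>block b. c b i * gen i x)" for b
    have genL: "gen j \<in> L2 p" if "j \<in> block b" for j b
      using that gen_L2[of "fst j" "snd j"] by (auto simp: block_def)
    have hL: "h b \<in> L2 p" for b unfolding h_def by (rule L2_comb) (rule genL)
    have block_orth: "l2_inner p (gen j) (gen j') = 0" if "j \<in> block b" "j' \<in> block b'" "b \<noteq> b'" for j j' b b'
      using that inner_gen_block[of "fst j" "fst j'" "snd j" "snd j'"] by (auto simp: block_def)
    have hE0: "l2_inner p (h b') (gen j) = 0" if "j \<in> block b" "b \<noteq> b'" for j b b'
    proof -
      have "l2_inner p (gen j) (h b') = 0"
        unfolding h_def by (rule inner_comb_right[OF genL genL[OF that(1)] block_orth[OF that(1) _ that(2)]])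
      then show ?thesis using inner_commute[of p "h b'" "gen j"] by simp
    qed
    have hh0: "l2_inner p (h b') (h b) = 0" if "b' \<noteq> b" for b b'
      unfolding h_def[of b] by (rule inner_comb_right[OF genL hL hE0[OF _ that[symmetric]]])
    \<comment> \<open>The sum of the blockwise projections is the projection to the joint span:
      against a generator of one block the parts from the other blocks vanish.\<close>
    define H where "H = (\<lambda>x. \<Sum>b\<in>F. h b x)"
    have HL: "H \<in> L2 p" unfolding H_def by (rule L2_sum) (rule hL)
    have gHgen: "l2_inner p (\<lambda>x. g x - H x) (gen j) = 0" if b: "b \<in> F" and j: "j \<in> block b" for b j
    proof -
      have "l2_inner p H (gen j) = (\<Sum>b'\<in>F. l2_inner p (h b') (gen j))"
        unfolding H_def by (rule inner_sum_left[OF hL genL[OF j]])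
      also have "\<dots> = (\<Sum>b'\<in>F. if b' = b then l2_inner p (h b) (gen j) else 0)"
        using hE0[OF j] by (intro sum.cong) auto
      also have "\<dots> = l2_inner p (h b) (gen j)" using finF b by simp
      finally have "l2_inner p (\<lambda>x. g x - H x) (gen j) = l2_inner p (\<lambda>x. g x - h b x) (gen j)"
        by (simp add: inner_diff_left g HL hL genL[OF j])
      then show ?thesis using c[OF b j] by (simp add: h_def)
    qed
    have gHL: "(\<lambda>x. g x - H x) \<in> L2 p" by (intro L2_diff g HL)
    have ghh: "l2_inner p (\<lambda>x. g x - H x) (h b) = 0" if "b \<in> F" for b
      unfolding h_def by (rule inner_comb_right[OF genL gHL gHgen[OF that]])
    have "l2_inner p (\<lambda>x. g x - H x) H = (\<Sum>b\<in>F. l2_inner p (\<lambda>x. g x - H x) (h b))"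
      using inner_sum_right[where g = h and A = F, OF hL gHL] unfolding H_def[symmetric] .
    then have gHH: "l2_inner p (\<lambda>x. g x - H x) H = 0" using ghh by simp
    have iblk: "i l \<in> block (hi_part N (snd (i l)))" "hi_part N (snd (i l)) \<in> F" if "l < n" for l
      using i[OF that] that by (auto simp: block_def F_def)
    have kL: "k \<in> L2 p" unfolding k_eq by (rule L2_comb) (use genL iblk in blast)
    have gHk: "l2_inner p (\<lambda>x. g x - H x) k = 0"
      unfolding k_eq
    proof (rule inner_comb_right[OF _ gHL])
      fix l assume "l \<in> {..<n}"
      then have l: "l < n" by simp
      show "gen (i l) \<in> L2 p" by (rule genL[OF iblk(1)[OF l]])
      show "l2_inner p (\<lambda>x. g x - H x) (gen (i l)) = 0" by (rule gHgen[OF iblk(2)[OF l] iblk(1)[OF l]])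
    qed
    \<comment> \<open>Both H and k lie in the span of the chosen blocks, so by Pythagoras H
      approximates g at least as well as k does.\<close>
    have "l2_inner p (\<lambda>x. g x - H x) (\<lambda>x. H x - k x) = 0"
      using gHH gHk by (simp add: inner_diff_right HL kL gHL)
    from l2_pythagoras[OF gHL L2_diff[OF HL kL] this]
    have "(l2_norm p (\<lambda>x. g x - H x))\<^sup>2 \<le> (l2_norm p (\<lambda>x. g x - k x))\<^sup>2" by simp
    also have "\<dots> \<le> (sqrt \<epsilon>)\<^sup>2" using gk by (intro power_mono) auto
    finally have 1: "(l2_norm p (\<lambda>x. g x - H x))\<^sup>2 \<le> \<epsilon>" using \<epsilon> by simp
    define G where "G = (\<Union>b\<in>F. block b)"
    have disj: "\<forall>b\<in>F. \<forall>b'\<in>F. b \<noteq> b' \<longrightarrow> block b \<inter> block b' = {}" by (auto simp: block_def)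
    have "(l2_norm p H)\<^sup>2 = (\<Sum>b\<in>F. (l2_norm p (h b))\<^sup>2)"
      unfolding H_def by (rule l2_pythagoras_sum[OF finF hL hh0])
    also have "\<dots> \<le> (\<Sum>b\<in>F. C * (\<Sum>i\<in>block b. (cmod (l2_inner p g (gen i)))\<^sup>2))"
      using cn by (intro sum_mono) (auto simp: h_def)
    also have "\<dots> = C * (\<Sum>i\<in>G. (cmod (l2_inner p g (gen i)))\<^sup>2)"
      unfolding G_def using finF finite_block disj
      by (subst sum.UNION_disjoint) (auto simp: sum_distrib_left)
    also have "\<dots> \<le> (C + 1) * (\<Sum>i\<in>G. (cmod (l2_inner p g (gen i)))\<^sup>2)"
      by (intro mult_right_mono sum_nonneg) auto
    finally have "(l2_norm p g)\<^sup>2 \<le> (C + 1) * (\<Sum>i\<in>G. (cmod (l2_inner p g (gen i)))\<^sup>2) + \<epsilon>"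
      using 1 l2_pythagoras[OF gHL HL gHH] by simp
    moreover have "finite G" "G \<subseteq> {1..r} \<times> Ip p"
      using finF finite_block by (auto simp: G_def block_def)
    ultimately show "\<exists>G. finite G \<and> G \<subseteq> {1..r} \<times> Ip p \<and>
        (l2_norm p g)\<^sup>2 \<le> (C + 1) * (\<Sum>i\<in>G. (cmod (l2_inner p g (gen i)))\<^sup>2) + \<epsilon>" by blast
  qed (use C in simp)
qed

text \<open>Outside the support ball g does not affect the inner product, so it is cut off before
  Cauchy-Schwarz. With the full norm of g on the right, the sum over all translates would be
  unbounded.\<close>

lemma upper_bound_single:
  assumes \<nu>: "\<nu> \<in> {1..r}" and a: "a \<in> Ip p" and g: "g \<in> L2 p"
  shows "(cmod (l2_inner p g (gen (\<nu>, a))))\<^sup>2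
    \<le> (l2_norm p (\<psi> \<nu>))\<^sup>2 * (\<integral>x. indicator (cylinder p (- int N) a) x * (cmod (g x))\<^sup>2 \<partial>haar p)"
proof -
  let ?B = "cylinder p (- int N) a"
  have [measurable]: "?B \<in> sets (haar p)" using cyl_in_borel Ip_qp[OF a] by simp
  note [measurable] = L2_D(1)[OF g] L2_D(1)[OF gen_L2[OF \<nu> a]]
  let ?g = "\<lambda>x. indicator ?B x * g x"
  have sq: "(cmod (?g x))\<^sup>2 = indicator ?B x * (cmod (g x))\<^sup>2" for x
    by (simp add: indicator_def)
  have gL: "?g \<in> L2 p"
    unfolding L2_def mem_Collect_eq
  proof
    show "integrable (haar p) (\<lambda>x. (cmod (?g x))\<^sup>2)"
      unfolding sq using integrable_mult_indicator[OF \<open>?B \<in> sets (haar p)\<close> L2_D(2)[OF g]] by simp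
  qed measurable
  have "l2_inner p g (gen (\<nu>, a)) = l2_inner p ?g (gen (\<nu>, a))"
    unfolding l2_inner_def
  proof (rule integral_cong_AE)
    show "AE x in haar p. g x * cnj (gen (\<nu>, a) x) = ?g x * cnj (gen (\<nu>, a) x)"
      using gen_supp[OF \<nu> Ip_qp[OF a]] by eventually_elim (auto simp: indicator_def)
    show "(\<lambda>x. g x * cnj (gen (\<nu>, a) x)) \<in> borel_measurable (haar p)"
      "(\<lambda>x. ?g x * cnj (gen (\<nu>, a) x)) \<in> borel_measurable (haar p)"
      by (intro borel_measurable_integrable integrable_inner g gL gen_L2 \<nu> a)+
  qed
  then have "(cmod (l2_inner p g (gen (\<nu>, a))))\<^sup>2 \<le> (l2_norm p ?g)\<^sup>2 * (l2_norm p (gen (\<nu>, a)))\<^sup>2"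
    using Cauchy_Schwarz_sq[OF gL gen_L2[OF \<nu> a]] by simp
  moreover have "l2_norm p (gen (\<nu>, a)) = l2_norm p (\<psi> \<nu>)"
    unfolding gen_def fst_conv snd_conv
    by (intro norm_eq_if_inner_eq inner_translate Ip_qp a \<psi>_L2 \<nu>)
  ultimately show ?thesis unfolding l2_norm_sq[of p ?g] sq by (simp add: mult.commute)
qed

text \<open>A point lies in at most \<open>card (lo_fracs N)\<close> of the balls, so the local
  masses of g from \<open>upper_bound_single\<close> sum to at most that multiple of its squared
  norm. The other factor is the sum of the squared norms of the generators.\<close>

lemma upper_bound:
  "\<exists>B\<ge>0. \<forall>g\<in>L2 p. \<forall>A. finite A \<longrightarrow> A \<subseteq> Ip p \<longrightarrow>
    (\<Sum>i\<in>{1..r} \<times> A. (cmod (l2_inner p g (gen i)))\<^sup>2) \<le> B * (l2_norm p g)\<^sup>2"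
proof (intro exI conjI ballI allI impI)
  let ?S = "\<Sum>\<nu>=1..r. (l2_norm p (\<psi> \<nu>))\<^sup>2"
  let ?B = "?S * real (card (lo_fracs N))"
  have S0: "0 \<le> ?S" by (intro sum_nonneg) auto
  then show "0 \<le> ?B" by simp
  fix g A assume g: "g \<in> L2 p" and A: "finite A" "A \<subseteq> Ip p"
  let ?f = "\<lambda>a x. indicator (cylinder p (- int N) a) x * (cmod (g x))\<^sup>2"
  have int: "integrable (haar p) (?f a)" if "a \<in> A" for a
    using integrable_mult_indicator[OF _ L2_D(2)[OF g], of "cylinder p (- int N) a"] that A cyl_in_borel[of a] Ip_qp
    by auto
  have count: "(\<Sum>a\<in>A. indicator (cylinder p (- int N) a) x) \<le> real (card (lo_fracs N))" if x: "x \<in> qp p" for x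
  proof -
    have "(\<Sum>a\<in>A. indicator (cylinder p (- int N) a) x) = real (card {a \<in> A. x \<in> cylinder p (- int N) a})"
      using A(1) by (simp add: indicator_def sum.If_cases Int_def)
    also have "card {a \<in> A. x \<in> cylinder p (- int N) a} \<le> card {a \<in> Ip p. hi_part N a = hi_part N x}"
      using A(2) by (intro card_mono card_same_hi) (auto simp: cyl_hi)
    also have "\<dots> \<le> card (lo_fracs N)" by (rule card_same_hi)
    finally show ?thesis by simp
  qed
  have "(\<Sum>a\<in>A. \<integral>x. ?f a x \<partial>haar p) = (\<integral>x. (\<Sum>a\<in>A. ?f a x) \<partial>haar p)"
    using int by (intro Bochner_Integration.integral_sum[symmetric]) auto
  also have "\<dots> \<le> (\<integral>x. real (card (lo_fracs N)) * (cmod (g x))\<^sup>2 \<partial>haar p)"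
  proof (rule integral_mono)
    show "integrable (haar p) (\<lambda>x. \<Sum>a\<in>A. ?f a x)" using int by auto
    show "integrable (haar p) (\<lambda>x. real (card (lo_fracs N)) * (cmod (g x))\<^sup>2)"
      using L2_D(2)[OF g] by simp
    fix x assume "x \<in> space (haar p)"
    then show "(\<Sum>a\<in>A. ?f a x) \<le> real (card (lo_fracs N)) * (cmod (g x))\<^sup>2"
      unfolding sum_distrib_right[symmetric] by (intro mult_right_mono count) auto
  qed
  also have "\<dots> = real (card (lo_fracs N)) * (l2_norm p g)\<^sup>2" by (simp add: l2_norm_sq)
  finally have le: "(\<Sum>a\<in>A. \<integral>x. ?f a x \<partial>haar p) \<le> real (card (lo_fracs N)) * (l2_norm p g)\<^sup>2" .
  have "(\<Sum>i\<in>{1..r} \<times> A. (cmod (l2_inner p g (gen i)))\<^sup>2) = (\<Sum>\<nu>=1..r. \<Sum>a\<in>A. (cmod (l2_inner p g (gen (\<nu>, a))))\<^sup>2)"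
    by (simp add: sum.cartesian_product)
  also have "\<dots> \<le> (\<Sum>\<nu>=1..r. \<Sum>a\<in>A. (l2_norm p (\<psi> \<nu>))\<^sup>2 * (\<integral>x. ?f a x \<partial>haar p))"
    using A(2) g by (intro sum_mono upper_bound_single) auto
  also have "\<dots> = ?S * (\<Sum>a\<in>A. \<integral>x. ?f a x \<partial>haar p)"
    by (simp only: sum_distrib_left[symmetric] sum_distrib_right[symmetric])
  also have "\<dots> \<le> ?S * (real (card (lo_fracs N)) * (l2_norm p g)\<^sup>2)"
    by (intro mult_left_mono le S0)
  finally show "(\<Sum>i\<in>{1..r} \<times> A. (cmod (l2_inner p g (gen i)))\<^sup>2) \<le> ?B * (l2_norm p g)\<^sup>2"
    by (simp add: mult.assoc)
qed

end

text \<open>The scaling axiom moves by one step; iterating it handles positive \<open>j\<close>, and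
  being an equivalence it handles negative \<open>j\<close> too.\<close>

lemma MRA_shift:
  assumes "MRA p V"
  shows "f \<in> V k \<longleftrightarrow> (\<lambda>x. f (qp_scale p j x)) \<in> V (k + j)"
proof -
  have step: "f \<in> V k \<longleftrightarrow> (\<lambda>x. f (qp_scale p 1 x)) \<in> V (k + 1)" for k f
    using assms unfolding MRA_def by blast
  have comp: "qp_scale p i (qp_scale p j x) = qp_scale p (i + j) x" for i j x
    by (simp add: qp_scale_def algebra_simps)
  have pos: "f \<in> V k \<longleftrightarrow> (\<lambda>x. f (qp_scale p (int n) x)) \<in> V (k + int n)" for n k f
  proof (induction n)
    case 0
    then show ?case by (simp add: qp_scale_def)
  next
    case (Suc n)
    then show ?case using step[of "\<lambda>x. f (qp_scale p (int n) x)" "k + int n"]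
      by (simp add: comp algebra_simps)
  qed
  show ?thesis
  proof (cases "0 \<le> j")
    case True
    then show ?thesis using pos[of f k "nat j"] by simp
  next
    case False
    then show ?thesis
      \<comment> \<open>For negative j the positive case is applied to the dilated function, and
        dilating it by -j gives f back.\<close>
      using pos[of "\<lambda>x. f (qp_scale p j x)" "k + j" "nat (- j)"] by (simp add: comp qp_scale_def)
  qed
qed

theorem theorem11:
  fixes p r :: nat
    and V :: "int \<Rightarrow> ((int \<Rightarrow> nat) \<Rightarrow> complex) set"
    and \<psi> :: "nat \<Rightarrow> (int \<Rightarrow> nat) \<Rightarrow> complex"
  assumes "prime p"
    and "MRA p V"
    and "\<forall>\<nu>\<in>{1..r}. \<psi> \<nu> \<in> L2 p \<and> compact_support p (\<psi> \<nu>)"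
    and "Wspace p V 0 =
           l2_closure p (lin_span {(\<lambda>x. \<psi> \<nu> (qp_diff p x a)) | \<nu> a. \<nu> \<in> {1..r} \<and> a \<in> Ip p})"
  shows "frame p ({1..r} \<times> Ip p \<times> (UNIV :: int set))
           (\<lambda>(\<nu>, a, j) x. complex_of_real (real p powr (real_of_int j / 2))
                           * \<psi> \<nu> (qp_diff p (qp_scale p j x) a))"
proof -
  interpret digit_base p
    using assms(1) by unfold_locales (rule prime_ge_2_nat)
  have "\<exists>N. \<forall>\<nu>\<in>{1..r}. \<forall>n\<ge>N \<nu>. AE x in haar p. x \<notin> cylinder p (- int n) (\<lambda>k. 0) \<longrightarrow> \<psi> \<nu> x = 0"
  proof (rule bchoice, rule ballI)
    fix \<nu> assume "\<nu> \<in> {1..r}"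
    then have "compact_support p (\<psi> \<nu>)" using assms(3) by blast
    then show "\<exists>N. \<forall>n\<ge>N. AE x in haar p. x \<notin> cylinder p (- int n) (\<lambda>k. 0) \<longrightarrow> \<psi> \<nu> x = 0"
      by (rule compact_support_cyl) blast
  qed
  then obtain N where N: "\<And>\<nu> n. \<nu> \<in> {1..r} \<Longrightarrow> N \<nu> \<le> n \<Longrightarrow>
      AE x in haar p. x \<notin> cylinder p (- int n) (\<lambda>k. 0) \<longrightarrow> \<psi> \<nu> x = 0" by blast
  \<comment> \<open>A common upper bound of the radii; unlike a maximum, the sum also makes sense
    for r = 0.\<close>
  define M where "M = (\<Sum>\<nu>=1..r. N \<nu>)"
  interpret wavelet_generators p r M \<psi>
  proof
    fix \<nu> assume \<nu>: "\<nu> \<in> {1..r}"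
    show "\<psi> \<nu> \<in> L2 p" using assms(3) \<nu> by blast
    have "N \<nu> \<le> M" unfolding M_def using \<nu> by (intro member_le_sum) auto
    then show "AE x in haar p. x \<notin> cylinder p (- int M) (\<lambda>k. 0) \<longrightarrow> \<psi> \<nu> x = 0"
      by (rule N[OF \<nu>])
  qed
  interpret nested_subspaces p V
    using assms(2) unfolding MRA_def by unfold_locales blast+
  let ?I = "{1..r} \<times> Ip p"
  let ?e = "\<lambda>(\<nu>, a, j) x. complex_of_real (real p powr (real_of_int j / 2))
    * \<psi> \<nu> (qp_diff p (qp_scale p j x) a)"
  have e: "?e (\<nu>, a, j) = dilate j (gen (\<nu>, a))" for \<nu> a j
    by (simp add: dilate_def gen_def fun_eq_iff)
  have "{(\<lambda>x. \<psi> \<nu> (qp_diff p x a)) | \<nu> a. \<nu> \<in> {1..r} \<and> a \<in> Ip p} = {gen i | i. i \<in> ?I}"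
    by (auto simp: gen_def)
  then have W: "Wspace p V 0 = l2_closure p (lin_span {gen i | i. i \<in> ?I})"
    using assms(4) by simp
  have genL: "gen i \<in> L2 p" if "i \<in> ?I" for i
    using that gen_L2[of "fst i" "snd i"] by auto
  have genW: "gen i \<in> Wspace p V 0" if i: "i \<in> ?I" for i
  proof -
    have "gen i \<in> {gen i | i. i \<in> ?I}" using i by blast
    then have "gen i \<in> lin_span {gen i | i. i \<in> ?I}" by (rule lin_span_superset)
    then show ?thesis unfolding W l2_closure_def using genL[OF i]
      by (auto intro!: bexI[of _ "gen i"])
  qed
  from lower_bound obtain C where C: "0 < C"
    and lo_fracs: "\<And>g \<epsilon>. g \<in> Wspace p V 0 \<Longrightarrow> 0 < \<epsilon> \<Longrightarrow> \<exists>G. finite G \<and> G \<subseteq> ?I \<and>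
      (l2_norm p g)\<^sup>2 \<le> C * (\<Sum>i\<in>G. (cmod (l2_inner p g (gen i)))\<^sup>2) + \<epsilon>"
    unfolding W[symmetric] by blast
  from upper_bound obtain B where B: "0 \<le> B"
    and up: "\<And>g A. g \<in> L2 p \<Longrightarrow> finite A \<Longrightarrow> A \<subseteq> Ip p \<Longrightarrow>
      (\<Sum>i\<in>{1..r} \<times> A. (cmod (l2_inner p g (gen i)))\<^sup>2) \<le> B * (l2_norm p g)\<^sup>2"
    by blast
  have main: "(\<lambda>i. (cmod (l2_inner p f (?e i)))\<^sup>2) summable_on {1..r} \<times> Ip p \<times> UNIV \<and>
      (l2_norm p f)\<^sup>2 \<le> C * (\<Sum>\<^sub>\<infinity>i\<in>{1..r} \<times> Ip p \<times> UNIV. (cmod (l2_inner p f (?e i)))\<^sup>2) \<and>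
      (\<Sum>\<^sub>\<infinity>i\<in>{1..r} \<times> Ip p \<times> UNIV. (cmod (l2_inner p f (?e i)))\<^sup>2) \<le> B * (l2_norm p f)\<^sup>2"
    if f: "f \<in> L2 p" for f
  proof -
    have "\<forall>j. \<exists>g. g \<in> V j \<and> (\<forall>h\<in>V j. l2_inner p (\<lambda>x. f x - g x) h = 0)"
      using projection_exists[OF closed f] by metis
    then obtain v where vV: "\<And>j. v j \<in> V j"
      and proj: "\<And>j h. h \<in> V j \<Longrightarrow> l2_inner p (\<lambda>x. f x - v j x) h = 0"
      by metis
    note vL = V_L2[OF vV]
    define w where "w j = (\<lambda>x. v (j + 1) x - v j x)" for j
    \<comment> \<open>The component of f at scale j, brought back to scale 0. The bounds for
      \<open>Wspace p V 0\<close> then apply to it, with constants independent of j.\<close>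
    define u where "u j = dilate (- j) (w j)" for j
    have wL: "w j \<in> L2 p" for j unfolding w_def by (intro L2_diff vL)
    have uL: "u j \<in> L2 p" for j unfolding u_def by (intro L2_dil wL)
    have w_dil: "w j = dilate j (u j)" for j by (simp add: u_def dilate_dilate)
    have norm_u: "l2_norm p (u j) = l2_norm p (w j)" for j
      unfolding u_def by (rule norm_dil[OF wL])
    have dilV: "dilate j h \<in> V (k + j)" if "h \<in> V k" for h j k
      unfolding dilate_def using that MRA_shift[OF assms(2), of h k j]
      by (intro closed_subspaceD(4)[OF closed]) simp
    have uW: "u j \<in> Wspace p V 0" for j
      unfolding Wspace_def
    proof (intro CollectI conjI ballI)
      have "w j \<in> V (j + 1)"
        unfolding w_def using vV V_mono[of j "j + 1"] by (intro V_diff) auto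
      from dilV[OF this, of "- j"] show "u j \<in> V (0 + 1)" by (simp add: u_def)
      fix g assume g: "g \<in> V 0"
      have "l2_inner p (u j) g = l2_inner p (w j) (dilate j g)"
        unfolding w_dil by (rule inner_dil[symmetric, OF uL V_L2[OF g]])
      also have "\<dots> = 0"
        unfolding w_def using dilV[OF g, of j] by (intro proj_diff_orth[OF f vV proj]) auto
      finally show "l2_inner p (u j) g = 0" .
    qed
    \<comment> \<open>Against a wavelet at scale j only the component of f at that scale counts: the
      wavelet lies in V (j + 1), so f may be replaced by v (j + 1), and it is orthogonal to V j, so
      v j may be subtracted.\<close>
    have fe: "l2_inner p f (dilate j h) = l2_inner p (u j) h" if h: "h \<in> Wspace p V 0" for h j
    proof -
      have hV: "h \<in> V 1" and h0: "\<And>g. g \<in> V 0 \<Longrightarrow> l2_inner p h g = 0"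
        using h by (auto simp: Wspace_def)
      have hL: "h \<in> L2 p" by (rule V_L2[OF hV])
      have dV: "dilate j h \<in> V (j + 1)" using dilV[OF hV, of j] by (simp add: add.commute)
      have dL: "dilate j h \<in> L2 p" by (rule L2_dil[OF hL])
      have 1: "l2_inner p f (dilate j h) = l2_inner p (v (j + 1)) (dilate j h)"
        using proj[OF dV] by (simp add: inner_diff_left f vL dL)
      have "l2_inner p (v j) (dilate j h) = l2_inner p (dilate (- j) (v j)) (dilate (- j) (dilate j h))"
        by (rule inner_dil[symmetric, OF vL dL])
      also have "\<dots> = l2_inner p (dilate (- j) (v j)) h"
        using dilate_dilate[of "- j" h] by simp
      also have "\<dots> = 0"
        using h0[OF dilV[OF vV[of j], of "- j", simplified]] inner_commute[of p "dilate (- j) (v j)" h] by simp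
      finally have "l2_inner p f (dilate j h) = l2_inner p (w j) (dilate j h)"
        unfolding 1 w_def by (simp add: inner_diff_left vL dL)
      also have "\<dots> = l2_inner p (u j) h"
        unfolding w_dil by (rule inner_dil[OF uL hL])
      finally show ?thesis .
    qed
    let ?q = "\<lambda>i. (cmod (l2_inner p f (?e i)))\<^sup>2"
    have q: "?q (\<nu>, a, j) = (cmod (l2_inner p (u j) (gen (\<nu>, a))))\<^sup>2" if "(\<nu>, a) \<in> ?I" for \<nu> a j
      unfolding e fe[OF genW[OF that]] ..
    have bound: "sum ?q F \<le> B * (l2_norm p f)\<^sup>2"
      if F: "finite F" "F \<subseteq> {1..r} \<times> Ip p \<times> UNIV" for F
    proof -
      \<comment> \<open>The finite set F is enclosed in a box of scales, generators and translates,
        since \<open>upper_bound\<close> and \<open>sum_le_norm\<close> are stated for full ranges.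
        The added 1 in \<open>n\<close> is for the excluded upper end of the scales.\<close>
      define A where "A = (\<lambda>(\<nu>, a, j). a) ` F"
      define n where "n = (\<Sum>(\<nu>, a, j)\<in>F. nat \<bar>j\<bar> + 1)"
      have A: "finite A" "A \<subseteq> Ip p" using F by (auto simp: A_def)
      have j: "j \<in> {- int n..<int n}" if "(\<nu>, a, j) \<in> F" for \<nu> a j
      proof -
        have "nat \<bar>j\<bar> + 1 \<le> n"
          unfolding n_def using member_le_sum[OF that, of "\<lambda>(\<nu>, a, j). nat \<bar>j\<bar> + 1"] F(1) by auto
        then show ?thesis by auto
      qed
      let ?F' = "(\<lambda>(j, \<nu>, a). (\<nu>, a, j)) ` ({- int n..<int n} \<times> ({1..r} \<times> A))"
      have "F \<subseteq> ?F'"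
      proof
        fix x assume x: "x \<in> F"
        obtain \<nu> a k where x_eq: "x = (\<nu>, a, k)" by (cases x)
        have "a \<in> A" using x unfolding A_def x_eq by force
        then show "x \<in> ?F'" using x F(2) j[of \<nu> a k] unfolding x_eq by force
      qed
      then have "sum ?q F \<le> sum ?q ?F'" by (intro sum_mono2) (use A in auto)
      also have "\<dots> = (\<Sum>j\<in>{- int n..<int n}. \<Sum>i\<in>{1..r} \<times> A. ?q (fst i, snd i, j))"
        by (subst sum.reindex) (auto simp: inj_on_def sum.cartesian_product split_def)
      also have "\<dots> = (\<Sum>j\<in>{- int n..<int n}. \<Sum>i\<in>{1..r} \<times> A. (cmod (l2_inner p (u j) (gen i)))\<^sup>2)"
      proof (intro sum.cong refl)
        fix j i assume "i \<in> {1..r} \<times> A"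
        then have "(fst i, snd i) \<in> ?I" using A(2) by auto
        from q[OF this, of j] show "?q (fst i, snd i, j) = (cmod (l2_inner p (u j) (gen i)))\<^sup>2" by simp
      qed
      also have "\<dots> \<le> (\<Sum>j\<in>{- int n..<int n}. B * (l2_norm p (u j))\<^sup>2)"
        by (intro sum_mono up uL A)
      also have "\<dots> = B * (\<Sum>j\<in>{- int n..<int n}. (l2_norm p (w j))\<^sup>2)"
        by (simp add: norm_u sum_distrib_left)
      also have "\<dots> \<le> B * (l2_norm p f)\<^sup>2"
        unfolding w_def by (intro mult_left_mono B sum_le_norm[OF f vV proj])
      finally show ?thesis .
    qed
    have summ: "?q summable_on {1..r} \<times> Ip p \<times> UNIV"
      by (rule nonneg_bdd_above_summable_on) (use bound in \<open>auto intro!: bdd_aboveI2\<close>)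
    moreover have "infsum ?q ({1..r} \<times> Ip p \<times> UNIV) \<le> B * (l2_norm p f)\<^sup>2"
      by (rule infsum_le_finite_sums[OF summ]) (use bound in auto)
    moreover have "(l2_norm p f)\<^sup>2 \<le> C * infsum ?q ({1..r} \<times> Ip p \<times> UNIV)"
    proof (rule field_le_epsilon)
      fix \<delta> :: real assume \<delta>: "0 < \<delta>"
      obtain n :: nat where n: "(l2_norm p f)\<^sup>2 - \<delta> / 2 \<le> (\<Sum>j\<in>{- int n..<int n}. (l2_norm p (w j))\<^sup>2)"
        using norm_le_sum[OF f vV proj, of "\<delta> / 2"] \<delta> unfolding w_def by auto
      \<comment> \<open>Half of the error was spent on the truncation of scales; the other half is
        spread over the 2 n scales that remain. The extra 1 avoids division by zero for n =
        0.\<close>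
      define \<epsilon> where "\<epsilon> = \<delta> / (2 * (2 * real n + 1))"
      have \<epsilon>: "0 < \<epsilon>" using \<delta> by (simp add: \<epsilon>_def)
      have "\<forall>j. \<exists>G. finite G \<and> G \<subseteq> ?I \<and>
          (l2_norm p (u j))\<^sup>2 \<le> C * (\<Sum>i\<in>G. (cmod (l2_inner p (u j) (gen i)))\<^sup>2) + \<epsilon>"
        using lo_fracs[OF uW \<epsilon>] by blast
      then obtain G where G: "\<And>j. finite (G j)" "\<And>j. G j \<subseteq> ?I"
        "\<And>j. (l2_norm p (u j))\<^sup>2 \<le> C * (\<Sum>i\<in>G j. (cmod (l2_inner p (u j) (gen i)))\<^sup>2) + \<epsilon>"
        by metis
      define F where "F = (\<lambda>(j, \<nu>, a). (\<nu>, a, j)) ` (SIGMA j:{- int n..<int n}. G j)"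
      have F: "finite F" "F \<subseteq> {1..r} \<times> Ip p \<times> UNIV" using G(1,2) by (fastforce simp: F_def)+
      have "sum ?q F = (\<Sum>j\<in>{- int n..<int n}. \<Sum>i\<in>G j. ?q (fst i, snd i, j))"
        unfolding F_def using G(1)
        by (subst sum.reindex) (auto simp: inj_on_def sum.Sigma split_def)
      also have "\<dots> = (\<Sum>j\<in>{- int n..<int n}. \<Sum>i\<in>G j. (cmod (l2_inner p (u j) (gen i)))\<^sup>2)"
      proof (intro sum.cong refl)
        fix j i assume "i \<in> G j"
        then have "(fst i, snd i) \<in> ?I" using G(2) by force
        from q[OF this, of j] show "?q (fst i, snd i, j) = (cmod (l2_inner p (u j) (gen i)))\<^sup>2" by simp
      qed
      finally have sF: "sum ?q F = (\<Sum>j\<in>{- int n..<int n}. \<Sum>i\<in>G j. (cmod (l2_inner p (u j) (gen i)))\<^sup>2)" .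
      have "(\<Sum>j\<in>{- int n..<int n}. (l2_norm p (w j))\<^sup>2)
          \<le> (\<Sum>j\<in>{- int n..<int n}. C * (\<Sum>i\<in>G j. (cmod (l2_inner p (u j) (gen i)))\<^sup>2) + \<epsilon>)"
        unfolding norm_u[symmetric] by (intro sum_mono G(3))
      also have "\<dots> = C * sum ?q F + 2 * real n * \<epsilon>"
        unfolding sF by (simp add: sum.distrib sum_distrib_left)
      also have "2 * real n * \<epsilon> \<le> (2 * real n + 1) * \<epsilon>" using \<epsilon> by (intro mult_right_mono) auto
      also have "(2 * real n + 1) * \<epsilon> = \<delta> / 2" by (simp add: \<epsilon>_def field_simps)
      also have "sum ?q F \<le> infsum ?q ({1..r} \<times> Ip p \<times> UNIV)"
        by (rule finite_sum_le_infsum[OF summ F]) auto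
      finally show "(l2_norm p f)\<^sup>2 \<le> C * infsum ?q ({1..r} \<times> Ip p \<times> UNIV) + \<delta>"
        using n C by simp
    qed
    ultimately show ?thesis by blast
  qed
  show ?thesis
    unfolding frame_def
  proof (intro conjI ballI; (rule exI[of _ "1 / C"], rule exI[of _ "B + 1 / C"], intro conjI ballI)?)
    show "countable ({1..r} \<times> Ip p \<times> (UNIV :: int set))"
      by (intro countable_SIGMA countable_Ip) auto
    show "?e i \<in> L2 p" if "i \<in> {1..r} \<times> Ip p \<times> (UNIV :: int set)" for i
    proof -
      obtain \<nu> a j where i: "i = (\<nu>, a, j)" by (cases i)
      show ?thesis unfolding i e using that i by (intro L2_dil gen_L2) auto
    qed
    \<comment> \<open>The upper constant is enlarged by 1 / C so that the order of the two constants
      holds without exhibiting a function of nonzero norm.\<close>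
    show "0 < 1 / C" "1 / C \<le> B + 1 / C" using C B by auto
    fix f assume f: "f \<in> L2 p"
    let ?s = "\<Sum>\<^sub>\<infinity>i\<in>{1..r} \<times> Ip p \<times> UNIV. (cmod (l2_inner p f (?e i)))\<^sup>2"
    show "(\<lambda>i. (cmod (l2_inner p f (?e i)))\<^sup>2) summable_on {1..r} \<times> Ip p \<times> UNIV"
      using main[OF f] by blast
    have 1: "(l2_norm p f)\<^sup>2 \<le> C * ?s" and 2: "?s \<le> B * (l2_norm p f)\<^sup>2" using main[OF f] by blast+
    show "1 / C * (l2_norm p f)\<^sup>2 \<le> ?s" using 1 C by (simp add: field_simps)
    have "0 \<le> 1 / C * (l2_norm p f)\<^sup>2" using C by simp
    then show "?s \<le> (B + 1 / C) * (l2_norm p f)\<^sup>2" using 2 unfolding distrib_right by linarith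
  qed
qed

end
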